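(* Let $n$ be a positive integer, let $\alpha,\beta>-1$ be real, let $\delta>0$, let $\nu\in\mathbb{C}$ with $\operatorname{Re}\nu<n$, and let $f:\mathbb{R}\to\mathbb{C}$ be a continuous function such that for some $\varepsilon>0$ one has $f(x)=O\big(x^{\operatorname{Re}\nu-n-\varepsilon}\big)$ as $x\to\infty$. Then for every $x\in\mathbb{R}$ the approximate fractional Jacobi derivative of $f$ satisfies $$W_{\delta,\alpha,\beta}^{\nu,n}[f](x)=\frac{1}{\Gamma(-\nu)}\frac{1}{\delta^{\nu}}\int_{1}^{\infty}f(x+\delta y)\,\frac{1}{(y+1)^{\nu+1}}\,F\!\left(\nu+1,\,n+\beta+1;\,2n+\alpha+\beta+2;\,\frac{2}{y+1}\right)dy$$ $$+\frac{\Gamma(2n+\alpha+\beta+2)}{2^{2n-\nu+\alpha+\beta+1}\,\Gamma(n+\alpha+1)\,\Gamma(n-\nu+\beta+1)}\frac{1}{\delta^{\nu}}\int_{-1}^{1}f(x+\delta y)\,(1-y)^{n+\alpha-\nu}(1+y)^{n+\beta-\nu}\,F\!\left(-\nu,\,2n-\nu+\alpha+\beta+1;\,n-\nu+\beta+1;\,\frac{1+y}{2}\right)dy .$$ Moreover, by continuity the formula is also valid for $\operatorname{Re}\nu=n$ (with the same decay condition on $f$), where the left-hand side is then understood as the limit of $W_{\delta,\alpha,\beta}^{\mu,n}[f](x)$ as $\mu\to\nu$ with $\operatorname{Re}\mu<n$.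
   Context: $F(a,b;c;z)$ denotes the Gauss hypergeometric function ${}_2F_1$, and $1/\Gamma(-\nu)$ is taken to be $0$ when $\nu$ is a nonnegative integer. Weyl fractional integral: for $\operatorname{Re}\mu>0$ and $f$ with $f(x)=O(x^{-\operatorname{Re}\mu-\varepsilon})$ as $x\to\infty$ for some $\varepsilon>0$, $$W^{-\mu}[f](x)=\frac{1}{\Gamma(\mu)}\int_x^\infty f(y)(y-x)^{\mu-1}\,dy .$$ Approximate orthogonal (Jacobi) derivative: let $P_n^{(\alpha,\beta)}$ be the Jacobi polynomial of degree $n$ (orthogonal on $[-1,1]$ with respect to $(1-\xi)^\alpha(1+\xi)^\beta d\xi$, standard normalization), let $h_n=\int_{-1}^1 P_n^{(\alpha,\beta)}(\xi)^2(1-\xi)^\alpha(1+\xi)^\beta d\xi$ and let $k_n$ be its leading coefficient. For a continuous function $g$ put $$D_{\delta,\alpha,\beta}^n[g](x)=\frac{k_n\,n!}{h_n}\frac{1}{\delta^n}\int_{-1}^{1}g(x+\delta\xi)\,P_n^{(\alpha,\beta)}(\xi)\,(1-\xi)^\alpha(1+\xi)^\beta\,d\xi .$$ Approximate fractional Jacobi derivative: for $\operatorname{Re}\nu<n$, $$W_{\delta,\alpha,\beta}^{\nu,n}[f](x):=(-1)^n D_{\delta,\alpha,\beta}^n\big[W^{\nu-n}[f]\big](x).$$ *)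

theory Defs
  imports "HOL-Analysis.Analysis" "HOL-Library.Landau_Symbols"
begin

text \<open>The Gauss series, which represents \<open>F(a,b;c;z)\<close> for \<open>norm z < 1\<close> only (no analytic
  continuation is provided).\<close>

definition hyp2F1 :: "complex \<Rightarrow> complex \<Rightarrow> complex \<Rightarrow> complex \<Rightarrow> complex" where
  "hyp2F1 a b c z = eval_fps (fps_hypergeo [a, b] [c] 1) z"

lemma hyp2F1_series:
  "hyp2F1 a b c z = (\<Sum>k. pochhammer a k * pochhammer b k / (pochhammer c k * fact k) * z ^ k)"
  by (simp add: hyp2F1_def eval_fps_def)

definition weyl_integral :: "complex \<Rightarrow> (real \<Rightarrow> complex) \<Rightarrow> real \<Rightarrow> complex" where
  "weyl_integral \<mu> f x =
     1 / Gamma \<mu> * (LBINT y:{x<..}. f y * complex_of_real (y - x) powr (\<mu> - 1))"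

definition jacobi_weight :: "real \<Rightarrow> real \<Rightarrow> real \<Rightarrow> real" where
  "jacobi_weight \<alpha> \<beta> \<xi> = (1 - \<xi>) powr \<alpha> * (1 + \<xi>) powr \<beta>"

text \<open>The last conjunct is the standard normalization
  \<open>P\<^sub>n(1) = (\<alpha> + 1) \<cdots> (\<alpha> + n) / n!\<close>. For \<open>\<alpha>, \<beta> > -1\<close> the three conditions determine the
  polynomial uniquely.\<close>

definition jacobi_poly :: "nat \<Rightarrow> real \<Rightarrow> real \<Rightarrow> real poly" where
  "jacobi_poly n \<alpha> \<beta> = (THE p. degree p = n \<and>
     (\<forall>q. degree q < n \<longrightarrow>
        (LBINT \<xi>:{-1..1}. poly p \<xi> * poly q \<xi> * jacobi_weight \<alpha> \<beta> \<xi>) = 0) \<and>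
     poly p 1 = (\<alpha> + of_nat n) gchoose n)"

definition jacobi_h :: "nat \<Rightarrow> real \<Rightarrow> real \<Rightarrow> real" where
  "jacobi_h n \<alpha> \<beta> =
     (LBINT \<xi>:{-1..1}. (poly (jacobi_poly n \<alpha> \<beta>) \<xi>)\<^sup>2 * jacobi_weight \<alpha> \<beta> \<xi>)"

definition jacobi_k :: "nat \<Rightarrow> real \<Rightarrow> real \<Rightarrow> real" where
  "jacobi_k n \<alpha> \<beta> = lead_coeff (jacobi_poly n \<alpha> \<beta>)"

definition jacobi_deriv ::
    "real \<Rightarrow> real \<Rightarrow> real \<Rightarrow> nat \<Rightarrow> (real \<Rightarrow> complex) \<Rightarrow> real \<Rightarrow> complex" where
  "jacobi_deriv \<delta> \<alpha> \<beta> n g x =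
     complex_of_real (jacobi_k n \<alpha> \<beta> * fact n / jacobi_h n \<alpha> \<beta> * (1 / \<delta> ^ n)) *
     (LBINT \<xi>:{-1..1}. g (x + \<delta> * \<xi>) *
        complex_of_real (poly (jacobi_poly n \<alpha> \<beta>) \<xi> * jacobi_weight \<alpha> \<beta> \<xi>))"

definition frac_jacobi_deriv ::
    "real \<Rightarrow> real \<Rightarrow> real \<Rightarrow> complex \<Rightarrow> nat \<Rightarrow> (real \<Rightarrow> complex) \<Rightarrow> real \<Rightarrow> complex" where
  "frac_jacobi_deriv \<delta> \<alpha> \<beta> \<nu> n f x =
     (-1) ^ n * jacobi_deriv \<delta> \<alpha> \<beta> n (weyl_integral (of_nat n - \<nu>) f) x"

end

theory Submission imports Defs begin

text \<open>
  In the coordinate \<open>\<xi> = 2t - 1\<close>, Rodrigues' formula writes the Jacobi polynomial times its weight as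
  an \<open>n\<close>-th derivative of \<open>t^(n+\<beta>) (1-t)^(n+\<alpha>)\<close>. Interchanging the two integrations turns the
  approximate derivative of the Weyl integral of order \<open>\<nu> - n\<close> into \<open>\<integral> F(r) K(r) dr\<close>, where
  \<open>F(r) = f(x - \<delta> + 2\<delta>r)\<close> and \<open>K\<close> is the fractional integral of order \<open>n - \<nu>\<close> of that
  \<open>n\<close>-th derivative. For \<open>r > 1\<close> integration by parts \<open>n\<close> times leads to Euler's integral for the
  hypergeometric function; for \<open>0 < r < 1\<close> the power series of \<open>(1-t)^(n+\<alpha>)\<close> is integrated term by
  term, and Euler's transformation gives the stated form. Both parts of the kernel have integrable
  majorants that do not depend on \<open>\<nu>\<close> as long as \<open>Re \<nu> \<le> n\<close>, which gives the limiting case by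
  dominated convergence.
\<close>

text \<open>The point r = 1 shapes the proof. For r > 1 the function (r-t)^(n-\<nu>-1) is smooth on
  [0,1], so all n derivatives can be moved onto it. For r < 1 it is singular at t = r and each
  derivative would worsen the singularity; the series used instead only has to converge up to t = r.
  In both cases the argument of F stays below 1, so the Gauss series suffices. At Re \<nu> = n both
  series can blow up at r = 1, like |1-r|^\<alpha> when \<alpha> < 0; hence the majorants must allow
  an integrable singularity there.

  The limit exists because the factor 1/Gamma(n-\<nu>) of the Weyl integral cancels: the left part
  of the kernel carries Gamma(n-\<nu>), the right part carries (-\<nu>)_n =
  Gamma(n-\<nu>)/Gamma(-\<nu>). Only reciprocal Gamma functions of \<nu> remain, and these are
  continuous up to Re \<nu> = n, although the Weyl integral itself is in general no longer
  absolutely convergent there.\<close>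

section \<open>Fractional integrals and the complex Beta integral\<close>

text \<open>With \<open>of_real_diff\<close> active, the base of \<open>complex_of_real (r - t) powr a\<close> would no longer be visibly real.\<close>

declare of_real_diff [simp del]

lemma borel_measurable_of_real_powr [measurable]:
  fixes a :: complex
  assumes [measurable]: "g \<in> borel_measurable M"
  shows "(\<lambda>x. complex_of_real (g x) powr a) \<in> borel_measurable M"
proof -
  have "(\<lambda>x. complex_of_real (g x) powr a) =
      (\<lambda>x. if g x = 0 then 0 else if g x < 0
        then exp (a * (complex_of_real (ln (-g x)) + complex_of_real pi * \<i>))
        else exp (a * complex_of_real (ln (g x))))"
    by (auto simp: powr_def Ln_of_real fun_eq_iff Ln_of_real')
  also have "\<dots> \<in> borel_measurable M" by measurable
  finally show ?thesis .
qed

lemma norm_of_real_powr: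
  fixes a :: complex
  assumes "x > 0"
  shows "norm (complex_of_real x powr a) = x powr Re a"
  using assms by (simp add: norm_powr_real_powr)

lemma Re_pos_not_nonpos_Ints:
  fixes z :: complex
  assumes "Re z > 0"
  shows "z \<notin> \<int>\<^sub>\<le>\<^sub>0"
  using assms by (auto elim!: nonpos_Ints_cases)

text \<open>Absolute convergence over the half plane t < r comes from the substitution r = t + s,
  after which \<open>h\<close> majorizes the inner integral of the norms. Inner integrability is
  asked only where \<open>w\<close> is nonzero, because the function integrated later is controlled
  only to the right of 0. The first conclusion later supplies measurability in r.\<close>

lemma fractional_fubini:
  fixes w f :: "real \<Rightarrow> complex" and h :: "real \<Rightarrow> real" and \<mu> :: complex
  assumes [measurable]: "w \<in> borel_measurable borel" "f \<in> borel_measurable borel"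
    and h: "integrable lborel h"
    and int: "\<And>t. w t \<noteq> 0 \<Longrightarrow>
      set_integrable lborel {0<..} (\<lambda>s. norm (f (t + s)) * s powr (Re \<mu> - 1))"
    and bound: "\<And>t. norm (w t) *
      (LBINT s:{0<..}. norm (f (t + s)) * s powr (Re \<mu> - 1)) \<le> h t"
  shows "integrable lborel
      (\<lambda>r. f r * (LBINT t:{..<r}. w t * complex_of_real (r - t) powr (\<mu> - 1)))"
    and "(LBINT t. w t * (LBINT r:{t<..}. f r * complex_of_real (r - t) powr (\<mu> - 1))) =
      (LBINT r. f r * (LBINT t:{..<r}. w t * complex_of_real (r - t) powr (\<mu> - 1)))"
proof -
  define G where "G = (\<lambda>(t, r). indicator {0<..} (r - t) *\<^sub>R
      (w t * f r * complex_of_real (r - t) powr (\<mu> - 1)))"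
  have G_meas [measurable]: "G \<in> borel_measurable (lborel \<Otimes>\<^sub>M lborel)"
    unfolding G_def by measurable
  have norm_G: "norm (G (t, t + s)) =
      norm (w t) * (indicator {0<..} s *\<^sub>R (norm (f (t + s)) * s powr (Re \<mu> - 1)))" for t s
    by (auto simp: G_def norm_mult norm_of_real_powr indicator_def)
  have G_int: "integrable lborel (\<lambda>r. G (t, r))" for t
  proof -
    have "integrable lborel (\<lambda>s. norm (G (t, t + s)))"
      unfolding norm_G using int[of t] by (cases "w t = 0") (auto simp: set_integrable_def)
    hence "integrable lborel (\<lambda>s. G (t, t + 1 * s))"
      by (subst (asm) integrable_norm_iff) simp_all
    thus ?thesis
      by (subst (asm) lborel_integrable_real_affine_iff) auto
  qed
  have norm_int: "(LBINT r. norm (G (t, r))) =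
      norm (w t) * (LBINT s:{0<..}. norm (f (t + s)) * s powr (Re \<mu> - 1))" for t
  proof -
    have "(LBINT r. norm (G (t, r))) = (LBINT s. norm (G (t, t + 1 * s)))"
      by (subst lborel_integral_real_affine[where c = 1 and t = t]) auto
    thus ?thesis
      by (simp add: norm_G set_lebesgue_integral_def)
  qed
  have "integrable (lborel \<Otimes>\<^sub>M lborel) G"
  proof (rule lborel_pair.Fubini_integrable)
    show "integrable lborel (\<lambda>t. LBINT r. norm (G (t, r)))"
    proof (rule Bochner_Integration.integrable_bound[OF h])
      show "AE t in lborel. norm (LBINT r. norm (G (t, r))) \<le> norm (h t)"
        using bound by (auto simp: norm_int intro!: AE_I2 order_trans[OF _ abs_ge_self])
          (smt (verit) bound integral_nonneg_AE norm_int norm_ge_zero AE_I2)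
    qed measurable
  qed (use G_int in auto)
  hence G_int2: "integrable (lborel \<Otimes>\<^sub>M lborel) (\<lambda>(t, r). G (t, r))"
    by simp
  have left: "(LBINT r. G (t, r)) =
      w t * (LBINT r:{t<..}. f r * complex_of_real (r - t) powr (\<mu> - 1))" for t
    unfolding set_lebesgue_integral_def
    by (subst integral_mult_right_zero [symmetric], rule Bochner_Integration.integral_cong)
       (auto simp: G_def indicator_def)
  have right: "(LBINT t. G (t, r)) =
      f r * (LBINT t:{..<r}. w t * complex_of_real (r - t) powr (\<mu> - 1))" for r
    unfolding set_lebesgue_integral_def
    by (subst integral_mult_right_zero [symmetric], rule Bochner_Integration.integral_cong)
       (auto simp: G_def indicator_def)
  show "integrable lborel
      (\<lambda>r. f r * (LBINT t:{..<r}. w t * complex_of_real (r - t) powr (\<mu> - 1)))"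
    using lborel_pair.integrable_snd[OF G_int2] by (simp add: right)
  show "(LBINT t. w t * (LBINT r:{t<..}. f r * complex_of_real (r - t) powr (\<mu> - 1))) =
      (LBINT r. f r * (LBINT t:{..<r}. w t * complex_of_real (r - t) powr (\<mu> - 1)))"
    using lborel_pair.Fubini_integral[OF G_int2] by (simp add: left right)
qed

text \<open>The Gamma integral is available as a gauge integral, with absolute integrability over
  the completed measure; Borel measurability of the integrand brings it to
  \<open>lborel\<close>.\<close>

lemma
  fixes z :: complex
  assumes "Re z > 0"
  shows set_integrable_Gamma:
      "set_integrable lborel {0<..} (\<lambda>s. complex_of_real s powr (z - 1) * of_real (exp (-s)))"
    and LBINT_Gamma:
      "(LBINT s:{0<..}. complex_of_real s powr (z - 1) * of_real (exp (-s))) = Gamma z"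
proof -
  have eq: "(\<lambda>s. complex_of_real s powr (z - 1) * of_real (exp (-s))) =
      (\<lambda>s. complex_of_real s powr (z - 1) / of_real (exp s))"
    by (simp add: exp_minus field_simps)
  show I: "set_integrable lborel {0<..} (\<lambda>s. complex_of_real s powr (z - 1) * of_real (exp (-s)))"
  proof -
    have "(\<lambda>s. indicator {0<..} s *\<^sub>R (complex_of_real s powr (z - 1) * of_real (exp (-s))))
        \<in> borel_measurable lborel" by simp
    thus ?thesis
      using absolutely_integrable_Gamma_integral'[OF assms]
      unfolding eq set_integrable_def by (simp add: integrable_completion)
  qed
  show "(LBINT s:{0<..}. complex_of_real s powr (z - 1) * of_real (exp (-s))) = Gamma z"
    using set_borel_integral_eq_integral(2)[OF I] Gamma_integral_complex'[OF assms]
    by (simp add: eq has_integral_integrable_integral)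
qed

lemma set_integrable_norm_iff:
  fixes f :: "'a \<Rightarrow> 'b :: {banach, second_countable_topology}"
  assumes "set_borel_measurable M A f"
  shows "set_integrable M A (\<lambda>x. norm (f x)) \<longleftrightarrow> set_integrable M A f"
proof -
  have "(\<lambda>x. indicator A x *\<^sub>R norm (f x)) = (\<lambda>x. norm (indicator A x *\<^sub>R f x))"
    by auto
  thus ?thesis
    using assms unfolding set_integrable_def set_borel_measurable_def
    by (simp only: integrable_norm_iff)
qed

lemma set_integrable_Beta:
  fixes b :: complex
  assumes "a > 0" "Re b > 0"
  shows "set_integrable lborel {0<..<1}
    (\<lambda>t. complex_of_real (t powr (a - 1)) * complex_of_real (1 - t) powr (b - 1))"
proof -
  have "set_integrable lborel {0<..<1} (\<lambda>t. t powr (a - 1) * (1 - t) powr (Re b - 1))"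
    by (rule set_integrable_subset[OF integrable_Beta]) (use assms in auto)
  also have "?this \<longleftrightarrow> set_integrable lborel {0<..<1}
      (\<lambda>t. norm (complex_of_real (t powr (a - 1)) * complex_of_real (1 - t) powr (b - 1)))"
    by (intro set_integrable_cong) (auto simp: norm_mult norm_of_real_powr)
  finally show ?thesis
    by (subst (asm) set_integrable_norm_iff) (auto simp: set_borel_measurable_def)
qed

lemma set_integral_affine:
  fixes f :: "real \<Rightarrow> 'b :: {banach, second_countable_topology}"
  assumes "c > 0"
  shows "(LBINT y:A. f y) = c *\<^sub>R (LBINT x:{x. d + c * x \<in> A}. f (d + c * x))"
  unfolding set_lebesgue_integral_def
  by (subst lborel_integral_real_affine[where c = c and t = d])
     (use assms in \<open>auto simp: indicator_def\<close>)

lemma set_integrable_affine_iff: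
  fixes f :: "real \<Rightarrow> 'b :: {banach, second_countable_topology}"
  assumes "c > 0"
  shows "set_integrable lborel A f \<longleftrightarrow>
    set_integrable lborel {x. d + c * x \<in> A} (\<lambda>x. f (d + c * x))"
  unfolding set_integrable_def
  by (subst lborel_integrable_real_affine_iff[symmetric, where c = c and t = d])
     (use assms in \<open>auto simp: indicator_def\<close>)

lemma LBINT_Beta_scaled:
  fixes b :: complex
  assumes "r > 0"
  shows "(LBINT t:{0<..<r}. complex_of_real (t powr (a - 1)) * complex_of_real (r - t) powr (b - 1)) =
    complex_of_real r powr (of_real a + b - 1) *
    (LBINT t:{0<..<1}. complex_of_real (t powr (a - 1)) * complex_of_real (1 - t) powr (b - 1))"
proof -
  have dom: "{x. 0 + r * x \<in> {0<..<r}} = {0<..<1}"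
    using assms by (auto simp: zero_less_mult_iff)
  have r: "complex_of_real r powr (of_real a + b - 1) = of_real r * (complex_of_real (r powr (a - 1)) * of_real r powr (b - 1))"
  proof -
    have "of_real a + b - 1 = 1 + ((of_real (a - 1)) + (b - 1))" by (simp add: of_real_diff)
    thus ?thesis using assms by (simp only: powr_add powr_of_real) auto
  qed
  show ?thesis
    unfolding set_integral_affine[OF assms, of "{0<..<r}" _ 0] dom r
    unfolding scaleR_conv_of_real set_integral_mult_right [symmetric]
  proof (rule set_lebesgue_integral_cong)
    show "\<forall>x. x \<in> {0<..<1} \<longrightarrow> complex_of_real r * (complex_of_real ((0 + r * x) powr (a - 1)) *
        complex_of_real (r - (0 + r * x)) powr (b - 1)) =
      of_real r * (complex_of_real (r powr (a - 1)) * complex_of_real r powr (b - 1)) *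
      (complex_of_real (x powr (a - 1)) * complex_of_real (1 - x) powr (b - 1))"
    proof safe
      fix x :: real assume x: "x \<in> {0<..<1}"
      have "complex_of_real (r - (0 + r * x)) = complex_of_real r * complex_of_real (1 - x)"
        by (simp add: algebra_simps of_real_diff)
      moreover have "\<dots> powr (b - 1) = complex_of_real r powr (b - 1) * complex_of_real (1 - x) powr (b - 1)"
        using x assms by (intro powr_times_real) auto
      ultimately show "complex_of_real r * (complex_of_real ((0 + r * x) powr (a - 1)) *
          complex_of_real (r - (0 + r * x)) powr (b - 1)) =
        of_real r * (complex_of_real (r powr (a - 1)) * complex_of_real r powr (b - 1)) *
        (complex_of_real (x powr (a - 1)) * complex_of_real (1 - x) powr (b - 1))"
        using x assms by (simp add: powr_mult)
    qed
  qed auto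
qed

text \<open>Convolving \<open>t powr (a - 1)\<close> with \<open>t powr (b - 1)\<close> and integrating against \<open>exp (-r)\<close>
  gives \<open>Gamma a * Gamma b\<close>.\<close>

lemma LBINT_Beta:
  fixes b :: complex
  assumes a: "a > 0" and b: "Re b > 0"
  shows "(LBINT t:{0<..<1}. complex_of_real (t powr (a - 1)) * complex_of_real (1 - t) powr (b - 1)) =
    Beta (of_real a) b" (is "?J = _")
proof -
  \<comment> \<open>Extension by zero puts the convolution over (0,r) into the form of
    \<open>fractional_fubini\<close>; \<open>f\<close> needs no cut-off, since \<open>w\<close>
    vanishes for t <= 0.\<close>
  define w where "w = (\<lambda>t. complex_of_real (indicator {0<..} t * t powr (a - 1)))"
  define f where "f = (\<lambda>t. complex_of_real (exp (-t)))"
  define h where "h = (\<lambda>t. indicator {0<..} t *\<^sub>R (norm (complex_of_real t powr (of_real a - 1) * of_real (exp (-t)))) *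
    (LBINT s:{0<..}. norm (complex_of_real s powr (b - 1) * of_real (exp (-s)))))"
  have [measurable]: "w \<in> borel_measurable borel" "f \<in> borel_measurable borel"
    unfolding w_def f_def by measurable
  have A: "set_integrable lborel {0<..} (\<lambda>t. norm (complex_of_real t powr (of_real a - 1) * of_real (exp (-t))))"
    by (rule set_integrable_norm[OF set_integrable_Gamma]) (use a in auto)
  have B: "set_integrable lborel {0<..} (\<lambda>t. norm (complex_of_real t powr (b - 1) * of_real (exp (-t))))"
    by (rule set_integrable_norm[OF set_integrable_Gamma]) (use b in auto)
  have eq: "norm (f (t + s)) * s powr (Re b - 1) = exp (-t) * norm (complex_of_real s powr (b - 1) * of_real (exp (-s)))"
    if "s \<in> {0<..}" for s t
  proof -
    have "exp (-(t + s)) = exp (-t) * exp (-s)" by (simp flip: exp_add)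
    thus ?thesis
      using that by (simp add: f_def norm_mult norm_of_real_powr del: minus_add_distrib)
  qed
  have h: "integrable lborel h"
    using A unfolding h_def set_integrable_def by simp
  have int: "set_integrable lborel {0<..} (\<lambda>s. norm (f (t + s)) * s powr (Re b - 1))" for t
    using set_integrable_mult_right[OF B, of "exp (-t)"]
    by (subst set_integrable_cong[OF refl refl eq]) auto
  have "norm (w t) * (LBINT s:{0<..}. norm (f (t + s)) * s powr (Re b - 1)) = h t" for t
  proof -
    have "(LBINT s:{0<..}. norm (f (t + s)) * s powr (Re b - 1)) =
        (LBINT s:{0<..}. exp (-t) * norm (complex_of_real s powr (b - 1) * of_real (exp (-s))))"
      using eq by (intro set_lebesgue_integral_cong) auto
    thus ?thesis
      by (auto simp: h_def w_def norm_mult norm_of_real_powr indicator_def)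
  qed
  note swap = fractional_fubini(2)[of w f h b, OF _ _ h int eq_refl[OF this]]
  \<comment> \<open>Integrating over r first: the shift r = t + s extracts exp(-t), and two
    independent Gamma integrals remain.\<close>
  have "(LBINT t. w t * (LBINT r:{t<..}. f r * complex_of_real (r - t) powr (b - 1))) =
      (LBINT t:{0<..}. (complex_of_real t powr (of_real a - 1) * of_real (exp (-t))) * Gamma b)"
  proof -
    have "(LBINT r:{t<..}. f r * complex_of_real (r - t) powr (b - 1)) = of_real (exp (-t)) * Gamma b" for t
    proof -
      have "{x. t + 1 * x \<in> {t<..}} = {0<..}" by auto
      hence "(LBINT r:{t<..}. f r * complex_of_real (r - t) powr (b - 1)) =
          (LBINT s:{0<..}. of_real (exp (-t)) * (complex_of_real s powr (b - 1) * of_real (exp (-s))))"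
        by (subst set_integral_affine[of 1 _ _ t])
           (auto simp: f_def exp_add exp_minus field_simps)
      thus ?thesis using LBINT_Gamma[OF b] by simp
    qed
    moreover have "w t = indicator {0<..} t *\<^sub>R complex_of_real t powr (of_real a - 1)" for t
      using powr_of_real[of t "a - 1"] by (auto simp: w_def indicator_def of_real_diff)
    ultimately show ?thesis
      unfolding set_lebesgue_integral_def[of lborel "{0<..}"]
      by (intro Bochner_Integration.integral_cong refl) simp
  qed
  also have "\<dots> = Gamma (of_real a) * Gamma b"
    using LBINT_Gamma[of "of_real a"] a by simp
  finally have "Gamma (of_real a) * Gamma b =
      (LBINT r. f r * (LBINT t:{..<r}. w t * complex_of_real (r - t) powr (b - 1)))"
    using swap by simp
  \<comment> \<open>Integrating over t first: scaling by r yields r^(a+b-1) times the unknown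
    integral, so the outer integral is Gamma(a+b).\<close>
  also have "\<dots> = (LBINT r:{0<..}. complex_of_real r powr (of_real a + b - 1) * of_real (exp (-r)) * ?J)"
  proof -
    have "(LBINT t:{..<r}. w t * complex_of_real (r - t) powr (b - 1)) =
        (LBINT t:{0<..<r}. complex_of_real (t powr (a - 1)) * complex_of_real (r - t) powr (b - 1))" for r
      unfolding set_lebesgue_integral_def
      by (intro Bochner_Integration.integral_cong refl) (auto simp: w_def indicator_def)
    moreover have "(LBINT t:{0<..<r}. complex_of_real (t powr (a - 1)) * complex_of_real (r - t) powr (b - 1)) = 0"
      if "r \<le> 0" for r using that by (simp add: set_lebesgue_integral_def)
    ultimately have "f r * (LBINT t:{..<r}. w t * complex_of_real (r - t) powr (b - 1)) =
        indicator {0<..} r *\<^sub>R (complex_of_real r powr (of_real a + b - 1) * of_real (exp (-r)) * ?J)" for r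
      using LBINT_Beta_scaled[of r a b] by (cases "r > 0") (simp_all add: f_def)
    thus ?thesis
      unfolding set_lebesgue_integral_def[of lborel "{0<..}"] by simp
  qed
  also have "\<dots> = Gamma (of_real a + b) * ?J"
    using LBINT_Gamma[of "of_real a + b"] a b by simp
  finally show ?thesis
    using Re_pos_not_nonpos_Ints[of "of_real a + b"] a b
    by (simp add: Beta_def Gamma_eq_zero_iff field_simps)
qed

section \<open>Rodrigues' formula for Jacobi polynomials\<close>

lemma set_integral_Icc_eq_Ioo:
  fixes f :: "real \<Rightarrow> 'a :: {banach, second_countable_topology}"
  assumes "a \<le> b"
  shows "(LBINT x:{a..b}. f x) = (LBINT x:{a<..<b}. f x)"
  using interval_integral_Icc[OF assms, of f] interval_integral_Ioo[of a b f] assms by simp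

text \<open>Differentiability and continuity of the integrand are demanded only inside the interval,
  since weights t^b (1-t)^a may be unbounded at its ends; continuity of the antiderivative supplies
  the boundary values.\<close>

lemma set_integral_FTC_Ioo:
  fixes F f :: "real \<Rightarrow> 'a :: euclidean_space"
  assumes "a < b"
    and "\<And>x. a < x \<Longrightarrow> x < b \<Longrightarrow> (F has_vector_derivative f x) (at x)"
    and "continuous_on {a<..<b} f"
    and "set_integrable lborel {a<..<b} f"
    and "continuous_on {a..b} F"
  shows "(LBINT x:{a<..<b}. f x) = F b - F a"
proof -
  have "(LBINT x=ereal a..ereal b. f x) = F b - F a"
  proof (rule interval_integral_FTC_integrable[where F = F])
    show "isCont f x" if "ereal a < ereal x" "ereal x < ereal b" for x
      using assms(3) that by (simp add: continuous_on_eq_continuous_at)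
    show "((F \<circ> real_of_ereal) \<longlongrightarrow> F a) (at_right (ereal a))"
      using assms(1,5) by (simp add: ereal_tendsto_simps continuous_on_Icc_at_rightD)
    show "((F \<circ> real_of_ereal) \<longlongrightarrow> F b) (at_left (ereal b))"
      using assms(1,5) by (simp add: ereal_tendsto_simps continuous_on_Icc_at_leftD)
  qed (use assms in auto)
  thus ?thesis
    using assms(1) interval_integral_Ioo[of a b f] by simp
qed

lemma set_integrable_bounded_mult:
  fixes g :: "real \<Rightarrow> complex" and k :: "real \<Rightarrow> real"
  assumes k: "set_integrable lborel A k" and A: "A \<in> sets borel"
    and g: "continuous_on A g" and M: "\<And>x. x \<in> A \<Longrightarrow> norm (g x) \<le> M"
  shows "set_integrable lborel A (\<lambda>x. complex_of_real (k x) * g x)"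
  unfolding set_integrable_def
proof (rule Bochner_Integration.integrable_bound)
  show "integrable lborel (\<lambda>x. M * norm (indicator A x *\<^sub>R k x))"
    using k unfolding set_integrable_def by auto
  have [measurable]: "(\<lambda>x. indicator A x *\<^sub>R k x) \<in> borel_measurable lborel"
      "(\<lambda>x. indicator A x *\<^sub>R g x) \<in> borel_measurable borel"
    using k borel_measurable_continuous_on_indicator[OF A g] by (auto simp: set_integrable_def)
  have "(\<lambda>x. complex_of_real (indicator A x *\<^sub>R k x) * (indicator A x *\<^sub>R g x)) \<in> borel_measurable lborel"
    by measurable
  also have "(\<lambda>x. complex_of_real (indicator A x *\<^sub>R k x) * (indicator A x *\<^sub>R g x)) =
      (\<lambda>x. indicator A x *\<^sub>R (complex_of_real (k x) * g x))"
    by (auto simp: indicator_def)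
  finally show "(\<lambda>x. indicator A x *\<^sub>R (complex_of_real (k x) * g x)) \<in> borel_measurable lborel" .
  show "AE x in lborel. norm (indicator A x *\<^sub>R (complex_of_real (k x) * g x))
          \<le> norm (M * norm (indicator A x *\<^sub>R k x))"
  proof (rule AE_I2)
    fix x
    show "norm (indicator A x *\<^sub>R (complex_of_real (k x) * g x)) \<le> norm (M * norm (indicator A x *\<^sub>R k x))"
      using mult_left_mono[OF order_trans[OF M[of x] abs_ge_self], of "\<bar>k x\<bar>"]
      by (auto simp: indicator_def norm_mult abs_mult mult_ac)
  qed
qed

lemma set_integrable_jacobi_weight:
  fixes g :: "real \<Rightarrow> complex"
  assumes "a > -1" "b > -1" "continuous_on {0..1} g"
  shows "set_integrable lborel {0<..<1} (\<lambda>t. complex_of_real (t powr b * (1 - t) powr a) * g t)"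
proof -
  obtain M where M: "\<And>x. x \<in> {0..1} \<Longrightarrow> norm (g x) \<le> M"
    using compact_imp_bounded[OF compact_continuous_image[OF assms(3)]]
    unfolding bounded_iff by blast
  show ?thesis
  proof (rule set_integrable_bounded_mult)
    show "set_integrable lborel {0<..<1} (\<lambda>t. t powr b * (1 - t) powr a)"
    proof (rule set_integrable_subset)
      show "set_integrable lborel {0..1} (\<lambda>t. t powr b * (1 - t) powr a)"
        using integrable_Beta[of "b + 1" "a + 1"] assms by simp
    qed auto
    show "continuous_on {0<..<1} g"
      by (rule continuous_on_subset[OF assms(3)]) auto
    show "norm (g t) \<le> M" if "t \<in> {0<..<1}" for t
      using M that by auto
  qed auto
qed

text \<open>Defined so that \<open>t^b (1-t)^a * rodrigues_poly m a b\<close> is the \<open>m\<close>-th derivative of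
  \<open>t^(b+m) (1-t)^(a+m)\<close>.\<close>

primrec rodrigues_poly :: "nat \<Rightarrow> real \<Rightarrow> real \<Rightarrow> real poly" where
  "rodrigues_poly 0 a b = 1"
| "rodrigues_poly (Suc m) a b =
     [:0, 1, -1:] * pderiv (rodrigues_poly m (a + 1) (b + 1)) +
     [:b + 1, -(a + b + 2):] * rodrigues_poly m (a + 1) (b + 1)"

text \<open>One of the differentiations in Rodrigues' formula: both exponents drop by one, t^b
  (1-t)^a is a common factor in the product rule, and the cofactor is the recursion of
  \<open>rodrigues_poly\<close>.\<close>

lemma has_real_derivative_rodrigues:
  assumes "0 < t" "t < 1"
  shows "((\<lambda>t. t powr (b + 1) * (1 - t) powr (a + 1) * poly (rodrigues_poly m (a + 1) (b + 1)) t)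
    has_real_derivative t powr b * (1 - t) powr a * poly (rodrigues_poly (Suc m) a b) t) (at t)"
proof -
  define p where "p = rodrigues_poly m (a + 1) (b + 1)"
  have A: "((\<lambda>t. t powr (b + 1)) has_real_derivative (b + 1) * t powr b) (at t)"
    using has_real_derivative_powr[of t "b + 1"] assms by simp
  have B: "((\<lambda>t. (1 - t) powr (a + 1)) has_real_derivative (a + 1) * (1 - t) powr a * (-1)) (at t)"
  proof (rule DERIV_chain2[where f = "\<lambda>t. t powr (a + 1)"])
    show "((\<lambda>t. t powr (a + 1)) has_real_derivative (a + 1) * (1 - t) powr a) (at (1 - t))"
      using has_real_derivative_powr[of "1 - t" "a + 1"] assms by simp
    show "((\<lambda>t. 1 - t) has_real_derivative -1) (at t)"
      by (auto intro!: derivative_eq_intros)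
  qed
  have eq: "poly (rodrigues_poly (Suc m) a b) t =
      t * (1 - t) * poly (pderiv p) t + ((b + 1) * (1 - t) - (a + 1) * t) * poly p t"
    by (simp add: p_def algebra_simps)
  have eq': "t powr (b + 1) = t * t powr b" "(1 - t) powr (a + 1) = (1 - t) * (1 - t) powr a"
    using assms by (simp_all add: powr_add)
  show ?thesis
    unfolding p_def [symmetric]
    by (intro DERIV_cong[OF DERIV_mult[OF DERIV_mult[OF A B] poly_DERIV[of p t]]])
       (unfold eq eq', simp add: algebra_simps)
qed

lemma degree_rodrigues_poly_le: "degree (rodrigues_poly m a b) \<le> m"
proof (induction m arbitrary: a b)
  case (Suc m)
  let ?p = "rodrigues_poly m (a + 1) (b + 1)"
  have "degree ([:0, 1, -1:] * pderiv ?p) \<le> Suc m"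
  proof (cases "m = 0")
    case False
    thus ?thesis
      using degree_mult_le[of "[:0, 1, -1:]" "pderiv ?p"] Suc[of "a + 1" "b + 1"]
      by (simp add: degree_pderiv)
  qed auto
  moreover have "degree ([:b + 1, -(a + b + 2):] * ?p) \<le> Suc m"
    using degree_mult_le[of "[:b + 1, -(a + b + 2):]" ?p] Suc[of "a + 1" "b + 1"]
    by (auto split: if_splits)
  ultimately show ?case by (simp add: degree_add_le)
qed auto

text \<open>Each recursion step multiplies the top coefficient by -(m+a+b+2), where -m comes from
  the term -t^2 p' and -(a+b+2) from the linear factor. This never vanishes when a + b > -2, a
  condition preserved when a and b grow by one.\<close>

lemma coeff_rodrigues_poly_nonzero:
  assumes "a + b > -2"
  shows "coeff (rodrigues_poly m a b) m \<noteq> 0"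
  using assms
proof (induction m arbitrary: a b)
  case (Suc m)
  let ?p = "rodrigues_poly m (a + 1) (b + 1)"
  have "coeff ?p (Suc m) = 0"
    using degree_rodrigues_poly_le[of m "a + 1" "b + 1"] by (simp add: coeff_eq_0)
  moreover have "coeff ([:0, 1, -1:] * pderiv p + [:b + 1, -(a + b + 2):] * p) (Suc m) =
      -(real m + a + b + 2) * coeff p m" if "coeff p (Suc m) = 0" for p :: "real poly"
    using that by (cases m) (simp_all add: coeff_pderiv algebra_simps)
  ultimately have "coeff (rodrigues_poly (Suc m) a b) (Suc m) = -(real m + a + b + 2) * coeff ?p m"
    by simp
  moreover have "real m + a + b + 2 \<noteq> 0" "coeff ?p m \<noteq> 0"
    using Suc by auto
  ultimately show ?case by simp
qed auto

text \<open>At t = 1 the term with \<open>pderiv\<close> carries the factor t(1-t) = 0, and the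
  linear factor equals -(a+1). This value settles the normalization of the Jacobi
  polynomial.\<close>

lemma poly_rodrigues_poly_1: "poly (rodrigues_poly m a b) 1 = (-1) ^ m * pochhammer (a + 1) m"
  by (induction m arbitrary: a b) (simp_all add: pochhammer_rec algebra_simps)

text \<open>The sequence \<open>v\<close> lists the successive derivatives of a test function.
  Polynomials as test functions give orthogonality and the norm; powers of r - t give the kernel for
  r > 1.\<close>

lemma rodrigues_by_parts:
  fixes v :: "nat \<Rightarrow> real \<Rightarrow> complex"
  assumes "a > -1" "b > -1"
    and "\<And>i t. i < m \<Longrightarrow> t \<in> {0<..<1} \<Longrightarrow> (v i has_vector_derivative v (Suc i) t) (at t)"
    and "\<And>i. i \<le> m \<Longrightarrow> continuous_on {0..1} (v i)"
  shows "(LBINT t:{0<..<1}. complex_of_real (t powr b * (1 - t) powr a * poly (rodrigues_poly m a b) t) * v 0 t) =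
    (-1) ^ m * (LBINT t:{0<..<1}. complex_of_real (t powr (b + real m) * (1 - t) powr (a + real m)) * v m t)"
  using assms
proof (induction m arbitrary: a b v)
  case (Suc m)
  define p where "p = rodrigues_poly m (a + 1) (b + 1)"
  define U where "U = (\<lambda>t. t powr (b + 1) * (1 - t) powr (a + 1) * poly p t)"
  define u where "u = (\<lambda>t. t powr b * (1 - t) powr a * poly (rodrigues_poly (Suc m) a b) t)"
  have cont: "continuous_on {0..1} (v 0)" "continuous_on {0..1} (v 1)"
    using Suc.prems(4)[of 0] Suc.prems(4)[of 1] by auto
  \<comment> \<open>As a, b > -1, the exponents in \<open>U\<close> are positive, so
    \<open>U\<close> is continuous up to the ends even where \<open>u\<close> is unbounded.\<close>
  have contU: "continuous_on {0..1} U"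
    unfolding U_def using Suc.prems(1,2)
    by (intro continuous_intros continuous_on_powr') auto
  have contu: "continuous_on {0<..<1} u"
    unfolding u_def by (intro continuous_intros) auto
  have int1: "set_integrable lborel {0<..<1} (\<lambda>t. complex_of_real (u t) * v 0 t)"
    using set_integrable_jacobi_weight[OF Suc.prems(1,2), of "\<lambda>t. of_real (poly (rodrigues_poly (Suc m) a b) t) * v 0 t"] cont
    by (simp add: u_def mult.assoc continuous_intros del: rodrigues_poly.simps)
  have int2: "set_integrable lborel {0<..<1} (\<lambda>t. complex_of_real (U t) * v 1 t)"
    using set_integrable_jacobi_weight[of "a + 1" "b + 1" "\<lambda>t. of_real (poly p t) * v 1 t"] cont Suc.prems(1,2)
    by (simp add: U_def mult.assoc continuous_intros)
  have "(LBINT t:{0<..<1}. of_real (U t) * v 1 t + of_real (u t) * v 0 t) =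
      of_real (U 1) * v 0 1 - of_real (U 0) * v 0 0"
  proof (rule set_integral_FTC_Ioo)
    show "((\<lambda>t. of_real (U t) * v 0 t) has_vector_derivative of_real (U t) * v 1 t + of_real (u t) * v 0 t) (at t)"
      if "0 < t" "t < 1" for t
    proof (rule has_vector_derivative_mult)
      have "(U has_real_derivative u t) (at t)"
        unfolding U_def u_def p_def by (rule has_real_derivative_rodrigues[OF that])
      thus "((\<lambda>t. complex_of_real (U t)) has_vector_derivative complex_of_real (u t)) (at t)"
        by (simp add: has_real_derivative_iff_has_vector_derivative has_vector_derivative_of_real)
      show "(v 0 has_vector_derivative v 1 t) (at t)"
        using Suc.prems(3)[of 0 t] that by simp
    qed
    show "continuous_on {0<..<1} (\<lambda>t. of_real (U t) * v 1 t + of_real (u t) * v 0 t)"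
      by (intro continuous_intros contu continuous_on_subset[OF contU]
          continuous_on_subset[OF cont(1)] continuous_on_subset[OF cont(2)]) auto
    show "continuous_on {0..1} (\<lambda>t. complex_of_real (U t) * v 0 t)"
      by (intro continuous_intros contU cont)
    show "set_integrable lborel {0<..<1} (\<lambda>t. of_real (U t) * v 1 t + of_real (u t) * v 0 t)"
      using int1 int2 by (rule set_integral_add(1)[rotated])
  qed auto
  \<comment> \<open>No boundary terms: \<open>U\<close> contains 0 powr (a + 1) at 1 and 0 powr (b +
    1) at 0.\<close>
  also have "\<dots> = 0" by (simp add: U_def)
  finally have "(LBINT t:{0<..<1}. of_real (u t) * v 0 t) = - (LBINT t:{0<..<1}. of_real (U t) * v 1 t)"
    using set_integral_add(2)[OF int2 int1] by (simp add: add_eq_0_iff)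
  also have "(LBINT t:{0<..<1}. of_real (U t) * v 1 t) =
      (-1) ^ m * (LBINT t:{0<..<1}. of_real (t powr (b + 1 + real m) * (1 - t) powr (a + 1 + real m)) * v (Suc m) t)"
    unfolding U_def p_def
    using Suc.IH[of "a + 1" "b + 1" "\<lambda>i. v (Suc i)"] Suc.prems by (simp del: rodrigues_poly.simps)
  finally show ?case
    by (simp add: u_def add_ac del: rodrigues_poly.simps)
qed auto

section \<open>Change of variable from [-1,1] to (0,1)\<close>

lemma jacobi_weight_affine:
  assumes "t \<in> {0<..<1}"
  shows "jacobi_weight \<alpha> \<beta> (-1 + 2 * t) = 2 powr (\<alpha> + \<beta>) * (t powr \<beta> * (1 - t) powr \<alpha>)"
proof -
  have "1 - (-1 + 2 * t) = 2 * (1 - t)" "1 + (-1 + 2 * t) = 2 * t" by simp_all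
  moreover have "(2 * (1 - t)) powr \<alpha> = 2 powr \<alpha> * (1 - t) powr \<alpha>" "(2 * t) powr \<beta> = 2 powr \<beta> * t powr \<beta>"
    using assms by (intro powr_mult; simp)+
  ultimately show ?thesis
    by (simp only: jacobi_weight_def) (simp add: powr_add)
qed

lemma set_integral_jacobi_weight:
  fixes g :: "real \<Rightarrow> complex"
  shows "(LBINT \<xi>:{-1..1}. complex_of_real (jacobi_weight \<alpha> \<beta> \<xi>) * g \<xi>) =
    complex_of_real (2 powr (\<alpha> + \<beta> + 1)) *
    (LBINT t:{0<..<1}. complex_of_real (t powr \<beta> * (1 - t) powr \<alpha>) * g (-1 + 2 * t))"
proof -
  have "{x. -1 + 2 * x \<in> {-1<..<1}} = {0<..<1::real}" by auto
  hence "(LBINT \<xi>:{-1..1}. complex_of_real (jacobi_weight \<alpha> \<beta> \<xi>) * g \<xi>) =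
      2 * (LBINT t:{0<..<1}. complex_of_real (jacobi_weight \<alpha> \<beta> (-1 + 2 * t)) * g (-1 + 2 * t))"
    by (simp add: set_integral_Icc_eq_Ioo set_integral_affine[of 2 "{-1<..<1}" _ "-1"] scaleR_conv_of_real)
  also have "(LBINT t:{0<..<1}. complex_of_real (jacobi_weight \<alpha> \<beta> (-1 + 2 * t)) * g (-1 + 2 * t)) =
      (LBINT t:{0<..<1}. complex_of_real (2 powr (\<alpha> + \<beta>)) *
        (complex_of_real (t powr \<beta> * (1 - t) powr \<alpha>) * g (-1 + 2 * t)))"
    by (intro set_lebesgue_integral_cong allI impI, simp)
       (simp only: jacobi_weight_affine of_real_mult mult.assoc)
  finally show ?thesis
    by (simp add: powr_add)
qed

lemma set_integral_jacobi_weight_real: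
  fixes g :: "real \<Rightarrow> real"
  shows "(LBINT \<xi>:{-1..1}. g \<xi> * jacobi_weight \<alpha> \<beta> \<xi>) =
    2 powr (\<alpha> + \<beta> + 1) * (LBINT t:{0<..<1}. t powr \<beta> * (1 - t) powr \<alpha> * g (-1 + 2 * t))"
proof -
  have "complex_of_real (LBINT \<xi>:{-1..1}. g \<xi> * jacobi_weight \<alpha> \<beta> \<xi>) =
      complex_of_real (2 powr (\<alpha> + \<beta> + 1) *
        (LBINT t:{0<..<1}. t powr \<beta> * (1 - t) powr \<alpha> * g (-1 + 2 * t)))"
    using set_integral_jacobi_weight[of \<alpha> \<beta> "\<lambda>\<xi>. complex_of_real (g \<xi>)"]
    unfolding of_real_mult set_integral_complex_of_real [symmetric]
    by (simp add: mult.commute)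
  thus ?thesis by (simp only: of_real_eq_iff)
qed

lemma set_integrable_poly_jacobi_weight:
  fixes \<alpha> \<beta> :: real
  assumes "\<alpha> > -1" "\<beta> > -1"
  shows "set_integrable lborel {0<..<1} (\<lambda>t. t powr \<beta> * (1 - t) powr \<alpha> * poly p t)"
proof -
  have "integrable lborel (\<lambda>t. complex_of_real
      (indicator {0<..<1} t *\<^sub>R (t powr \<beta> * (1 - t) powr \<alpha> * poly p t)))"
    using set_integrable_jacobi_weight[OF assms, of "\<lambda>t. of_real (poly p t)"]
    by (simp add: set_integrable_def continuous_intros scaleR_conv_of_real)
  thus ?thesis
    unfolding complex_of_real_integrable_eq set_integrable_def .
qed

lemma rodrigues_by_parts_poly:
  assumes "\<alpha> > -1" "\<beta> > -1"
  shows "(LBINT t:{0<..<1}. t powr \<beta> * (1 - t) powr \<alpha> * (poly (rodrigues_poly m \<alpha> \<beta>) t * poly q t)) =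
    (-1) ^ m * (LBINT t:{0<..<1}. t powr (\<beta> + real m) * (1 - t) powr (\<alpha> + real m) * poly ((pderiv ^^ m) q) t)"
    (is "?L = ?R")
proof -
  have "complex_of_real ?L = complex_of_real ?R"
    using rodrigues_by_parts[OF assms, of m "\<lambda>i t. complex_of_real (poly ((pderiv ^^ i) q) t)"]
    unfolding of_real_mult set_integral_complex_of_real [symmetric]
    by (simp add: mult.assoc continuous_intros has_vector_derivative_of_real
        flip: has_real_derivative_iff_has_vector_derivative)
  thus ?thesis by (simp only: of_real_eq_iff)
qed

text \<open>The right side of Rodrigues' formula divided by the weight, with t = (1+\<xi>)/2. The
  classical constant is (-1)^n/(2^n n!); its 2^n disappears because d/d\<xi> contributes 2^(-n)
  while (1-\<xi>)^n (1+\<xi>)^n contributes 2^(2n).\<close>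

definition jacobi_rodrigues :: "nat \<Rightarrow> real \<Rightarrow> real \<Rightarrow> real poly" where
  "jacobi_rodrigues n \<alpha> \<beta> =
     smult ((-1) ^ n / fact n) (pcompose (rodrigues_poly n \<alpha> \<beta>) [:1 / 2, 1 / 2:])"

lemma poly_jacobi_rodrigues_affine:
  "poly (jacobi_rodrigues n \<alpha> \<beta>) (-1 + 2 * t) = (-1) ^ n / fact n * poly (rodrigues_poly n \<alpha> \<beta>) t"
  by (simp add: jacobi_rodrigues_def poly_pcompose field_simps)

lemma poly_jacobi_rodrigues_1: "poly (jacobi_rodrigues n \<alpha> \<beta>) 1 = (\<alpha> + of_nat n) gchoose n"
  using poly_jacobi_rodrigues_affine[of n \<alpha> \<beta> 1]
  by (simp add: poly_rodrigues_poly_1 gbinomial_pochhammer' flip: power_mult_distrib)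

context
  fixes n :: nat and \<alpha> \<beta> :: real
  assumes \<alpha>: "\<alpha> > -1" and \<beta>: "\<beta> > -1"
begin

lemma degree_rodrigues_poly: "degree (rodrigues_poly n \<alpha> \<beta>) = n"
  using \<alpha> \<beta> degree_rodrigues_poly_le[of n \<alpha> \<beta>] coeff_rodrigues_poly_nonzero[of \<alpha> \<beta> n]
  by (intro antisym le_degree) auto

lemma degree_jacobi_rodrigues: "degree (jacobi_rodrigues n \<alpha> \<beta>) = n"
  by (simp add: jacobi_rodrigues_def degree_rodrigues_poly degree_pcompose)

lemma lead_coeff_jacobi_rodrigues:
  "lead_coeff (jacobi_rodrigues n \<alpha> \<beta>) =
     (-1) ^ n / fact n * (coeff (rodrigues_poly n \<alpha> \<beta>) n / 2 ^ n)"
proof -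
  have "lead_coeff (pcompose (rodrigues_poly n \<alpha> \<beta>) [:1 / 2, 1 / 2:]) =
      coeff (rodrigues_poly n \<alpha> \<beta>) n / 2 ^ n"
    using degree_rodrigues_poly by (subst lead_coeff_comp) (simp_all add: power_divide)
  thus ?thesis by (simp add: jacobi_rodrigues_def)
qed

text \<open>Integration by parts n times puts the n-th derivative on a polynomial of degree below n.
  Composition with \<open>[:-1, 2:]\<close> writes \<open>q\<close> in the variable t.\<close>

lemma jacobi_rodrigues_orthogonal:
  assumes "degree q < n"
  shows "(LBINT \<xi>:{-1..1}. poly (jacobi_rodrigues n \<alpha> \<beta>) \<xi> * poly q \<xi> * jacobi_weight \<alpha> \<beta> \<xi>) = 0"
proof -
  have "(pderiv ^^ n) (pcompose q [:-1, 2:]) = 0"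
    using assms by (intro poly_eqI) (simp add: coeff_higher_pderiv coeff_eq_0 degree_pcompose)
  hence "(LBINT t:{0<..<1}. t powr \<beta> * (1 - t) powr \<alpha> *
      (poly (rodrigues_poly n \<alpha> \<beta>) t * poly (pcompose q [:-1, 2:]) t)) = 0"
    by (subst rodrigues_by_parts_poly[OF \<alpha> \<beta>]) (simp add: set_lebesgue_integral_def)
  also have "(\<lambda>t. t powr \<beta> * (1 - t) powr \<alpha> * (poly (rodrigues_poly n \<alpha> \<beta>) t * poly (pcompose q [:-1, 2:]) t)) =
      (\<lambda>t. ((-1) ^ n * fact n) * (t powr \<beta> * (1 - t) powr \<alpha> *
        (poly (jacobi_rodrigues n \<alpha> \<beta>) (-1 + 2 * t) * poly q (-1 + 2 * t))))"
    unfolding poly_jacobi_rodrigues_affine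
    by (simp add: poly_pcompose mult_ac power_mult_distrib [symmetric])
  finally show ?thesis
    unfolding set_integral_jacobi_weight_real by simp
qed

text \<open>The combination \<open>r\<close> of the two candidates in which the leading terms cancel
  has degree below n, so it is orthogonal to both candidates and hence to itself. A positive weight
  forces it to vanish; the two are then proportional, and the nonzero value at 1 fixes the factor.
  This licenses the \<open>THE\<close> in \<open>jacobi_poly\<close>.\<close>

lemma jacobi_rodrigues_unique:
  assumes n: "n > 0"
    and deg: "degree p = n"
    and orth: "\<And>q. degree q < n \<Longrightarrow>
      (LBINT \<xi>:{-1..1}. poly p \<xi> * poly q \<xi> * jacobi_weight \<alpha> \<beta> \<xi>) = 0"
    and norm: "poly p 1 = (\<alpha> + of_nat n) gchoose n"
  shows "p = jacobi_rodrigues n \<alpha> \<beta>"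
proof -
  define P where "P = jacobi_rodrigues n \<alpha> \<beta>"
  define r where "r = smult (lead_coeff P) p - smult (lead_coeff p) P"
  have degP: "degree P = n" unfolding P_def by (rule degree_jacobi_rodrigues)
  have deg_r: "degree r < n"
  proof -
    have "coeff r n = 0"
      using deg degP by (simp add: r_def)
    moreover have "degree r \<le> n"
      unfolding r_def using deg degP by (intro degree_diff_le) (auto intro: order_trans[OF degree_smult_le])
    ultimately show ?thesis
      using n by (metis degree_0 le_neq_implies_less leading_coeff_0_iff)
  qed
  define w where "w = (\<lambda>t::real. t powr \<beta> * (1 - t) powr \<alpha>)"
  define s where "s = pcompose r [:-1, 2:]"
  have int: "set_integrable lborel {0<..<1} (\<lambda>t. w t * poly q t)" for q
    unfolding w_def by (rule set_integrable_poly_jacobi_weight[OF \<alpha> \<beta>])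
  have "(LBINT t:{0<..<1}. w t * poly (pcompose (p * r) [:-1, 2:]) t) = 0"
    using orth[OF deg_r] set_integral_jacobi_weight_real[of "\<lambda>\<xi>. poly p \<xi> * poly r \<xi>" \<alpha> \<beta>]
    by (simp add: poly_pcompose w_def algebra_simps)
  moreover have "(LBINT t:{0<..<1}. w t * poly (pcompose (P * r) [:-1, 2:]) t) = 0"
    using jacobi_rodrigues_orthogonal[OF deg_r]
      set_integral_jacobi_weight_real[of "\<lambda>\<xi>. poly P \<xi> * poly r \<xi>" \<alpha> \<beta>]
    by (simp add: poly_pcompose w_def P_def algebra_simps)
  moreover have "(\<lambda>t. w t * (poly s t)\<^sup>2) =
      (\<lambda>t. lead_coeff P * (w t * poly (pcompose (p * r) [:-1, 2:]) t) -
           lead_coeff p * (w t * poly (pcompose (P * r) [:-1, 2:]) t))"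
    by (auto simp: s_def r_def poly_pcompose power2_eq_square algebra_simps)
  ultimately have zero: "(LBINT t:{0<..<1}. w t * (poly s t)\<^sup>2) = 0"
    by (simp only: set_integral_diff(2)[OF set_integrable_mult_right[OF int] set_integrable_mult_right[OF int]])
       simp
  have "set_integrable lborel {0<..<1} (\<lambda>t. w t * (poly s t)\<^sup>2)"
    using int[of "s\<^sup>2"] by simp
  moreover have "w t \<ge> 0" for t by (simp add: w_def)
  ultimately have AE: "AE t in lborel. indicator {0<..<1} t *\<^sub>R (w t * (poly s t)\<^sup>2) = 0"
    using zero unfolding set_integrable_def set_lebesgue_integral_def
    by (subst (asm) integral_nonneg_eq_0_iff_AE) (auto simp: indicator_def)
  \<comment> \<open>A nonzero polynomial has finitely many roots, whereas w s^2 vanishes almost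
    everywhere on (0,1), which has positive measure.\<close>
  have "s = 0"
  proof (rule ccontr)
    assume "s \<noteq> 0"
    hence "finite {t. poly s t = 0}" by (rule poly_roots_finite)
    hence "AE t in lborel. t \<notin> {t. poly s t = 0}"
      by (intro AE_not_in finite_imp_null_set_lborel)
    with AE have "AE t in lborel. t \<notin> {0<..<1::real}"
      by eventually_elim (auto simp: w_def indicator_def split: if_splits)
    hence "emeasure lborel {0<..<1::real} = 0"
      by (subst (asm) AE_iff_measurable[of "{0<..<1}"]) auto
    thus False by simp
  qed
  hence "r = 0"
    unfolding s_def by (subst (asm) pcompose_eq_0_iff) auto
  hence *: "smult (lead_coeff P) p = smult (lead_coeff p) P" by (simp add: r_def)
  have "poly P 1 \<noteq> 0"
    unfolding P_def poly_jacobi_rodrigues_1 gbinomial_pochhammer'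
    using pochhammer_pos[of "\<alpha> + 1" n] \<alpha> by simp
  moreover have "poly P 1 = poly p 1" using norm by (simp add: P_def poly_jacobi_rodrigues_1)
  ultimately have "lead_coeff P = lead_coeff p"
    using arg_cong[OF *, of "\<lambda>p. poly p 1"] by simp
  moreover have "lead_coeff P \<noteq> 0" using degP n by auto
  ultimately have "smult (lead_coeff P) (p - P) = 0" "lead_coeff P \<noteq> 0"
    using * by (simp_all only: smult_diff_right) simp
  thus ?thesis unfolding P_def by simp
qed

lemma jacobi_poly_eq:
  assumes "n > 0"
  shows "jacobi_poly n \<alpha> \<beta> = jacobi_rodrigues n \<alpha> \<beta>"
  unfolding jacobi_poly_def
  by (rule the_equality)
     (use jacobi_rodrigues_orthogonal degree_jacobi_rodrigues poly_jacobi_rodrigues_1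
        jacobi_rodrigues_unique[OF assms] in blast)+

text \<open>One factor is written by Rodrigues' formula and integrated by parts; the n-th derivative
  of the other is n! times its leading coefficient, and a Beta integral is left.\<close>

lemma jacobi_h_eq:
  assumes "n > 0"
  shows "jacobi_h n \<alpha> \<beta> =
    (-1) ^ n * 2 powr (\<alpha> + \<beta> + 1) / fact n * coeff (rodrigues_poly n \<alpha> \<beta>) n *
      Beta (real n + \<beta> + 1) (real n + \<alpha> + 1)"
proof -
  define Q where "Q = rodrigues_poly n \<alpha> \<beta>"
  have "(pderiv ^^ n) Q = [:fact n * coeff Q n:]"
    using degree_rodrigues_poly
    by (intro poly_eqI) (auto simp: Q_def coeff_higher_pderiv coeff_pCons pochhammer_fact coeff_eq_0 split: nat.split)
  hence "(LBINT t:{0<..<1}. t powr \<beta> * (1 - t) powr \<alpha> * (poly Q t * poly Q t)) =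
      (-1) ^ n * (LBINT t:{0<..<1}. (t powr (\<beta> + real n) * (1 - t) powr (\<alpha> + real n)) * (fact n * coeff Q n))"
    unfolding Q_def by (subst rodrigues_by_parts_poly[OF \<alpha> \<beta>]) simp
  also have "(LBINT t:{0<..<1}. (t powr (\<beta> + real n) * (1 - t) powr (\<alpha> + real n)) * (fact n * coeff Q n)) =
      Beta (real n + \<beta> + 1) (real n + \<alpha> + 1) * (fact n * coeff Q n)"
  proof -
    have "set_integrable lborel {0..1} (\<lambda>t. t powr (\<beta> + real n) * (1 - t) powr (\<alpha> + real n))"
      using integrable_Beta[of "real n + \<beta> + 1" "real n + \<alpha> + 1"] \<alpha> \<beta> by (simp add: add_ac)
    from set_borel_integral_eq_integral(2)[OF this]
    have "(LBINT t:{0<..<1}. t powr (\<beta> + real n) * (1 - t) powr (\<alpha> + real n)) =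
        Beta (real n + \<beta> + 1) (real n + \<alpha> + 1)"
      using has_integral_Beta_real[of "real n + \<beta> + 1" "real n + \<alpha> + 1"] \<alpha> \<beta>
      by (simp add: set_integral_Icc_eq_Ioo has_integral_iff add_ac)
    thus ?thesis by simp
  qed
  finally show ?thesis
    unfolding jacobi_h_def jacobi_poly_eq[OF assms] set_integral_jacobi_weight_real poly_jacobi_rodrigues_affine
    by (simp add: Q_def power2_eq_square mult_ac field_simps flip: power_mult_distrib)
qed

text \<open>Numerator and denominator both contain the leading coefficient of
  \<open>rodrigues_poly\<close>, so it cancels and is never evaluated; only its being nonzero
  matters.\<close>

lemma jacobi_k_h_ratio:
  assumes "n > 0"
  shows "jacobi_k n \<alpha> \<beta> * fact n / jacobi_h n \<alpha> \<beta> =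
    fact n / (2 powr (\<alpha> + \<beta> + 1) * 2 ^ n * Beta (real n + \<beta> + 1) (real n + \<alpha> + 1))"
  using coeff_rodrigues_poly_nonzero[of \<alpha> \<beta> n] \<alpha> \<beta>
  unfolding jacobi_k_def jacobi_poly_eq[OF assms] jacobi_h_eq[OF assms] lead_coeff_jacobi_rodrigues
  by (simp add: field_simps)

text \<open>The factors 2^(\<alpha>+\<beta>+1) and n! of the constant cancel against the
  substitution and Rodrigues' formula, the remaining 2^n joins \<delta>^n, and (-1)^n is the sign in
  Rodrigues' formula.\<close>

lemma jacobi_deriv_eq:
  assumes "n > 0" "\<delta> > 0"
  shows "jacobi_deriv \<delta> \<alpha> \<beta> n g x =
    (-1) ^ n / complex_of_real ((2 * \<delta>) ^ n * Beta (real n + \<beta> + 1) (real n + \<alpha> + 1)) *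
    (LBINT t:{0<..<1}. complex_of_real (t powr \<beta> * (1 - t) powr \<alpha> * poly (rodrigues_poly n \<alpha> \<beta>) t) *
      g (x - \<delta> + 2 * \<delta> * t))"
proof -
  have "(\<lambda>\<xi>. g (x + \<delta> * \<xi>) * complex_of_real (poly (jacobi_poly n \<alpha> \<beta>) \<xi> * jacobi_weight \<alpha> \<beta> \<xi>)) =
      (\<lambda>\<xi>. complex_of_real (jacobi_weight \<alpha> \<beta> \<xi>) *
        (complex_of_real (poly (jacobi_rodrigues n \<alpha> \<beta>) \<xi>) * g (x + \<delta> * \<xi>)))"
    by (simp add: jacobi_poly_eq[OF assms(1)] mult_ac)
  hence "(LBINT \<xi>:{-1..1}. g (x + \<delta> * \<xi>) *
        complex_of_real (poly (jacobi_poly n \<alpha> \<beta>) \<xi> * jacobi_weight \<alpha> \<beta> \<xi>)) =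
      complex_of_real (2 powr (\<alpha> + \<beta> + 1)) *
      (LBINT t:{0<..<1}. complex_of_real ((-1) ^ n / fact n) *
        (complex_of_real (t powr \<beta> * (1 - t) powr \<alpha> * poly (rodrigues_poly n \<alpha> \<beta>) t) *
          g (x - \<delta> + 2 * \<delta> * t)))"
    by (simp only: set_integral_jacobi_weight poly_jacobi_rodrigues_affine) (simp add: mult_ac algebra_simps)
  thus ?thesis
    unfolding jacobi_deriv_def jacobi_k_h_ratio[OF assms(1)]
    by (simp add: power_mult_distrib mult_ac)
qed

end

section \<open>Euler's transformation of the hypergeometric series\<close>

definition hyp2F1_coeff :: "complex \<Rightarrow> complex \<Rightarrow> complex \<Rightarrow> nat \<Rightarrow> complex" where
  "hyp2F1_coeff a b c k = pochhammer a k * pochhammer b k / (pochhammer c k * fact k)"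

lemma hyp2F1_coeff_0 [simp]: "hyp2F1_coeff a b c 0 = 1"
  by (simp add: hyp2F1_coeff_def)

lemma hyp2F1_coeff_Suc:
  "hyp2F1_coeff a b c (Suc k) =
     (a + of_nat k) / (of_nat k + 1) * ((b + of_nat k) / (c + of_nat k)) * hyp2F1_coeff a b c k"
  by (simp add: hyp2F1_coeff_def pochhammer_Suc add_ac mult_ac)

lemma tendsto_shift_ratio: "(\<lambda>k. (a + of_nat k) / (c + of_nat k) :: complex) \<longlonglongrightarrow> 1"
proof -
  have inf: "filterlim (\<lambda>k. c + of_nat k :: complex) at_infinity sequentially"
    by (intro tendsto_add_filterlim_at_infinity[OF tendsto_const] tendsto_of_nat)
  have "(\<lambda>k. 1 + (a - c) / (c + of_nat k)) \<longlonglongrightarrow> 1 + 0"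
    by (intro tendsto_add tendsto_const tendsto_divide_0[OF tendsto_const inf])
  moreover have "eventually (\<lambda>k. c + of_nat k \<noteq> 0) sequentially"
    using filterlim_at_infinity_imp_eventually_ne[OF inf, of 0] by simp
  hence "eventually (\<lambda>k. 1 + (a - c) / (c + of_nat k) = (a + of_nat k) / (c + of_nat k)) sequentially"
    by eventually_elim (simp add: field_simps)
  ultimately show ?thesis
    by (simp add: tendsto_cong)
qed

text \<open>The ratio of consecutive terms tends to z for all parameters. If c is a nonpositive
  integer, division by zero makes the coefficients eventually 0, which is consistent with
  \<open>hyp2F1_coeff_Suc\<close>.\<close>

lemma summable_norm_hyp2F1:
  assumes "norm z < 1"
  shows "summable (\<lambda>k. norm (hyp2F1_coeff a b c k * z ^ k))"
proof -
  define q where "q = (norm z + 1) / 2"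
  have q: "norm z < q" "q < 1" using assms by (simp_all add: q_def)
  have "(\<lambda>k. (a + of_nat k) / (1 + of_nat k) * ((b + of_nat k) / (c + of_nat k)) * z) \<longlonglongrightarrow> 1 * 1 * z"
    by (intro tendsto_intros tendsto_shift_ratio)
  hence "eventually (\<lambda>k. norm ((a + of_nat k) / (1 + of_nat k) * ((b + of_nat k) / (c + of_nat k)) * z) < q) sequentially"
    using q(1) by (intro order_tendstoD(2)[OF tendsto_norm]) auto
  then obtain K where K: "\<And>k. k \<ge> K \<Longrightarrow>
      norm ((a + of_nat k) / (1 + of_nat k) * ((b + of_nat k) / (c + of_nat k)) * z) \<le> q"
    unfolding eventually_sequentially by (meson less_imp_le)
  show ?thesis
  proof (rule summable_ratio_test[OF q(2)])
    fix k assume k: "k \<ge> K"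
    have "norm (hyp2F1_coeff a b c (Suc k) * z ^ Suc k) =
        norm ((a + of_nat k) / (1 + of_nat k) * ((b + of_nat k) / (c + of_nat k)) * z) *
        norm (hyp2F1_coeff a b c k * z ^ k)"
      by (simp add: hyp2F1_coeff_Suc norm_mult norm_divide add_ac)
    also have "\<dots> \<le> q * norm (hyp2F1_coeff a b c k * z ^ k)"
      by (intro mult_right_mono K k) simp
    finally show "norm (norm (hyp2F1_coeff a b c (Suc k) * z ^ Suc k)) \<le>
        q * norm (norm (hyp2F1_coeff a b c k * z ^ k))" by simp
  qed
qed

lemma hyp2F1_eq_suminf: "hyp2F1 a b c z = (\<Sum>k. hyp2F1_coeff a b c k * z ^ k)"
  by (simp add: hyp2F1_series hyp2F1_coeff_def)

lemma hyp2F1_sums: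
  assumes "norm z < 1"
  shows "(\<lambda>k. hyp2F1_coeff a b c k * z ^ k) sums hyp2F1 a b c z"
  unfolding hyp2F1_eq_suminf
  by (rule summable_sums, rule summable_norm_cancel, rule summable_norm_hyp2F1[OF assms])

lemma fps_nth_hypergeo: "fps_nth (fps_hypergeo [a, b] [c] 1) k = hyp2F1_coeff a b c k"
  by (simp add: hyp2F1_coeff_def)

section \<open>The hypergeometric equation for formal power series\<close>

lemma fps_conv_radius_ge_1:
  fixes f :: "complex fps"
  assumes "\<And>z. norm z < 1 \<Longrightarrow> summable (\<lambda>k. fps_nth f k * z ^ k)"
  shows "fps_conv_radius f \<ge> 1"
  unfolding fps_conv_radius_def
proof (rule conv_radius_geI_ex)
  fix r :: real
  assume "0 < r" "ereal r < 1"
  thus "\<exists>z. norm z = r \<and> summable (\<lambda>k. fps_nth f k * z ^ k)"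
    using assms[of "complex_of_real r"] by (intro exI[of _ "complex_of_real r"]) auto
qed

text \<open>The k-th coefficient of the left side of the equation is exactly the difference of the
  two sides of the recursion. The equivalence is used in both directions: to obtain the equation for
  \<open>G\<close>, and to read off the coefficients of \<open>H\<close>.\<close>

lemma fps_hypergeo_ODE_iff:
  fixes f :: "complex fps"
  shows "fps_X * (1 - fps_X) * fps_deriv (fps_deriv f) +
      (fps_const c - fps_const (a + b + 1) * fps_X) * fps_deriv f - fps_const (a * b) * f = 0 \<longleftrightarrow>
    (\<forall>k. (of_nat k + 1) * (of_nat k + c) * fps_nth f (Suc k) =
      (of_nat k + a) * (of_nat k + b) * fps_nth f k)"
proof -
  have "fps_nth (fps_X * (1 - fps_X) * fps_deriv (fps_deriv f) +
      (fps_const c - fps_const (a + b + 1) * fps_X) * fps_deriv f - fps_const (a * b) * f) k =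
      (of_nat k + 1) * (of_nat k + c) * fps_nth f (Suc k) -
      (of_nat k + a) * (of_nat k + b) * fps_nth f k" for k
  proof -
    have "fps_X * (1 - fps_X) * fps_deriv (fps_deriv f) +
        (fps_const c - fps_const (a + b + 1) * fps_X) * fps_deriv f - fps_const (a * b) * f =
        fps_X * fps_deriv (fps_deriv f) - fps_X * (fps_X * fps_deriv (fps_deriv f)) +
        fps_const c * fps_deriv f - fps_const (a + b + 1) * (fps_X * fps_deriv f) - fps_const (a * b) * f"
      by (simp add: algebra_simps)
    also have "fps_nth \<dots> k = (of_nat k + 1) * (of_nat k + c) * fps_nth f (Suc k) -
        (of_nat k + a) * (of_nat k + b) * fps_nth f k"
    proof (cases k)
      case (Suc m)
      thus ?thesis by (cases m) (simp_all add: algebra_simps)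
    qed (simp add: algebra_simps)
    finally show ?thesis .
  qed
  thus ?thesis
    by (simp only: fps_eq_iff fps_zero_nth eq_iff_diff_eq_0[symmetric] right_minus_eq)
qed

text \<open>\<open>S\<close> is the series of (1-X)^s, whose first-order equation amounts to (k+1)
  binom(s,k+1) = (s-k) binom(s,k).\<close>

lemma fps_binomial_one_minus_deriv:
  fixes s :: complex
  defines "S \<equiv> Abs_fps (\<lambda>k. (-1) ^ k * (s gchoose k))"
  shows "(1 - fps_X) * fps_deriv S = - (fps_const s * S)"
proof (rule fps_ext)
  fix k
  have rec: "(of_nat k + 1) * (s gchoose Suc k) = (s - of_nat k) * (s gchoose k)" for k
    using gbinomial_mult_1[of s k] by (simp add: algebra_simps)
  have "fps_nth ((1 - fps_X) * fps_deriv S) k =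
      (-1) ^ Suc k * ((of_nat k + 1) * (s gchoose Suc k)) - of_nat k * ((-1) ^ k * (s gchoose k))"
    by (cases k) (simp_all add: S_def algebra_simps)
  also have "\<dots> = fps_nth (- (fps_const s * S)) k"
    unfolding rec by (simp add: S_def algebra_simps)
  finally show "fps_nth ((1 - fps_X) * fps_deriv S) k = fps_nth (- (fps_const s * S)) k" .
qed

text \<open>\<open>G\<close>, \<open>G1\<close>, \<open>G2\<close> play a series and its first two
  derivatives, treated as independent. The left side is (1-X) times the hypergeometric operator for
  A, B, C applied to (1-X)^(C-A-B) G, after division by that power; the right side is (1-X) times
  the operator for C-A, C-B, C applied to \<open>G\<close>.\<close>

lemma Euler_transform_ring_identity:
  fixes A B C X G G1 G2 :: "'a :: comm_ring_1"
  shows "X * ((1 - X) * G1 - (C - A - B) * G - (C - A - B) * ((1 - X) * G1 - (C - A - B) * G) +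
      (1 - X) * ((1 - X) * G2 - G1 - (C - A - B) * G1)) +
    (C - (A + B + 1) * X) * ((1 - X) * G1 - (C - A - B) * G) - A * B * (1 - X) * G =
    (1 - X) * (X * (1 - X) * G2 + (C - (C - A + (C - B) + 1) * X) * G1 - (C - A) * (C - B) * G)"
proof -
  \<comment> \<open>With C eliminated, the identity splits into a part with \<open>G1\<close> and a
    part with \<open>G\<close>; the terms in \<open>G2\<close> agree as they stand.\<close>
  define s where "s = C - A - B"
  have C: "C = s + A + B" by (simp add: s_def)
  define Y where "Y = 1 - X"
  have X: "X = 1 - Y" by (simp add: Y_def)
  have 1: "X * (Y * G1 - s * (Y * G1) + Y * (- G1 - s * G1)) + (C - (A + B + 1) * X) * (Y * G1) = Y * ((C - (C - A + (C - B) + 1) * X) * G1)"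
    unfolding C by (simp add: distrib_left distrib_right left_diff_distrib right_diff_distrib mult_ac)
  have 2: "X * (- s * G + s * (s * G)) - (C - (A + B + 1) * X) * (s * G) - A * B * Y * G = - (Y * ((C - A) * (C - B) * G))"
    unfolding C Y_def by (simp add: distrib_left distrib_right left_diff_distrib right_diff_distrib mult_ac)
  show ?thesis unfolding s_def[symmetric] Y_def[symmetric]
    using 1 2 by (simp add: algebra_simps)
qed

text \<open>Both sides solve the hypergeometric equation with the same constant term.\<close>

theorem hyp2F1_Euler_transform:
  assumes z: "norm z < 1" and c: "c \<notin> \<int>\<^sub>\<le>\<^sub>0"
  shows "hyp2F1 a b c z = (1 - z) powr (c - a - b) * hyp2F1 (c - a) (c - b) c z"
proof -
  define s where "s = c - a - b"
  define S where "S = Abs_fps (\<lambda>k. (-1) ^ k * (s gchoose k))"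
  have S_sums: "(\<lambda>k. fps_nth S k * z ^ k) sums (1 - z) powr s" if "norm z < 1" for z
  proof -
    have "(\<lambda>k. (s gchoose k) * (-z) ^ k) sums (1 + (-z)) powr s"
      using that by (intro gen_binomial_complex) simp
    moreover have "(s gchoose k) * (-z) ^ k = fps_nth S k * z ^ k" for k
      by (subst power_minus) (simp add: S_def)
    ultimately show ?thesis by simp
  qed
  define G where "G = fps_hypergeo [c - a, c - b] [c] (1::complex)"
  define H where "H = S * G"
  define X where "X = (fps_X :: complex fps)"
  have c': "of_nat k + c \<noteq> 0" for k
  proof
    assume "of_nat k + c = 0"
    hence "c = - of_nat k" by (simp add: eq_neg_iff_add_eq_0 add.commute)
    thus False using c by simp
  qed
  have rec: "(of_nat k + 1) * (of_nat k + c) * hyp2F1_coeff a b c (Suc k) =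
      (of_nat k + a) * (of_nat k + b) * hyp2F1_coeff a b c k" for a b k
  proof -
    have *: "p * q * (x / p * (y / q) * h) = x * y * h" if "p \<noteq> 0" "q \<noteq> 0" for p q x y h :: complex
      using that by simp
    show ?thesis
      using *[of "of_nat k + 1" "of_nat k + c"] c'[of k] of_nat_neq_0[of k, where 'a = complex]
      by (simp add: hyp2F1_coeff_Suc add.commute)
  qed
  have "\<forall>k. (of_nat k + 1) * (of_nat k + c) * fps_nth G (Suc k) =
      (of_nat k + (c - a)) * (of_nat k + (c - b)) * fps_nth G k"
    unfolding G_def fps_nth_hypergeo by (intro allI rec)
  hence G: "X * (1 - X) * fps_deriv (fps_deriv G) +
      (fps_const c - fps_const ((c - a) + (c - b) + 1) * X) * fps_deriv G - fps_const ((c - a) * (c - b)) * G = 0"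
    unfolding X_def by (subst fps_hypergeo_ODE_iff)
  have S: "(1 - X) * fps_deriv S = - (fps_const s * S)"
    unfolding X_def S_def by (rule fps_binomial_one_minus_deriv)
  have dX: "fps_deriv X = 1" by (simp add: X_def)
  \<comment> \<open>Since (1-X) S' = -s S, every derivative of \<open>H\<close> becomes a multiple
    of \<open>S\<close> once it is multiplied by a power of 1-X; \<open>T\<close> is the cofactor
    for the first derivative.\<close>
  define T where "T = (1 - X) * fps_deriv G - fps_const s * G"
  have H1: "(1 - X) * fps_deriv H = S * T"
  proof -
    have "(1 - X) * fps_deriv H = S * ((1 - X) * fps_deriv G) + ((1 - X) * fps_deriv S) * G"
      by (simp add: H_def algebra_simps)
    thus ?thesis unfolding S by (simp add: T_def algebra_simps)
  qed
  have T': "fps_deriv T = (1 - X) * fps_deriv (fps_deriv G) - fps_deriv G - fps_const s * fps_deriv G"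
    by (simp add: T_def dX algebra_simps)
  have H2: "(1 - X) * ((1 - X) * fps_deriv (fps_deriv H)) = S * (T - fps_const s * T + (1 - X) * fps_deriv T)"
  proof -
    have "(1 - X) * fps_deriv (fps_deriv H) - fps_deriv H = fps_deriv ((1 - X) * fps_deriv H)"
      by (simp add: dX algebra_simps)
    also have "\<dots> = S * fps_deriv T + fps_deriv S * T" unfolding H1 by simp
    finally have e: "(1 - X) * fps_deriv (fps_deriv H) = fps_deriv H + (S * fps_deriv T + fps_deriv S * T)"
      by (simp only: diff_eq_eq add.commute)
    have "(1 - X) * ((1 - X) * fps_deriv (fps_deriv H)) =
        (1 - X) * fps_deriv H + S * ((1 - X) * fps_deriv T) + ((1 - X) * fps_deriv S) * T"
      unfolding e by (simp add: algebra_simps)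
    thus ?thesis unfolding S H1 by (simp add: algebra_simps)
  qed
  \<comment> \<open>The additional factor 1-X lets \<open>S\<close> be taken out of the whole
    equation; it is cancelled again below, as formal power series have no zero divisors.\<close>
  have "(1 - X) * (X * (1 - X) * fps_deriv (fps_deriv H) +
      (fps_const c - fps_const (a + b + 1) * X) * fps_deriv H - fps_const (a * b) * H) =
      X * ((1 - X) * ((1 - X) * fps_deriv (fps_deriv H))) +
      (fps_const c - fps_const (a + b + 1) * X) * ((1 - X) * fps_deriv H) - fps_const (a * b) * (1 - X) * H"
    by (simp add: algebra_simps)
  also have "\<dots> = S * (X * (T - fps_const s * T + (1 - X) * fps_deriv T) +
      (fps_const c - fps_const (a + b + 1) * X) * T - fps_const (a * b) * (1 - X) * G)"
    unfolding H1 H2 by (simp add: H_def algebra_simps)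
  also have "X * (T - fps_const s * T + (1 - X) * fps_deriv T) +
      (fps_const c - fps_const (a + b + 1) * X) * T - fps_const (a * b) * (1 - X) * G =
      (1 - X) * (X * (1 - X) * fps_deriv (fps_deriv G) +
      (fps_const c - fps_const ((c - a) + (c - b) + 1) * X) * fps_deriv G - fps_const ((c - a) * (c - b)) * G)"
  proof -
    define A B C where ABC: "A = fps_const a" "B = fps_const b" "C = fps_const c"
    have *: "fps_const s = C - A - B" "fps_const (a + b + 1) = A + B + 1" "fps_const (a * b) = A * B"
      "fps_const ((c - a) + (c - b) + 1) = (C - A) + (C - B) + 1"
      "fps_const ((c - a) * (c - b)) = (C - A) * (C - B)"
      by (simp_all add: ABC s_def)
    show ?thesis
      unfolding T' unfolding T_def * ABC(3)[symmetric] by (rule Euler_transform_ring_identity)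
  qed
  also have "\<dots> = 0" unfolding G by simp
  finally have "(1 - X) * (X * (1 - X) * fps_deriv (fps_deriv H) +
      (fps_const c - fps_const (a + b + 1) * X) * fps_deriv H - fps_const (a * b) * H) = 0" by simp
  moreover have "1 - X \<noteq> 0"
  proof
    assume "1 - X = 0"
    hence "fps_nth (1 - X) 0 = 0" by simp
    thus False by (simp add: X_def)
  qed
  ultimately have "X * (1 - X) * fps_deriv (fps_deriv H) +
      (fps_const c - fps_const (a + b + 1) * X) * fps_deriv H - fps_const (a * b) * H = 0"
    by simp
  hence H_rec: "(of_nat k + 1) * (of_nat k + c) * fps_nth H (Suc k) =
      (of_nat k + a) * (of_nat k + b) * fps_nth H k" for k
    unfolding X_def by (subst (asm) fps_hypergeo_ODE_iff) blast
  \<comment> \<open>The factor k + c never vanishes, so the recursion and the constant term 1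
    determine all coefficients.\<close>
  have "fps_nth H k = hyp2F1_coeff a b c k" for k
  proof (induction k)
    case 0
    show ?case by (simp add: H_def S_def G_def)
  next
    case (Suc k)
    have "(of_nat k + 1) * (of_nat k + c) * fps_nth H (Suc k) =
        (of_nat k + 1) * (of_nat k + c) * hyp2F1_coeff a b c (Suc k)"
      unfolding H_rec rec Suc ..
    thus ?case using c'[of k] of_nat_neq_0[of k, where 'a = complex] by (simp add: add_ac)
  qed
  hence "hyp2F1 a b c z = eval_fps H z"
    by (simp only: hyp2F1_eq_suminf eval_fps_def)
  also have "\<dots> = eval_fps S z * eval_fps G z"
    unfolding H_def
  proof (rule eval_fps_mult)
    have z': "ereal (norm z) < 1" using z by simp
    have "summable (\<lambda>k. fps_nth S k * z ^ k)" if "norm z < 1" for z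
      using sums_summable[OF S_sums[OF that]] .
    hence "fps_conv_radius S \<ge> 1" by (rule fps_conv_radius_ge_1)
    thus "ereal (norm z) < fps_conv_radius S" by (rule less_le_trans[OF z'])
    have "summable (\<lambda>k. fps_nth G k * z ^ k)" if "norm z < 1" for z
      using sums_summable[OF hyp2F1_sums[OF that]] unfolding G_def fps_nth_hypergeo .
    hence "fps_conv_radius G \<ge> 1" by (rule fps_conv_radius_ge_1)
    thus "ereal (norm z) < fps_conv_radius G" by (rule less_le_trans[OF z'])
  qed
  also have "eval_fps S z = (1 - z) powr s"
    using sums_unique[OF S_sums[OF z]] by (simp add: eval_fps_def)
  finally show ?thesis
    by (simp add: hyp2F1_def G_def s_def)
qed

section \<open>The kernel of the approximate fractional derivative\<close>

text \<open>The series converges absolutely at \<rho>, which bounds all t in \<open>A\<close>, so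
  the integrals of the norms are summable with bound (integral of |m|) times the sum of |c_k|
  \<rho>^k. Used with A = (0,1), \<rho> = 1 for r > 1 and with A = (0,r), \<rho> = r for r <
  1.\<close>

lemma
  fixes m :: "real \<Rightarrow> complex" and c :: "nat \<Rightarrow> complex"
  assumes m: "set_integrable lborel A m" and A: "A \<in> sets borel"
    and bnd: "\<And>t. t \<in> A \<Longrightarrow> 0 \<le> t \<and> t \<le> \<rho>"
    and c: "summable (\<lambda>k. norm (c k) * \<rho> ^ k)"
  shows sums_set_integral_power_series:
      "(\<lambda>k. c k * (LBINT t:A. m t * of_real t ^ k)) sums
        (LBINT t:A. m t * (\<Sum>k. c k * of_real t ^ k))"
    and set_integrable_power_series:
      "set_integrable lborel A (\<lambda>t. m t * (\<Sum>k. c k * of_real t ^ k))"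
proof -
  define f where "f = (\<lambda>k t. indicator A t *\<^sub>R (m t * (c k * of_real t ^ k)))"
  have m': "integrable lborel (\<lambda>t. norm (indicator A t *\<^sub>R m t))"
    using m unfolding set_integrable_def by (rule integrable_norm)
  have [measurable]: "(\<lambda>t. indicator A t *\<^sub>R m t) \<in> borel_measurable lborel"
    using m unfolding set_integrable_def by measurable
  have f_eq: "f k t = (indicator A t *\<^sub>R m t) * (c k * of_real t ^ k)" for k t
    by (simp add: f_def)
  have f_meas: "f k \<in> borel_measurable lborel" for k
    unfolding f_eq[abs_def] by measurable
  have f_le: "norm (f k t) \<le> norm (indicator A t *\<^sub>R m t) * (norm (c k) * \<rho> ^ k)" for k t
  proof (cases "t \<in> A")
    case True
    hence "\<bar>t\<bar> ^ k \<le> \<rho> ^ k" using bnd[OF True] by (intro power_mono) auto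
    thus ?thesis
      using True by (auto simp: f_eq norm_mult norm_power intro!: mult_left_mono)
  qed (simp add: f_def)
  have int: "integrable lborel (f k)" for k
  proof (rule Bochner_Integration.integrable_bound)
    show "integrable lborel (\<lambda>t. norm (indicator A t *\<^sub>R m t) * (norm (c k) * \<rho> ^ k))"
      by (intro integrable_mult_left m')
    show "AE t in lborel. norm (f k t) \<le> norm (norm (indicator A t *\<^sub>R m t) * (norm (c k) * \<rho> ^ k))"
      using order_trans[OF f_le abs_ge_self] by simp
  qed (rule f_meas)
  have AE: "AE t in lborel. summable (\<lambda>k. norm (f k t))"
  proof (rule AE_I2)
    fix t
    show "summable (\<lambda>k. norm (f k t))"
      by (rule summable_comparison_test'[OF summable_mult[OF c, of "norm (indicator A t *\<^sub>R m t)"]])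
         (use f_le in simp)
  qed
  have int_le: "(LBINT t. norm (f k t)) \<le> (LBINT t. norm (indicator A t *\<^sub>R m t)) * (norm (c k) * \<rho> ^ k)" for k
    by (subst integral_mult_left_zero [symmetric], intro integral_mono integrable_norm int integrable_mult_left m' f_le)
  have sum: "summable (\<lambda>k. LBINT t. norm (f k t))"
    by (rule summable_comparison_test'[OF summable_mult[OF c, of "LBINT t. norm (indicator A t *\<^sub>R m t)"]])
       (use int_le in simp)
  have f_sum: "(\<Sum>k. f k t) = indicator A t *\<^sub>R (m t * (\<Sum>k. c k * of_real t ^ k))" for t
  proof (cases "t \<in> A")
    case True
    have "summable (\<lambda>k. norm (c k * of_real t ^ k))"
    proof (rule summable_comparison_test'[OF c])
      fix k
      have "\<bar>t\<bar> ^ k \<le> \<rho> ^ k" using bnd[OF True] by (intro power_mono) auto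
      thus "norm (norm (c k * of_real t ^ k)) \<le> norm (c k) * \<rho> ^ k"
        by (simp add: norm_mult norm_power mult_left_mono)
    qed
    hence "summable (\<lambda>k. c k * of_real t ^ k)" by (rule summable_norm_cancel)
    thus ?thesis using True by (simp add: f_def suminf_mult)
  qed (simp add: f_def)
  have f_int: "integral\<^sup>L lborel (f k) = c k * (LBINT t:A. m t * of_real t ^ k)" for k
    unfolding set_lebesgue_integral_def
    by (subst integral_mult_right_zero [symmetric]) (simp add: f_def mult_ac)
  show "set_integrable lborel A (\<lambda>t. m t * (\<Sum>k. c k * of_real t ^ k))"
    using integrable_suminf[OF int AE sum] unfolding set_integrable_def f_sum .
  show "(\<lambda>k. c k * (LBINT t:A. m t * of_real t ^ k)) sums (LBINT t:A. m t * (\<Sum>k. c k * of_real t ^ k))"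
    using sums_integral[OF int AE sum] unfolding f_sum f_int set_lebesgue_integral_def .
qed

section \<open>Euler's integral for the hypergeometric function\<close>

lemma Beta_pochhammer:
  fixes a b :: complex
  assumes "Re a > 0" "Re b > 0"
  shows "Beta (a + of_nat k) b = Beta a b * (pochhammer a k / pochhammer (a + b) k)"
proof -
  have "a \<notin> \<int>\<^sub>\<le>\<^sub>0" "b \<notin> \<int>\<^sub>\<le>\<^sub>0" "a + b \<notin> \<int>\<^sub>\<le>\<^sub>0" "a + b + of_nat k \<notin> \<int>\<^sub>\<le>\<^sub>0"
    using assms by (auto intro!: Re_pos_not_nonpos_Ints)
  hence "Gamma a \<noteq> 0" "Gamma (a + b) \<noteq> 0" "Gamma (a + b + of_nat k) \<noteq> 0"
    by (auto simp: Gamma_eq_zero_iff)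
  with \<open>a \<notin> \<int>\<^sub>\<le>\<^sub>0\<close> \<open>a + b \<notin> \<int>\<^sub>\<le>\<^sub>0\<close> show ?thesis
    by (simp add: Beta_def pochhammer_Gamma add_ac field_simps)
qed

lemma complex_of_real_powr_one_minus_sums:
  fixes a :: complex
  assumes "\<bar>z\<bar> < 1"
  shows "(\<lambda>k. pochhammer a k / fact k * of_real z ^ k) sums complex_of_real (1 - z) powr (-a)"
proof -
  have "(\<lambda>k. (-a gchoose k) * (- complex_of_real z) ^ k) sums (1 + (- complex_of_real z)) powr (-a)"
    by (rule gen_binomial_complex) (use assms in simp)
  moreover have "(-a gchoose k) * (- complex_of_real z) ^ k = pochhammer a k / fact k * of_real z ^ k" for k
    by (subst power_minus) (simp add: gbinomial_pochhammer mult_ac)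
  ultimately show ?thesis by (simp add: of_real_diff)
qed

text \<open>The binomial series of (1-zt)^(-a) contributes (a)_k z^k / k!, and the k-th moment of
  the Beta weight contributes the Beta value times (b)_k/(c)_k.\<close>

lemma
  fixes a :: complex and b c z :: real
  assumes b: "b > 0" and cb: "c > b" and z: "0 \<le> z" "z < 1"
  shows set_integrable_Euler_hyp2F1:
      "set_integrable lborel {0<..<1} (\<lambda>t. complex_of_real (t powr (b - 1) * (1 - t) powr (c - b - 1)) *
        complex_of_real (1 - z * t) powr (-a))"
    and LBINT_Euler_hyp2F1:
      "(LBINT t:{0<..<1}. complex_of_real (t powr (b - 1) * (1 - t) powr (c - b - 1)) *
        complex_of_real (1 - z * t) powr (-a)) = of_real (Beta b (c - b)) * hyp2F1 a (of_real b) (of_real c) (of_real z)"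
proof -
  define m where "m = (\<lambda>t. complex_of_real (t powr (b - 1) * (1 - t) powr (c - b - 1)))"
  define d where "d = (\<lambda>k. pochhammer a k / fact k * complex_of_real z ^ k)"
  have m: "set_integrable lborel {0<..<1} m"
    using set_integrable_jacobi_weight[of "c - b - 1" "b - 1" "\<lambda>_. 1"] b cb by (simp add: m_def)
  \<comment> \<open>The binomial series is the hypergeometric series F(a,1;1;z).\<close>
  have d: "summable (\<lambda>k. norm (d k) * 1 ^ k)"
    using summable_norm_hyp2F1[of "complex_of_real z" a "1" 1] z
    by (simp add: d_def hyp2F1_coeff_def pochhammer_fact [symmetric])
  have d_sum: "(\<Sum>k. d k * of_real t ^ k) = complex_of_real (1 - z * t) powr (-a)" if "t \<in> {0<..<1}" for t
  proof -
    have "\<bar>z * t\<bar> < 1 * 1" unfolding abs_mult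
      using that z by (intro mult_strict_mono') auto
    from sums_unique[OF complex_of_real_powr_one_minus_sums[of "z * t" a]] this show ?thesis
      by (simp add: d_def power_mult_distrib mult_ac)
  qed
  have eq: "set_integrable lborel {0<..<1} (\<lambda>t. m t * (\<Sum>k. d k * of_real t ^ k)) \<longleftrightarrow>
      set_integrable lborel {0<..<1} (\<lambda>t. m t * complex_of_real (1 - z * t) powr (-a))"
    by (intro set_integrable_cong refl) (simp add: d_sum)
  have eq': "(LBINT t:{0<..<1}. m t * (\<Sum>k. d k * of_real t ^ k)) =
      (LBINT t:{0<..<1}. m t * complex_of_real (1 - z * t) powr (-a))"
    by (intro set_lebesgue_integral_cong) (simp_all add: d_sum)
  show "set_integrable lborel {0<..<1} (\<lambda>t. complex_of_real (t powr (b - 1) * (1 - t) powr (c - b - 1)) *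
        complex_of_real (1 - z * t) powr (-a))"
    using set_integrable_power_series[OF m _ _ d] unfolding eq unfolding m_def by simp
  have mom: "(LBINT t:{0<..<1}. m t * of_real t ^ k) =
      of_real (Beta b (c - b)) * (pochhammer (of_real b) k / pochhammer (of_real c) k)" for k
  proof -
    have "(LBINT t:{0<..<1}. m t * of_real t ^ k) = (LBINT t:{0<..<1}.
        complex_of_real (t powr (b + real k - 1)) * complex_of_real (1 - t) powr (of_real (c - b) - 1))"
    proof (intro set_lebesgue_integral_cong allI impI)
      fix t :: real assume t: "t \<in> {0<..<1}"
      have "complex_of_real (1 - t) powr (of_real (c - b) - 1) = complex_of_real ((1 - t) powr (c - b - 1))"
        using t powr_of_real[of "1 - t" "c - b - 1"] by (simp add: of_real_diff)
      moreover have "t powr (b + real k - 1) = t powr (b - 1) * t ^ k"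
        using t by (simp add: powr_diff powr_add powr_realpow)
      ultimately show "m t * of_real t ^ k =
          complex_of_real (t powr (b + real k - 1)) * complex_of_real (1 - t) powr (of_real (c - b) - 1)"
        by (simp add: m_def)
    qed simp
    also have "\<dots> = Beta (of_real b + of_nat k) (of_real (c - b))"
      using b cb by (subst LBINT_Beta) auto
    also have "\<dots> = Beta (of_real b) (of_real (c - b)) * (pochhammer (of_real b) k / pochhammer (of_real c) k)"
      using b cb by (subst Beta_pochhammer) (auto simp: of_real_diff)
    finally show ?thesis by (simp only: Beta_complex_of_real)
  qed
  have "(\<lambda>k. d k * (LBINT t:{0<..<1}. m t * of_real t ^ k)) sums
      (LBINT t:{0<..<1}. m t * (\<Sum>k. d k * of_real t ^ k))"
    by (rule sums_set_integral_power_series[OF m _ _ d]) auto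
  moreover have "(\<lambda>k. of_real (Beta b (c - b)) * (hyp2F1_coeff a (of_real b) (of_real c) k * of_real z ^ k)) sums
      (of_real (Beta b (c - b)) * hyp2F1 a (of_real b) (of_real c) (of_real z))"
    using z by (intro sums_mult hyp2F1_sums) auto
  moreover have "d k * (LBINT t:{0<..<1}. m t * of_real t ^ k) =
      of_real (Beta b (c - b)) * (hyp2F1_coeff a (of_real b) (of_real c) k * of_real z ^ k)" for k
    unfolding mom by (simp add: d_def hyp2F1_coeff_def mult_ac)
  ultimately show "(LBINT t:{0<..<1}. complex_of_real (t powr (b - 1) * (1 - t) powr (c - b - 1)) *
        complex_of_real (1 - z * t) powr (-a)) = of_real (Beta b (c - b)) * hyp2F1 a (of_real b) (of_real c) (of_real z)"
    unfolding eq' unfolding m_def by (simp add: sums_iff)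
qed

section \<open>Evaluation of the kernel on both sides of r = 1\<close>

lemma has_vector_derivative_of_real_diff_powr:
  fixes e :: complex
  assumes "t < r"
  shows "((\<lambda>t. complex_of_real (r - t) powr e) has_vector_derivative
    - e * complex_of_real (r - t) powr (e - 1)) (at t within S)"
proof -
  have "complex_of_real r - complex_of_real t \<notin> \<real>\<^sub>\<le>\<^sub>0"
    using assms by (simp flip: of_real_diff)
  hence "((\<lambda>z. (complex_of_real r - z) powr e) has_field_derivative
      - e * (complex_of_real r - complex_of_real t) powr (e - 1)) (at (complex_of_real t))"
    by (auto intro!: derivative_eq_intros)
  from has_vector_derivative_real_field[OF this] show ?thesis by (simp add: of_real_diff)
qed

text \<open>After n integrations by parts the exponent of r - t is -\<nu>-1, independent of n.
  Taking r^(-\<nu>-1) out leaves Euler's integral at z = 1/r < 1.\<close>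

lemma jacobi_kernel_right:
  fixes \<nu> :: complex and \<alpha> \<beta> r :: real
  assumes \<alpha>: "\<alpha> > -1" and \<beta>: "\<beta> > -1" and r: "r > 1"
  shows "(LBINT t:{0<..<1}. complex_of_real (t powr \<beta> * (1 - t) powr \<alpha> * poly (rodrigues_poly n \<alpha> \<beta>) t) *
      complex_of_real (r - t) powr (of_nat n - \<nu> - 1)) =
    pochhammer (-\<nu>) n * of_real (Beta (real n + \<beta> + 1) (real n + \<alpha> + 1)) *
    (of_real r powr (-\<nu> - 1) *
      hyp2F1 (\<nu> + 1) (of_nat n + of_real \<beta> + 1) (2 * of_nat n + of_real \<alpha> + of_real \<beta> + 2) (of_real (1 / r)))"
proof -
  define \<mu> where "\<mu> = of_nat n - \<nu>"
  \<comment> \<open>The i-th derivative in t of (r-t)^(\<mu>-1): each step brings down -(\<mu>-1-i)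
    = (1-\<mu>) + i.\<close>
  define v where "v = (\<lambda>i t. pochhammer (1 - \<mu>) i * complex_of_real (r - t) powr (\<mu> - 1 - of_nat i))"
  have vd: "(v i has_vector_derivative v (Suc i) t) (at t within S)" if "t < r" for i t S
  proof -
    have "(v i has_vector_derivative pochhammer (1 - \<mu>) i *
        (- (\<mu> - 1 - of_nat i) * complex_of_real (r - t) powr (\<mu> - 1 - of_nat i - 1))) (at t within S)"
      unfolding v_def
      by (intro has_vector_derivative_mult_right has_vector_derivative_of_real_diff_powr that)
    moreover have "pochhammer (1 - \<mu>) i * (- (\<mu> - 1 - of_nat i) * complex_of_real (r - t) powr (\<mu> - 1 - of_nat i - 1)) = v (Suc i) t"
      by (simp add: v_def pochhammer_Suc algebra_simps)
    ultimately show ?thesis by simp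
  qed
  have cv: "continuous_on {0..1} (v i)" for i
    unfolding continuous_on_eq_continuous_within
    using vd r by (auto intro!: has_vector_derivative_continuous[OF vd])
  have "(LBINT t:{0<..<1}. complex_of_real (t powr \<beta> * (1 - t) powr \<alpha> * poly (rodrigues_poly n \<alpha> \<beta>) t) * v 0 t) =
      (-1) ^ n * (LBINT t:{0<..<1}. complex_of_real (t powr (\<beta> + real n) * (1 - t) powr (\<alpha> + real n)) * v n t)"
    by (rule rodrigues_by_parts[OF \<alpha> \<beta>]) (use vd cv r in auto)
  also have "(LBINT t:{0<..<1}. complex_of_real (t powr (\<beta> + real n) * (1 - t) powr (\<alpha> + real n)) * v n t) =
      (LBINT t:{0<..<1}. (pochhammer (1 - \<mu>) n * of_real r powr (-\<nu> - 1)) *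
        (complex_of_real (t powr (real n + \<beta> + 1 - 1) * (1 - t) powr ((2 * real n + \<alpha> + \<beta> + 2) - (real n + \<beta> + 1) - 1)) *
          complex_of_real (1 - (1 / r) * t) powr (-(\<nu> + 1))))"
  proof (intro set_lebesgue_integral_cong allI impI)
    fix t :: real assume t: "t \<in> {0<..<1}"
    have "complex_of_real (r - t) = complex_of_real r * complex_of_real (1 - (1 / r) * t)"
      using r by (simp add: of_real_diff field_simps)
    moreover have "1 - (1 / r) * t \<ge> 0" using t r by (simp add: field_simps)
    ultimately have "complex_of_real (r - t) powr (-\<nu> - 1) =
        of_real r powr (-\<nu> - 1) * complex_of_real (1 - (1 / r) * t) powr (-\<nu> - 1)"
      using r by (simp add: powr_times_real)
    hence "v n t = pochhammer (1 - \<mu>) n * (of_real r powr (-\<nu> - 1) * complex_of_real (1 - (1 / r) * t) powr (-\<nu> - 1))"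
      by (simp add: v_def \<mu>_def)
    moreover have "real n + \<beta> + 1 - 1 = \<beta> + real n" "(2 * real n + \<alpha> + \<beta> + 2) - (real n + \<beta> + 1) - 1 = \<alpha> + real n"
      "-(\<nu> + 1) = -\<nu> - 1" by simp_all
    ultimately show "complex_of_real (t powr (\<beta> + real n) * (1 - t) powr (\<alpha> + real n)) * v n t =
        (pochhammer (1 - \<mu>) n * of_real r powr (-\<nu> - 1)) *
        (complex_of_real (t powr (real n + \<beta> + 1 - 1) * (1 - t) powr ((2 * real n + \<alpha> + \<beta> + 2) - (real n + \<beta> + 1) - 1)) *
          complex_of_real (1 - (1 / r) * t) powr (-(\<nu> + 1)))"
      by (simp only: mult_ac)
  qed simp
  also have "\<dots> = (pochhammer (1 - \<mu>) n * of_real r powr (-\<nu> - 1)) *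
      (of_real (Beta (real n + \<beta> + 1) ((2 * real n + \<alpha> + \<beta> + 2) - (real n + \<beta> + 1))) *
        hyp2F1 (\<nu> + 1) (of_real (real n + \<beta> + 1)) (of_real (2 * real n + \<alpha> + \<beta> + 2)) (of_real (1 / r)))"
    unfolding set_integral_mult_right
    by (subst LBINT_Euler_hyp2F1) (use \<alpha> \<beta> r in auto)
  also have "(2 * real n + \<alpha> + \<beta> + 2) - (real n + \<beta> + 1) = real n + \<alpha> + 1" by simp
  finally have "(LBINT t:{0<..<1}. complex_of_real (t powr \<beta> * (1 - t) powr \<alpha> * poly (rodrigues_poly n \<alpha> \<beta>) t) * v 0 t) =
      ((-1) ^ n * pochhammer (1 - \<mu>) n) * of_real (Beta (real n + \<beta> + 1) (real n + \<alpha> + 1)) *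
      (of_real r powr (-\<nu> - 1) * hyp2F1 (\<nu> + 1) (of_real (real n + \<beta> + 1)) (of_real (2 * real n + \<alpha> + \<beta> + 2)) (of_real (1 / r)))"
    by (simp only: mult_ac)
  \<comment> \<open>As 1-\<mu> = \<nu>-n+1, this is the same product of n factors read backwards
    with all signs changed.\<close>
  moreover have "(-1) ^ n * pochhammer (1 - \<mu>) n = pochhammer (-\<nu>) n"
    using pochhammer_minus[of \<nu> n] by (simp add: \<mu>_def algebra_simps)
  ultimately show ?thesis
    by (simp add: v_def \<mu>_def add_ac)
qed

text \<open>Expand (1-t)^(a+m) by the binomial series, multiply by t^(b+m) and differentiate m
  times: t^(b+m+k) turns into (b+1+k)_m t^(b+k). The induction follows the recursion, each step
  applying b + 1 + t d/dt, which multiplies the k-th term by b+1+k.\<close>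

lemma rodrigues_poly_sums:
  fixes a b t :: real
  assumes "\<bar>t\<bar> < 1"
  shows "(\<lambda>k. pochhammer (b + 1 + real k) m * (pochhammer (-(a + real m)) k / fact k) * t ^ k) sums
    ((1 - t) powr a * poly (rodrigues_poly m a b) t)"
  using assms
proof (induction m arbitrary: a b t)
  case 0
  have "(\<lambda>k. (a gchoose k) * (-t) ^ k) sums (1 + (-t)) powr a"
    by (rule gen_binomial_real) (use 0 in simp)
  moreover have "(a gchoose k) * (-t) ^ k = pochhammer (-a) k / fact k * t ^ k" for k
    by (subst power_minus) (simp add: gbinomial_pochhammer mult_ac)
  ultimately show ?case by simp
next
  case (Suc m)
  define p where "p = rodrigues_poly m (a + 1) (b + 1)"
  define c where "c = (\<lambda>k. pochhammer (b + 1 + 1 + real k) m * (pochhammer (-(a + 1 + real m)) k / fact k))"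
  define f where "f = (\<lambda>t. (1 - t) powr (a + 1) * poly p t)"
  have f_sums: "(\<lambda>k. c k * t ^ k) sums f t" if "\<bar>t\<bar> < 1" for t
    using Suc.IH[OF that, of "b + 1" "a + 1"] by (simp add: c_def f_def p_def)
  define K where "K = (\<bar>t\<bar> + 1) / 2"
  have K: "\<bar>t\<bar> < K" "K < 1" "K > 0" using Suc.prems by (simp_all add: K_def)
  have summable: "summable (\<lambda>k. c k * x ^ k)" if "norm x < 1" for x
    using f_sums that by (auto simp: sums_iff)
  have diffs: "((\<lambda>x. \<Sum>k. c k * x ^ k) has_real_derivative (\<Sum>k. diffs c k * t ^ k)) (at t)"
    by (rule termdiffs_strong[OF summable[of K]]) (use K in auto)
  \<comment> \<open>The derivative of \<open>f\<close> is found twice, termwise here and by the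
    product rule in \<open>D2\<close>; equating the two links the series to the recursion of
    \<open>rodrigues_poly\<close>.\<close>
  have D1: "(f has_real_derivative (\<Sum>k. diffs c k * t ^ k)) (at t)"
  proof (rule DERIV_cong_ev[OF refl _ refl, THEN iffD1, OF _ diffs])
    have "eventually (\<lambda>x. x \<in> {-1<..<1}) (nhds t)"
      using Suc.prems by (intro eventually_nhds_in_open) auto
    thus "eventually (\<lambda>x. (\<Sum>k. c k * x ^ k) = f x) (nhds t)"
      by eventually_elim (use f_sums in \<open>auto simp: sums_iff\<close>)
  qed
  have D2: "(f has_real_derivative
      ((a + 1) * (1 - t) powr a * (-1) * poly p t + poly (pderiv p) t * (1 - t) powr (a + 1))) (at t)"
    unfolding f_def
  proof (rule DERIV_mult[OF DERIV_chain2[where f = "\<lambda>t. t powr (a + 1)"] poly_DERIV])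
    show "((\<lambda>t. t powr (a + 1)) has_real_derivative (a + 1) * (1 - t) powr a) (at (1 - t))"
      using has_real_derivative_powr[of "1 - t" "a + 1"] Suc.prems by simp
    show "((\<lambda>t. 1 - t) has_real_derivative -1) (at t)"
      by (auto intro!: derivative_eq_intros)
  qed
  have "(\<lambda>k. real k * c k * t ^ (k - Suc 0)) sums (\<Sum>k. diffs c k * t ^ k)"
    by (rule diffs_equiv, rule termdiff_converges[where K = 1]) (use Suc.prems summable in auto)
  from sums_add[OF sums_mult[OF f_sums[OF Suc.prems], of "b + 1"] sums_mult[OF this, of t]]
  have "(\<lambda>k. (b + 1) * (c k * t ^ k) + t * (real k * c k * t ^ (k - Suc 0))) sums
      ((b + 1) * f t + t * (\<Sum>k. diffs c k * t ^ k))" .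
  also have "(\<lambda>k. (b + 1) * (c k * t ^ k) + t * (real k * c k * t ^ (k - Suc 0))) =
      (\<lambda>k. (b + 1 + real k) * c k * t ^ k)"
  proof
    fix k
    show "(b + 1) * (c k * t ^ k) + t * (real k * c k * t ^ (k - Suc 0)) = (b + 1 + real k) * c k * t ^ k"
      by (cases k) (simp_all add: algebra_simps)
  qed
  also have "(\<lambda>k. (b + 1 + real k) * c k * t ^ k) =
      (\<lambda>k. pochhammer (b + 1 + real k) (Suc m) * (pochhammer (-(a + real (Suc m))) k / fact k) * t ^ k)"
    by (simp add: c_def pochhammer_rec add_ac mult_ac)
  also have "(b + 1) * f t + t * (\<Sum>k. diffs c k * t ^ k) =
      (1 - t) powr a * poly (rodrigues_poly (Suc m) a b) t"
  proof -
    have eq: "(1 - t) powr (a + 1) = (1 - t) * (1 - t) powr a"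
      using Suc.prems by (simp add: powr_add)
    have eq': "poly (rodrigues_poly (Suc m) a b) t =
        t * (1 - t) * poly (pderiv p) t + ((b + 1) * (1 - t) - (a + 1) * t) * poly p t"
      by (simp add: p_def algebra_simps)
    show ?thesis
      unfolding DERIV_unique[OF D1 D2] f_def eq eq' by (simp add: algebra_simps)
  qed
  finally show ?case .
qed

text \<open>Each term of the series from \<open>rodrigues_poly_sums\<close> meets (r-t)^(\<mu>-1) in
  a Beta integral scaled to (0,r). The resulting series in r is hypergeometric, with parameters that
  become those of the claim only after Euler's transformation.\<close>

lemma jacobi_kernel_left:
  fixes \<nu> :: complex and \<alpha> \<beta> r :: real
  assumes \<alpha>: "\<alpha> > -1" and \<beta>: "\<beta> > -1" and r: "0 < r" "r < 1" and \<nu>: "Re \<nu> < real n"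
  shows "(LBINT t:{0<..<r}. complex_of_real (t powr \<beta> * (1 - t) powr \<alpha> * poly (rodrigues_poly n \<alpha> \<beta>) t) *
      complex_of_real (r - t) powr (of_nat n - \<nu> - 1)) =
    Gamma (of_nat n - \<nu>) * Gamma (of_nat n + of_real \<beta> + 1) / Gamma (of_nat n - \<nu> + of_real \<beta> + 1) *
    (of_real r powr (of_nat n - \<nu> + of_real \<beta>) *
      hyp2F1 (of_nat n + of_real \<beta> + 1) (-(of_nat n + of_real \<alpha>)) (of_nat n - \<nu> + of_real \<beta> + 1) (of_real r))"
proof -
  define \<mu> where "\<mu> = of_nat n - \<nu>"
  have \<mu>: "Re \<mu> > 0" using \<nu> by (simp add: \<mu>_def)
  define m where "m = (\<lambda>t. complex_of_real (t powr \<beta>) * complex_of_real (r - t) powr (\<mu> - 1))"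
  define d where "d = (\<lambda>k. pochhammer (\<beta> + 1 + real k) n * (pochhammer (-(\<alpha> + real n)) k / fact k))"
  define E where "E = Gamma \<mu> * Gamma (of_nat n + of_real \<beta> + 1) / Gamma (\<mu> + of_real \<beta> + 1)"
  have d_sums: "(\<lambda>k. d k * t ^ k) sums ((1 - t) powr \<alpha> * poly (rodrigues_poly n \<alpha> \<beta>) t)" if "\<bar>t\<bar> < 1" for t
    using rodrigues_poly_sums[OF that, of \<beta> n \<alpha>] by (simp add: d_def)
  \<comment> \<open>Convergence at (r+1)/2, which lies strictly between r and 1, gives absolute
    convergence at r.\<close>
  have d: "summable (\<lambda>k. norm (complex_of_real (d k)) * r ^ k)"
    using powser_insidea[OF sums_summable[OF d_sums[of "(r + 1) / 2"]], of r] r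
    by (simp add: abs_mult power_abs)
  have mom: "(LBINT t:{0<..<r}. m t * of_real t ^ k) = of_real r powr (of_real \<beta> + of_nat k + \<mu>) * Beta (of_real \<beta> + of_nat k + 1) \<mu>" for k
  proof -
    have "(LBINT t:{0<..<r}. m t * of_real t ^ k) = (LBINT t:{0<..<r}.
        complex_of_real (t powr (\<beta> + real k + 1 - 1)) * complex_of_real (r - t) powr (\<mu> - 1))"
      by (intro set_lebesgue_integral_cong) (auto simp: m_def powr_add powr_realpow)
    also have "\<dots> = of_real r powr (of_real (\<beta> + real k + 1) + \<mu> - 1) * Beta (of_real (\<beta> + real k + 1)) \<mu>"
      unfolding LBINT_Beta_scaled[OF r(1)] using \<beta> \<mu> by (subst LBINT_Beta) auto
    also have "of_real (\<beta> + real k + 1) + \<mu> - 1 = of_real \<beta> + of_nat k + \<mu>" by simp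
    finally show ?thesis by simp
  qed
  have m: "set_integrable lborel {0<..<r} m"
  proof -
    have "{x. 0 + r * x \<in> {0<..<r}} = {0<..<1}"
      using r by (auto simp: zero_less_mult_iff)
    hence "set_integrable lborel {0<..<r} m \<longleftrightarrow> set_integrable lborel {0<..<1} (\<lambda>t. m (r * t))"
      using set_integrable_affine_iff[OF r(1), of "{0<..<r}" m 0] by simp
    also have "\<dots> \<longleftrightarrow> set_integrable lborel {0<..<1} (\<lambda>t. (of_real (r powr \<beta>) * of_real r powr (\<mu> - 1)) *
        (complex_of_real (t powr (\<beta> + 1 - 1)) * complex_of_real (1 - t) powr (\<mu> - 1)))"
    proof (intro set_integrable_cong refl)
      fix t :: real assume t: "t \<in> {0<..<1}"
      have "complex_of_real (r - r * t) = complex_of_real r * complex_of_real (1 - t)"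
        by (simp add: of_real_diff algebra_simps)
      hence "complex_of_real (r - r * t) powr (\<mu> - 1) = of_real r powr (\<mu> - 1) * complex_of_real (1 - t) powr (\<mu> - 1)"
        using t r by (simp add: powr_times_real)
      thus "m (r * t) = (of_real (r powr \<beta>) * of_real r powr (\<mu> - 1)) *
          (complex_of_real (t powr (\<beta> + 1 - 1)) * complex_of_real (1 - t) powr (\<mu> - 1))"
        using t r by (simp add: m_def powr_mult)
    qed
    also have "\<dots>"
      by (intro set_integrable_mult_right set_integrable_Beta) (use \<beta> \<mu> in auto)
    finally show ?thesis .
  qed
  have coeff: "of_real (d k) * (of_real r powr (of_real \<beta> + of_nat k + \<mu>) * Beta (of_real \<beta> + of_nat k + 1) \<mu>) =
      E * of_real r powr (\<mu> + of_real \<beta>) *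
      (hyp2F1_coeff (of_nat n + of_real \<beta> + 1) (-(of_nat n + of_real \<alpha>)) (\<mu> + of_real \<beta> + 1) k * of_real r ^ k)" for k
  proof -
    have r': "complex_of_real r powr (of_real \<beta> + of_nat k + \<mu>) = of_real r powr (\<mu> + of_real \<beta>) * of_real r ^ k"
    proof -
      have "of_real \<beta> + of_nat k + \<mu> = (\<mu> + of_real \<beta>) + of_nat k" by simp
      thus ?thesis using r by (simp only: powr_add) (simp add: powr_nat')
    qed
    have nz: "of_real \<beta> + 1 \<notin> (\<int>\<^sub>\<le>\<^sub>0 :: complex set)" "of_real \<beta> + 1 + of_nat k \<notin> (\<int>\<^sub>\<le>\<^sub>0 :: complex set)"
        "of_real \<beta> + 1 + of_nat n \<notin> (\<int>\<^sub>\<le>\<^sub>0 :: complex set)" "\<mu> + of_real \<beta> + 1 \<notin> \<int>\<^sub>\<le>\<^sub>0"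
        "\<mu> + of_real \<beta> + 1 + of_nat k \<notin> \<int>\<^sub>\<le>\<^sub>0"
      using \<beta> \<mu> by (auto intro!: Re_pos_not_nonpos_Ints)
    \<comment> \<open>The factor (\<beta>+1+k)_n raises Gamma(\<beta>+k+1) from the Beta value to
      Gamma(n+\<beta>+1+k), the source of (n+\<beta>+1)_k.\<close>
    have "pochhammer (of_real \<beta> + 1 + of_nat k) n * Beta (of_real \<beta> + of_nat k + 1) \<mu> =
        E * (pochhammer (of_nat n + of_real \<beta> + 1) k / pochhammer (\<mu> + of_real \<beta> + 1) k)"
      using nz unfolding E_def Beta_def
      by (simp add: pochhammer_Gamma Gamma_eq_zero_iff add_ac field_simps)
    moreover have neg: "-(of_nat n + complex_of_real \<alpha>) = complex_of_real (-(\<alpha> + real n))"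
      by (simp add: of_real_diff)
    have "complex_of_real (d k) = pochhammer (of_real \<beta> + 1 + of_nat k) n *
        (pochhammer (-(of_nat n + of_real \<alpha>)) k / fact k)"
      unfolding neg pochhammer_of_real by (simp add: d_def pochhammer_of_real [symmetric] add_ac)
    ultimately show ?thesis
      unfolding r' hyp2F1_coeff_def by (simp add: mult_ac)
  qed
  have "(\<lambda>k. of_real (d k) * (LBINT t:{0<..<r}. m t * of_real t ^ k)) sums
      (LBINT t:{0<..<r}. m t * (\<Sum>k. of_real (d k) * of_real t ^ k))"
    by (rule sums_set_integral_power_series[OF m _ _ d]) auto
  moreover have "(\<lambda>k. of_real (d k) * (LBINT t:{0<..<r}. m t * of_real t ^ k)) sums
      (E * of_real r powr (\<mu> + of_real \<beta>) *
        hyp2F1 (of_nat n + of_real \<beta> + 1) (-(of_nat n + of_real \<alpha>)) (\<mu> + of_real \<beta> + 1) (of_real r))"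
    unfolding mom coeff by (intro sums_mult hyp2F1_sums) (use r in auto)
  ultimately have "(LBINT t:{0<..<r}. m t * (\<Sum>k. of_real (d k) * of_real t ^ k)) =
      E * of_real r powr (\<mu> + of_real \<beta>) *
        hyp2F1 (of_nat n + of_real \<beta> + 1) (-(of_nat n + of_real \<alpha>)) (\<mu> + of_real \<beta> + 1) (of_real r)"
    by (rule sums_unique2)
  also have "(LBINT t:{0<..<r}. m t * (\<Sum>k. of_real (d k) * of_real t ^ k)) =
      (LBINT t:{0<..<r}. complex_of_real (t powr \<beta> * (1 - t) powr \<alpha> * poly (rodrigues_poly n \<alpha> \<beta>) t) *
        complex_of_real (r - t) powr (of_nat n - \<nu> - 1))"
  proof (intro set_lebesgue_integral_cong allI impI)
    fix t assume t: "t \<in> {0<..<r}"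
    have "(\<lambda>k. complex_of_real (d k) * of_real t ^ k) sums
        of_real ((1 - t) powr \<alpha> * poly (rodrigues_poly n \<alpha> \<beta>) t)"
      using sums_of_real[OF d_sums[of t], where 'a = complex] t r by simp
    from sums_unique[OF this] show "m t * (\<Sum>k. of_real (d k) * of_real t ^ k) =
        complex_of_real (t powr \<beta> * (1 - t) powr \<alpha> * poly (rodrigues_poly n \<alpha> \<beta>) t) *
        complex_of_real (r - t) powr (of_nat n - \<nu> - 1)"
      by (simp add: m_def \<mu>_def mult_ac)
  qed simp
  finally show ?thesis by (simp only: E_def \<mu>_def mult.assoc)
qed

section \<open>Bounds for the kernel that are uniform in the order\<close>

text \<open>Up to constant factors, \<open>K(r)\<close> is the first function for \<open>r > 1\<close> and the second one for
  \<open>0 < r < 1\<close>.\<close>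

definition jacobi_right :: "nat \<Rightarrow> real \<Rightarrow> real \<Rightarrow> complex \<Rightarrow> real \<Rightarrow> complex" where
  "jacobi_right n \<alpha> \<beta> \<nu> r = of_real r powr (-\<nu> - 1) *
     hyp2F1 (\<nu> + 1) (of_nat n + of_real \<beta> + 1) (2 * of_nat n + of_real \<alpha> + of_real \<beta> + 2) (of_real (1 / r))"

definition jacobi_left :: "nat \<Rightarrow> real \<Rightarrow> real \<Rightarrow> complex \<Rightarrow> real \<Rightarrow> complex" where
  "jacobi_left n \<alpha> \<beta> \<nu> r = of_real r powr (of_nat n - \<nu> + of_real \<beta>) *
     hyp2F1 (of_nat n + of_real \<beta> + 1) (-(of_nat n + of_real \<alpha>)) (of_nat n - \<nu> + of_real \<beta> + 1) (of_real r)"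

lemma borel_measurable_hyp2F1 [measurable]:
  assumes [measurable]: "g \<in> borel_measurable M"
  shows "(\<lambda>x. hyp2F1 a b c (g x)) \<in> borel_measurable M"
  unfolding hyp2F1_eq_suminf by measurable

lemma borel_measurable_jacobi_right [measurable]: "jacobi_right n \<alpha> \<beta> \<nu> \<in> borel_measurable borel"
  unfolding jacobi_right_def[abs_def] by measurable

lemma borel_measurable_jacobi_left [measurable]: "jacobi_left n \<alpha> \<beta> \<nu> \<in> borel_measurable borel"
  unfolding jacobi_left_def[abs_def] by measurable

text \<open>The exponent \<open>\<theta>\<close> only has to satisfy \<open>\<theta> < 1\<close> and \<open>\<alpha> + \<theta> > 0\<close>.\<close>

lemma norm_jacobi_right_le:
  fixes \<alpha> \<beta> :: real
  assumes \<alpha>: "\<alpha> > -1" and \<beta>: "\<beta> > -1"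
  obtains C \<theta> where "C \<ge> 0" "\<theta> < 1"
    "\<And>\<nu> r. Re \<nu> \<le> real n \<Longrightarrow> r > 1 \<Longrightarrow>
       norm (jacobi_right n \<alpha> \<beta> \<nu> r) \<le> C * (r powr (-Re \<nu> - 1) * (1 - 1 / r) powr (-\<theta>))"
proof -
  define \<theta> where "\<theta> = (1 + max 0 (-\<alpha>)) / 2"
  have \<theta>: "\<theta> < 1" "\<theta> > 0" "\<alpha> + \<theta> > 0" using \<alpha> by (auto simp: \<theta>_def max_def field_simps)
  define b c where "b = real n + \<beta> + 1" and "c = 2 * real n + \<alpha> + \<beta> + 2"
  have b: "b > 0" "c > b" "b > 0" using \<alpha> \<beta> by (auto simp: b_def c_def)
  define B where "B = Beta b (c - b)"
  have B: "B > 0" unfolding B_def Beta_def using b by (intro divide_pos_pos mult_pos_pos Gamma_real_pos) auto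
  define w where "w = (\<lambda>t. t powr (b - 1) * (1 - t) powr (\<alpha> + \<theta> - 1))"
  have w: "set_integrable lborel {0<..<1} w"
    unfolding w_def by (rule set_integrable_subset[OF integrable_Beta]) (use b \<theta> in auto)
  define C where "C = (LBINT t:{0<..<1}. w t) / B"
  have C: "C \<ge> 0" unfolding C_def set_lebesgue_integral_def
    using B by (intro divide_nonneg_nonneg integral_nonneg_AE) (auto simp: w_def indicator_def)
  show ?thesis
  proof (rule that[OF C \<theta>(1)])
    fix \<nu> :: complex and r :: real
    assume \<nu>: "Re \<nu> \<le> real n" and r: "r > 1"
    define z where "z = 1 / r"
    have z: "0 \<le> z" "z < 1" using r by (auto simp: z_def)
    define g where "g = (\<lambda>t. complex_of_real (t powr (b - 1) * (1 - t) powr (c - b - 1)) *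
        complex_of_real (1 - z * t) powr (-(\<nu> + 1)))"
    have g: "set_integrable lborel {0<..<1} g"
      unfolding g_def by (rule set_integrable_Euler_hyp2F1[OF b(1,2) z])
    have g_le: "norm (g t) \<le> (1 - z) powr (-\<theta>) * w t" if t: "t \<in> {0<..<1}" for t
    proof -
      have zt: "z * t \<le> t" "z * t \<le> z" using z t by (auto intro: mult_left_le_one_le mult_right_le_one_le)
      have zt': "0 < 1 - z * t" "1 - z * t \<le> 1" "1 - t \<le> 1 - z * t" "1 - z \<le> 1 - z * t"
        using zt z t by (auto intro: mult_nonneg_nonneg)
      \<comment> \<open>Since 1-zt <= 1, the worst order is Re \<nu> = n. The exponent n+1 is then
        split: n+1-\<theta> is charged to 1-t, leaving (1-t)^(\<alpha>+\<theta>-1), and \<theta> is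
        charged to 1-z, which leaves the integral. Both 1-t and 1-z lie below 1-zt.\<close>
      have "(1 - z * t) powr (-(Re \<nu> + 1)) \<le> (1 - z * t) powr (-(real n + 1))"
        using zt' \<nu> by (intro powr_mono') auto
      also have "\<dots> = (1 - z * t) powr (-(real n + 1 - \<theta>)) * (1 - z * t) powr (-\<theta>)"
        by (simp flip: powr_add)
      also have "\<dots> \<le> (1 - t) powr (-(real n + 1 - \<theta>)) * (1 - z) powr (-\<theta>)"
        using zt' \<theta> t z by (intro mult_mono powr_mono2') auto
      finally have "norm (g t) \<le> t powr (b - 1) * (1 - t) powr (c - b - 1) *
          ((1 - t) powr (-(real n + 1 - \<theta>)) * (1 - z) powr (-\<theta>))"
        using zt' by (auto simp: g_def norm_mult norm_of_real_powr intro!: mult_left_mono)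
      also have "\<dots> = (1 - z) powr (-\<theta>) * (t powr (b - 1) * ((1 - t) powr (c - b - 1) * (1 - t) powr (-(real n + 1 - \<theta>))))"
        by (simp only: mult_ac)
      also have "(1 - t) powr (c - b - 1) * (1 - t) powr (-(real n + 1 - \<theta>)) = (1 - t) powr (\<alpha> + \<theta> - 1)"
      proof -
        have "(c - b - 1) + (-(real n + 1 - \<theta>)) = \<alpha> + \<theta> - 1" by (simp add: b_def c_def)
        thus ?thesis by (simp only: powr_add [symmetric])
      qed
      finally show ?thesis by (simp add: w_def)
    qed
    have "norm (LBINT t:{0<..<1}. g t) \<le> (LBINT t:{0<..<1}. norm (g t))"
      by (rule set_integral_norm_bound[OF g])
    also have "\<dots> \<le> (LBINT t:{0<..<1}. (1 - z) powr (-\<theta>) * w t)"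
      by (intro set_integral_mono set_integrable_norm g set_integrable_mult_right w g_le)
    also have "\<dots> = (1 - z) powr (-\<theta>) * (C * B)" using B by (simp add: C_def)
    also have "(LBINT t:{0<..<1}. g t) = of_real B * hyp2F1 (\<nu> + 1) (of_real b) (of_real c) (of_real z)"
      unfolding g_def B_def by (rule LBINT_Euler_hyp2F1[OF b(1,2) z])
    finally have "B * norm (hyp2F1 (\<nu> + 1) (of_real b) (of_real c) (of_real z)) \<le> B * (C * (1 - z) powr (-\<theta>))"
      using B by (simp add: norm_mult mult_ac)
    hence "norm (hyp2F1 (\<nu> + 1) (of_real b) (of_real c) (of_real z)) \<le> C * (1 - z) powr (-\<theta>)"
      using B by simp
    hence "r powr (-Re \<nu> - 1) * norm (hyp2F1 (\<nu> + 1) (of_real b) (of_real c) (of_real z)) \<le>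
        r powr (-Re \<nu> - 1) * (C * (1 - z) powr (-\<theta>))"
      by (intro mult_left_mono) auto
    thus "norm (jacobi_right n \<alpha> \<beta> \<nu> r) \<le> C * (r powr (-Re \<nu> - 1) * (1 - 1 / r) powr (-\<theta>))"
      using r by (simp add: jacobi_right_def norm_mult norm_of_real_powr b_def c_def z_def mult_ac)
  qed
qed

text \<open>Since r^(-2) is the derivative of 1-1/r, there is an explicit antiderivative, with
  finite limits at 1 and at infinity because \<theta> < 1.\<close>

lemma set_integrable_right_majorant:
  fixes \<theta> :: real
  assumes "\<theta> < 1"
  shows "set_integrable lborel {1<..} (\<lambda>r. r powr (-2) * (1 - 1 / r) powr (-\<theta>))"
proof -
  let ?F = "\<lambda>r::real. (1 - 1 / r) powr (1 - \<theta>) / (1 - \<theta>)"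
  have lim0: "(?F \<longlongrightarrow> 0) (at_right 1)"
  proof -
    have "((\<lambda>r::real. 1 - 1 / r) \<longlongrightarrow> 1 - 1 / 1) (at_right 1)"
      by (intro tendsto_intros) auto
    hence "((\<lambda>r::real. (1 - 1 / r) powr (1 - \<theta>)) \<longlongrightarrow> 0) (at_right 1)"
      using assms by (intro tendsto_zero_powrI[where b = "1 - \<theta>"]) (auto intro!: tendsto_const eventually_at_rightI[of 1 2])
    thus ?thesis using tendsto_divide_zero[of "\<lambda>r::real. (1 - 1 / r) powr (1 - \<theta>)"] by auto
  qed
  have lim1: "(?F \<longlongrightarrow> 1 / (1 - \<theta>)) at_top"
  proof -
    have "((\<lambda>r::real. 1 - 1 / r) \<longlongrightarrow> 1 - 0) at_top"
      by (intro tendsto_diff tendsto_const tendsto_divide_0[OF tendsto_const filterlim_at_top_imp_at_infinity] filterlim_ident)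
    hence "((\<lambda>r::real. (1 - 1 / r) powr (1 - \<theta>) / (1 - \<theta>)) \<longlongrightarrow> (1 - 0) powr (1 - \<theta>) / (1 - \<theta>)) at_top"
      using assms by (intro tendsto_divide tendsto_powr tendsto_const) auto
    thus ?thesis by simp
  qed
  have "set_integrable lborel (einterval (ereal 1) \<infinity>) (\<lambda>r. r powr (-2) * (1 - 1 / r) powr (-\<theta>))"
  proof (rule interval_integral_FTC_nonneg[where F = ?F])
    fix x :: real assume "ereal 1 < ereal x"
    hence x: "x > 1" by simp
    have "((\<lambda>r. 1 - 1 / r) has_real_derivative 1 / x\<^sup>2) (at x)"
      using x by (auto intro!: derivative_eq_intros simp: power2_eq_square)
    moreover have "((\<lambda>r. r powr (1 - \<theta>)) has_real_derivative (1 - \<theta>) * (1 - 1 / x) powr (1 - \<theta> - 1)) (at (1 - 1 / x))"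
      by (rule has_real_derivative_powr) (use x in simp)
    ultimately have "((\<lambda>r. (1 - 1 / r) powr (1 - \<theta>)) has_real_derivative
        (1 - \<theta>) * (1 - 1 / x) powr (1 - \<theta> - 1) * (1 / x\<^sup>2)) (at x)"
      by (rule DERIV_chain2[rotated])
    moreover have "(1 - \<theta>) * (1 - 1 / x) powr (1 - \<theta> - 1) * (1 / x\<^sup>2) =
        (1 - \<theta>) * (x powr (-2) * (1 - 1 / x) powr (-\<theta>))"
      using x by (simp add: powr_minus_divide)
    ultimately have D: "((\<lambda>r. (1 - 1 / r) powr (1 - \<theta>)) has_real_derivative
        (1 - \<theta>) * (x powr (-2) * (1 - 1 / x) powr (-\<theta>))) (at x)" by simp
    show "(?F has_real_derivative x powr (-2) * (1 - 1 / x) powr (-\<theta>)) (at x)"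
      using DERIV_cdivide[OF D, of "1 - \<theta>"] assms by simp
    show "isCont (\<lambda>r. r powr (-2) * (1 - 1 / r) powr (-\<theta>)) x"
      using x by (intro continuous_intros) auto
  qed (use lim0 lim1 in \<open>auto simp: ereal_tendsto_simps\<close>)
  thus ?thesis by simp
qed

section \<open>Pochhammer bounds, continuity in the order, and the left majorant\<close>

lemma norm_pochhammer_le:
  fixes a :: complex
  assumes "norm a \<le> R"
  shows "norm (pochhammer a k) \<le> pochhammer R k"
proof (induction k)
  case (Suc k)
  have "norm (a + of_nat k) \<le> R + real k"
    using norm_triangle_ineq[of a "of_nat k"] assms by simp
  moreover have "R \<ge> 0" using norm_ge_zero[of a] assms by linarith
  ultimately show ?case
    using Suc by (auto simp: pochhammer_Suc norm_mult intro!: mult_mono order_trans[OF norm_ge_zero Suc])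
qed auto

lemma norm_pochhammer_ge:
  fixes c :: complex
  assumes "R \<le> Re c" "R > 0"
  shows "pochhammer R k \<le> norm (pochhammer c k)"
proof (induction k)
  case (Suc k)
  have "R + real k \<le> norm (c + of_nat k)"
    using complex_Re_le_cmod[of "c + of_nat k"] assms by simp
  thus ?case
    using Suc assms by (auto simp: pochhammer_Suc norm_mult intro!: mult_mono)
qed auto

text \<open>Tannery's theorem: for \<mu> within distance 1 of \<nu> one has |\<mu>+1| <= R, so
  |(\<mu>+1)_k| <= (R)_k and the series with first parameter R dominates.\<close>

lemma tendsto_jacobi_right:
  fixes r :: real
  assumes r: "r > 1"
  shows "((\<lambda>\<mu>. jacobi_right n \<alpha> \<beta> \<mu> r) \<longlongrightarrow> jacobi_right n \<alpha> \<beta> \<nu> r) (at \<nu> within S)"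
proof (cases "at \<nu> within S = bot")
  case False
  define z where "z = complex_of_real (1 / r)"
  define b c where "b = of_nat n + complex_of_real \<beta> + 1"
    and "c = 2 * of_nat n + complex_of_real \<alpha> + complex_of_real \<beta> + 2"
  have z: "norm z < 1" using r by (simp add: z_def norm_divide)
  define R where "R = norm (\<nu> + 1) + 1"
  have "((\<lambda>\<mu>. \<Sum>k. hyp2F1_coeff (\<mu> + 1) b c k * z ^ k) \<longlongrightarrow>
      (\<Sum>k. hyp2F1_coeff (\<nu> + 1) b c k * z ^ k)) (at \<nu> within S)"
  proof (rule tannerys_theorem[THEN conjunct2, THEN conjunct2])
    show "((\<lambda>\<mu>. hyp2F1_coeff (\<mu> + 1) b c k * z ^ k) \<longlongrightarrow> hyp2F1_coeff (\<nu> + 1) b c k * z ^ k) (at \<nu> within S)" for k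
    proof -
      have "((\<lambda>\<mu>. pochhammer (\<mu> + 1) k) \<longlongrightarrow> pochhammer (\<nu> + 1) k) (at \<nu> within S)"
        by (rule isCont_tendsto_compose[OF isCont_pochhammer]) (intro tendsto_intros)
      hence "((\<lambda>\<mu>. pochhammer (\<mu> + 1) k * (pochhammer b k / (pochhammer c k * fact k) * z ^ k)) \<longlongrightarrow>
          pochhammer (\<nu> + 1) k * (pochhammer b k / (pochhammer c k * fact k) * z ^ k)) (at \<nu> within S)"
        by (intro tendsto_intros)
      thus ?thesis by (simp add: hyp2F1_coeff_def mult_ac)
    qed
    show "summable (\<lambda>k. norm (hyp2F1_coeff (of_real R) b c k * z ^ k))"
      by (rule summable_norm_hyp2F1[OF z])
    have "eventually (\<lambda>\<mu>. dist \<mu> \<nu> < 1) (at \<nu> within S)"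
      by (rule tendstoD[OF tendsto_ident_at]) simp
    moreover have "norm (hyp2F1_coeff (\<mu> + 1) b c k * z ^ k) \<le> norm (hyp2F1_coeff (of_real R) b c k * z ^ k)"
      if "dist \<mu> \<nu> < 1" for k \<mu>
    proof -
      have "norm (\<mu> + 1) \<le> R"
        using that norm_triangle_ineq[of "\<mu> - \<nu>" "\<nu> + 1"] by (simp add: R_def dist_norm)
      hence "norm (pochhammer (\<mu> + 1) k) \<le> norm (pochhammer (complex_of_real R) k)"
        using order_trans[OF norm_pochhammer_le[of "\<mu> + 1" R k] abs_ge_self]
        by (simp add: pochhammer_of_real)
      thus ?thesis
        by (simp add: hyp2F1_coeff_def norm_mult norm_divide mult_right_mono divide_right_mono)
    qed
    ultimately show "eventually (\<lambda>(k, \<mu>). norm (hyp2F1_coeff (\<mu> + 1) b c k * z ^ k) \<le>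
        norm (hyp2F1_coeff (of_real R) b c k * z ^ k)) (at_top \<times>\<^sub>F (at \<nu> within S))"
      by (subst eventually_prod_filter) (intro exI[of _ "\<lambda>_. True"] exI[of _ "\<lambda>\<mu>. dist \<mu> \<nu> < 1"], auto)
  qed (use False in auto)
  moreover have "((\<lambda>\<mu>. complex_of_real r powr (-\<mu> - 1)) \<longlongrightarrow> of_real r powr (-\<nu> - 1)) (at \<nu> within S)"
    using r by (intro tendsto_intros) auto
  ultimately show ?thesis
    unfolding jacobi_right_def hyp2F1_eq_suminf b_def c_def z_def by (intro tendsto_mult)
qed auto

text \<open>Uses \<open>\<bar>(n-\<nu>+\<beta>+1)\<^sub>k\<bar> \<ge> (\<beta>+1)\<^sub>k\<close>, valid since \<open>Re \<nu> \<le> n\<close>, to remove \<open>\<nu>\<close> from the coefficients.\<close>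

definition left_majorant_coeff :: "nat \<Rightarrow> real \<Rightarrow> real \<Rightarrow> nat \<Rightarrow> real" where
  "left_majorant_coeff n \<alpha> \<beta> k =
     \<bar>pochhammer (real n + \<beta> + 1) k * pochhammer (-(real n + \<alpha>)) k\<bar> / (pochhammer (\<beta> + 1) k * fact k)"

lemma norm_hyp2F1_coeff_left_le:
  assumes \<beta>: "\<beta> > -1" and \<nu>: "Re \<nu> \<le> real n"
  shows "norm (hyp2F1_coeff (of_nat n + of_real \<beta> + 1) (-(of_nat n + of_real \<alpha>)) (of_nat n - \<nu> + of_real \<beta> + 1) k)
    \<le> left_majorant_coeff n \<alpha> \<beta> k"
proof -
  have "pochhammer (\<beta> + 1) k \<le> norm (pochhammer (of_nat n - \<nu> + of_real \<beta> + 1) k)"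
    by (rule norm_pochhammer_ge) (use \<beta> \<nu> in auto)
  moreover have pos: "pochhammer (\<beta> + 1) k > 0" using \<beta> by (intro pochhammer_pos) auto
  moreover have "norm (pochhammer (of_nat n - \<nu> + of_real \<beta> + 1) k) > 0"
    using calculation(1) pos by linarith
  moreover have "of_nat n + complex_of_real \<beta> + 1 = of_real (real n + \<beta> + 1)"
    "-(of_nat n + complex_of_real \<alpha>) = of_real (-(real n + \<alpha>))" by (simp_all add: of_real_diff)
  ultimately show ?thesis
    unfolding hyp2F1_coeff_def left_majorant_coeff_def
    by (simp only: norm_divide norm_mult pochhammer_of_real norm_of_real abs_mult norm_fact)
       (intro divide_left_mono mult_right_mono mult_pos_pos; simp)
qed

text \<open>The factor |(-(n+\<alpha>))_k|/k! is |binom(n+\<alpha>,k)| = O(k^(-n-\<alpha>-1)), and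
  (n+\<beta>+1)_k/(\<beta>+1)_k = O(k^n). The denominator k+\<beta>+1 comes from integrating
  r^(k+\<beta>), so the terms are O(k^(-\<alpha>-2)), summable because \<alpha> > -1.\<close>

lemma summable_left_majorant:
  assumes \<alpha>: "\<alpha> > -1" and \<beta>: "\<beta> > -1"
  shows "summable (\<lambda>k. left_majorant_coeff n \<alpha> \<beta> k / (real k + \<beta> + 1))"
proof -
  define z where "z = real n + \<alpha>"
  have "Bseq (\<lambda>k. (z gchoose k) / ((-1) ^ k / exp ((z + 1) * of_real (ln (real k)))))"
    by (rule convergent_imp_Bseq) (use gbinomial_asymptotic[of z] in \<open>auto simp: convergent_def\<close>)
  then obtain M where M: "M > 0" "\<And>k. norm ((z gchoose k) / ((-1) ^ k / exp ((z + 1) * of_real (ln (real k))))) \<le> M"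
    by (auto simp: Bseq_def)
  have g: "\<bar>pochhammer (-z) k\<bar> / fact k \<le> M * real k powr (-(z + 1))" if "k \<ge> 1" for k
  proof -
    have "\<bar>pochhammer (-z) k\<bar> / fact k = \<bar>z gchoose k\<bar>"
      by (simp add: gbinomial_pochhammer abs_mult)
    moreover have "\<bar>z gchoose k\<bar> * real k powr (z + 1) \<le> M"
      using M(2)[of k] that by (simp add: powr_def abs_mult power_abs)
    moreover have "real k powr (z + 1) > 0" using that by simp
    ultimately show ?thesis by (simp only: powr_minus) (simp add: field_simps)
  qed
  define E where "E = M * (real n + \<beta> + 2) ^ n / pochhammer (\<beta> + 1) n"
  have P: "pochhammer (\<beta> + 1) k > 0" for k using \<beta> by (intro pochhammer_pos) auto
  have bnd: "norm (left_majorant_coeff n \<alpha> \<beta> k / (real k + \<beta> + 1)) \<le> E * real k powr (-\<alpha> - 2)" if k: "k \<ge> 1" for k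
  proof -
    have up: "pochhammer (x::real) m \<le> (x + real m) ^ m" if "x > 0" for x m
    proof (induction m)
      case (Suc m)
      have "pochhammer x (Suc m) \<le> (x + real m) ^ m * (x + real m)"
        using Suc that by (auto simp: pochhammer_Suc intro!: mult_right_mono)
      also have "\<dots> = (x + real m) ^ Suc m" by simp
      also have "\<dots> \<le> (x + real (Suc m)) ^ Suc m" using that by (intro power_mono) auto
      finally show ?case .
    qed auto
    \<comment> \<open>Both sides equal (\<beta>+1)_(n+k). The quotient of two k-fold products thus
      becomes (\<beta>+1+k)_n/(\<beta>+1)_n, a polynomial of degree n in k.\<close>
    have "pochhammer (\<beta> + 1) n * pochhammer (real n + \<beta> + 1) k = pochhammer (\<beta> + 1) k * pochhammer (\<beta> + 1 + real k) n"
      using pochhammer_product'[of "\<beta> + 1" n k] pochhammer_product'[of "\<beta> + 1" k n] by (simp add: add_ac)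
    hence "pochhammer (real n + \<beta> + 1) k / pochhammer (\<beta> + 1) k = pochhammer (\<beta> + 1 + real k) n / pochhammer (\<beta> + 1) n"
      using P[of k] P[of n] by (simp add: field_simps)
    also have "\<dots> \<le> ((real n + \<beta> + 2) * real k) ^ n / pochhammer (\<beta> + 1) n"
    proof (intro divide_right_mono order_trans[OF up] power_mono)
      have "(real n + \<beta> + 1) * 1 \<le> (real n + \<beta> + 1) * real k" using k \<beta> by (intro mult_left_mono) auto
      thus "\<beta> + 1 + real k + real n \<le> (real n + \<beta> + 2) * real k" by (simp add: algebra_simps)
    qed (use \<beta> P[of n] in auto)
    also have "\<dots> = (real n + \<beta> + 2) ^ n / pochhammer (\<beta> + 1) n * real k powr real n"
      using k by (simp add: power_mult_distrib powr_realpow)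
    finally have A: "pochhammer (real n + \<beta> + 1) k / pochhammer (\<beta> + 1) k \<le>
        (real n + \<beta> + 2) ^ n / pochhammer (\<beta> + 1) n * real k powr real n" .
    have "pochhammer (real n + \<beta> + 1) k \<ge> 0" using \<beta> by (intro pochhammer_nonneg) auto
    hence "left_majorant_coeff n \<alpha> \<beta> k = pochhammer (real n + \<beta> + 1) k / pochhammer (\<beta> + 1) k *
        (\<bar>pochhammer (-z) k\<bar> / fact k)"
      by (simp add: left_majorant_coeff_def abs_mult z_def)
    also have "\<dots> \<le> ((real n + \<beta> + 2) ^ n / pochhammer (\<beta> + 1) n * real k powr real n) * (M * real k powr (-(z + 1)))"
      using A g[OF k] \<beta> P[of n] M by (intro mult_mono) (auto intro!: mult_nonneg_nonneg divide_nonneg_nonneg)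
    also have "\<dots> = E * (real k powr real n * real k powr (-(z + 1)))" by (simp add: E_def)
    also have "real k powr real n * real k powr (-(z + 1)) = real k powr (-\<alpha> - 1)"
      by (simp add: z_def flip: powr_add)
    finally have B: "left_majorant_coeff n \<alpha> \<beta> k \<le> E * real k powr (-\<alpha> - 1)" .
    have nonneg: "left_majorant_coeff n \<alpha> \<beta> k \<ge> 0"
      using P[of k] by (simp add: left_majorant_coeff_def)
    have "left_majorant_coeff n \<alpha> \<beta> k / (real k + \<beta> + 1) \<le> E * real k powr (-\<alpha> - 1) / real k"
      using B nonneg k \<beta> by (intro frac_le) auto
    also have "\<dots> = E * real k powr (-\<alpha> - 2)"
    proof -
      have e: "-\<alpha> - 2 = (-\<alpha> - 1) + (-1)" by simp
      show ?thesis
        unfolding e using k by (subst powr_add) (simp add: powr_minus_divide)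
    qed
    finally show ?thesis using nonneg \<beta> by simp
  qed
  have "summable (\<lambda>k. E * real k powr (-\<alpha> - 2))"
    using \<alpha> by (intro summable_mult) (simp add: summable_real_powr_iff)
  thus ?thesis
    by (rule summable_comparison_test'[where N = 1]) (use bnd in auto)
qed

text \<open>The power r^(n-\<nu>+\<beta>) is replaced by r^\<beta>, its size at the extreme order Re
  \<nu> = n, and distributed over the series for termwise integration.\<close>

definition left_majorant :: "nat \<Rightarrow> real \<Rightarrow> real \<Rightarrow> real \<Rightarrow> real" where
  "left_majorant n \<alpha> \<beta> r = (\<Sum>k. left_majorant_coeff n \<alpha> \<beta> k * r powr (real k + \<beta>))"

lemma left_majorant_coeff_nonneg:
  assumes "\<beta> > -1"
  shows "left_majorant_coeff n \<alpha> \<beta> k \<ge> 0"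
  using assms by (auto simp: left_majorant_coeff_def intro!: divide_nonneg_nonneg mult_nonneg_nonneg pochhammer_nonneg)

lemma summable_left_majorant_powser:
  assumes \<beta>: "\<beta> > -1" and r: "0 < r" "r < 1"
  shows "summable (\<lambda>k. left_majorant_coeff n \<alpha> \<beta> k * r ^ k)"
proof -
  have "left_majorant_coeff n \<alpha> \<beta> k * r ^ k =
      norm (hyp2F1_coeff (of_real (real n + \<beta> + 1)) (of_real (-(real n + \<alpha>))) (of_real (\<beta> + 1)) k * of_real r ^ k)" for k
  proof -
    have "pochhammer (\<beta> + 1) k > 0" using \<beta> by (intro pochhammer_pos) auto
    thus ?thesis
      unfolding hyp2F1_coeff_def left_majorant_coeff_def pochhammer_of_real
      using r by (simp add: norm_mult norm_divide abs_mult norm_power)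
  qed
  thus ?thesis
    using summable_norm_hyp2F1[of "complex_of_real r"] r by simp
qed

lemma left_majorant_eq:
  assumes "r > 0"
  shows "left_majorant_coeff n \<alpha> \<beta> k * r powr (real k + \<beta>) = r powr \<beta> * (left_majorant_coeff n \<alpha> \<beta> k * r ^ k)"
  using assms by (simp add: powr_add powr_realpow)

lemma norm_jacobi_left_le:
  assumes \<beta>: "\<beta> > -1" and \<nu>: "Re \<nu> \<le> real n" and r: "0 < r" "r < 1"
  shows "norm (jacobi_left n \<alpha> \<beta> \<nu> r) \<le> left_majorant n \<alpha> \<beta> r"
proof -
  define d where "d = left_majorant_coeff n \<alpha> \<beta>"
  define h where "h = hyp2F1_coeff (of_nat n + of_real \<beta> + 1) (-(of_nat n + of_real \<alpha>)) (of_nat n - \<nu> + of_real \<beta> + 1)"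
  have sum: "summable (\<lambda>k. d k * r ^ k)"
    unfolding d_def by (rule summable_left_majorant_powser[OF \<beta> r])
  have le: "norm (h k * of_real r ^ k) \<le> d k * r ^ k" for k
    using norm_hyp2F1_coeff_left_le[OF \<beta> \<nu>, of \<alpha> k] r
    by (auto simp: h_def d_def norm_mult norm_power intro!: mult_right_mono)
  have "norm (\<Sum>k. h k * of_real r ^ k) \<le> (\<Sum>k. d k * r ^ k)"
    by (rule norm_suminf_le[OF le sum])
  moreover have "norm (complex_of_real r powr (of_nat n - \<nu> + of_real \<beta>)) \<le> r powr \<beta>"
    using r \<nu> by (simp add: norm_of_real_powr powr_mono')
  ultimately have "norm (jacobi_left n \<alpha> \<beta> \<nu> r) \<le> r powr \<beta> * (\<Sum>k. d k * r ^ k)"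
    unfolding jacobi_left_def hyp2F1_eq_suminf h_def norm_mult by (intro mult_mono) auto
  also have "\<dots> = left_majorant n \<alpha> \<beta> r"
    unfolding d_def left_majorant_def left_majorant_eq[OF r(1)]
    by (rule suminf_mult[OF sum[unfolded d_def], symmetric])
  finally show ?thesis .
qed

text \<open>All terms are nonnegative, so the sum of their integrals decides; the k-th integral is
  the coefficient divided by k+\<beta>+1, obtained as a Beta integral with second parameter
  1.\<close>

lemma set_integrable_left_majorant:
  assumes \<alpha>: "\<alpha> > -1" and \<beta>: "\<beta> > -1"
  shows "set_integrable lborel {0<..<1} (left_majorant n \<alpha> \<beta>)"
proof -
  define d where "d = left_majorant_coeff n \<alpha> \<beta>"
  have d: "d k \<ge> 0" for k unfolding d_def by (rule left_majorant_coeff_nonneg[OF \<beta>])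
  define f where "f = (\<lambda>k r. indicator {0<..<1} r *\<^sub>R (d k * r powr (real k + \<beta>)))"
  have int: "integrable lborel (f k)" and val: "integral\<^sup>L lborel (f k) = d k / (real k + \<beta> + 1)" for k
  proof -
    have I: "set_integrable lborel {0..1} (\<lambda>r. r powr (real k + \<beta> + 1 - 1) * (1 - r) powr (1 - 1))"
      using \<beta> by (intro integrable_Beta) auto
    have eq: "indicator {0<..<1} r *\<^sub>R (r powr (real k + \<beta> + 1 - 1) * (1 - r) powr (1 - 1)) =
        indicator {0<..<1} r *\<^sub>R r powr (real k + \<beta>)" for r :: real
      by (auto simp: indicator_def)
    have "set_integrable lborel {0<..<1} (\<lambda>r. r powr (real k + \<beta> + 1 - 1) * (1 - r) powr (1 - 1))"
      by (rule set_integrable_subset[OF I]) auto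
    hence I': "set_integrable lborel {0<..<1} (\<lambda>r. r powr (real k + \<beta>))"
      unfolding set_integrable_def eq .
    thus "integrable lborel (f k)"
      using set_integrable_mult_right[OF I', of "d k"] by (simp add: f_def set_integrable_def)
    have "(LBINT r:{0<..<1}. r powr (real k + \<beta> + 1 - 1) * (1 - r) powr (1 - 1)) = Beta (real k + \<beta> + 1) 1"
      using set_borel_integral_eq_integral(2)[OF I] has_integral_Beta_real[of "real k + \<beta> + 1" 1] \<beta>
      by (simp only: set_integral_Icc_eq_Ioo[symmetric] has_integral_iff)
    also have "\<dots> = 1 / (real k + \<beta> + 1)"
    proof -
      have *: "real k + \<beta> + 1 > 0" using \<beta> by simp
      hence "real k + \<beta> + 1 \<notin> \<int>\<^sub>\<le>\<^sub>0" by (auto elim!: nonpos_Ints_cases)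
      hence "Gamma (real k + \<beta> + 1 + 1) = (real k + \<beta> + 1) * Gamma (real k + \<beta> + 1)"
        by (rule Gamma_plus1)
      moreover have "Gamma (real k + \<beta> + 1) \<noteq> 0"
        using Gamma_real_pos[OF *] by linarith
      ultimately show ?thesis
        unfolding Beta_def by (simp only:) simp
    qed
    finally have "(LBINT r:{0<..<1}. r powr (real k + \<beta>)) = 1 / (real k + \<beta> + 1)"
      unfolding set_lebesgue_integral_def eq .
    hence "(LBINT r:{0<..<1}. d k * r powr (real k + \<beta>)) = d k / (real k + \<beta> + 1)" by simp
    thus "integral\<^sup>L lborel (f k) = d k / (real k + \<beta> + 1)"
      unfolding f_def set_lebesgue_integral_def .
  qed
  have norm_f: "norm (f k r) = f k r" for k r using d[of k] by (simp add: f_def)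
  have "integrable lborel (\<lambda>r. \<Sum>k. f k r)"
  proof (rule integrable_suminf[OF int])
    show "AE r in lborel. summable (\<lambda>k. norm (f k r))"
    proof (rule AE_I2)
      fix r :: real
      show "summable (\<lambda>k. norm (f k r))"
      proof (cases "r \<in> {0<..<1}")
        case True
        hence "(\<lambda>k. norm (f k r)) = (\<lambda>k. r powr \<beta> * (d k * r ^ k))"
          unfolding norm_f using left_majorant_eq[of r] by (auto simp: f_def d_def)
        thus ?thesis
          using True summable_left_majorant_powser[OF \<beta>, of r n \<alpha>] by (simp add: summable_mult d_def)
      qed (simp add: f_def)
    qed
    show "summable (\<lambda>k. LBINT r. norm (f k r))"
      unfolding norm_f val d_def by (rule summable_left_majorant[OF \<alpha> \<beta>])
  qed
  also have "(\<lambda>r. \<Sum>k. f k r) = (\<lambda>r. indicator {0<..<1} r *\<^sub>R left_majorant n \<alpha> \<beta> r)"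
    by (auto simp: f_def left_majorant_def d_def indicator_def)
  finally show ?thesis unfolding set_integrable_def .
qed

text \<open>Here \<nu> sits in the lower parameter. The approach is confined to Re \<mu> <= n, since
  there the denominators stay away from 0 and \<open>left_majorant_coeff\<close> dominates for
  Tannery's theorem.\<close>

lemma tendsto_jacobi_left:
  fixes r :: real
  assumes \<beta>: "\<beta> > -1" and r: "0 < r" "r < 1" and \<nu>: "Re \<nu> \<le> real n" and S: "S \<subseteq> {\<mu>. Re \<mu> \<le> real n}"
  shows "((\<lambda>\<mu>. jacobi_left n \<alpha> \<beta> \<mu> r) \<longlongrightarrow> jacobi_left n \<alpha> \<beta> \<nu> r) (at \<nu> within S)"
proof (cases "at \<nu> within S = bot")
  case False
  define a b where "a = of_nat n + complex_of_real \<beta> + 1" and "b = -(of_nat n + complex_of_real \<alpha>)"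
  define z where "z = complex_of_real r"
  have "((\<lambda>\<mu>. \<Sum>k. hyp2F1_coeff a b (of_nat n - \<mu> + of_real \<beta> + 1) k * z ^ k) \<longlongrightarrow>
      (\<Sum>k. hyp2F1_coeff a b (of_nat n - \<nu> + of_real \<beta> + 1) k * z ^ k)) (at \<nu> within S)"
  proof (rule tannerys_theorem[THEN conjunct2, THEN conjunct2])
    show "((\<lambda>\<mu>. hyp2F1_coeff a b (of_nat n - \<mu> + of_real \<beta> + 1) k * z ^ k) \<longlongrightarrow>
        hyp2F1_coeff a b (of_nat n - \<nu> + of_real \<beta> + 1) k * z ^ k) (at \<nu> within S)" for k
    proof -
      have "pochhammer (of_nat n - \<nu> + of_real \<beta> + 1) k \<noteq> 0"
        using norm_pochhammer_ge[of "\<beta> + 1" "of_nat n - \<nu> + of_real \<beta> + 1" k] \<beta> \<nu> pochhammer_pos[of "\<beta> + 1" k]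
        by auto
      moreover have "((\<lambda>\<mu>. pochhammer (of_nat n - \<mu> + of_real \<beta> + 1) k) \<longlongrightarrow>
          pochhammer (of_nat n - \<nu> + of_real \<beta> + 1) k) (at \<nu> within S)"
        by (rule isCont_tendsto_compose[OF isCont_pochhammer]) (intro tendsto_intros)
      ultimately show ?thesis
        unfolding hyp2F1_coeff_def by (intro tendsto_intros) auto
    qed
    show "summable (\<lambda>k. left_majorant_coeff n \<alpha> \<beta> k * r ^ k)"
      by (rule summable_left_majorant_powser[OF \<beta> r])
    have "eventually (\<lambda>\<mu>. Re \<mu> \<le> real n) (at \<nu> within S)"
      using S by (auto simp: eventually_at_filter intro!: always_eventually)
    moreover have "norm (hyp2F1_coeff a b (of_nat n - \<mu> + of_real \<beta> + 1) k * z ^ k) \<le> left_majorant_coeff n \<alpha> \<beta> k * r ^ k"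
      if "Re \<mu> \<le> real n" for k \<mu>
      using norm_hyp2F1_coeff_left_le[OF \<beta> that, of \<alpha> k] r
      by (auto simp: a_def b_def z_def norm_mult norm_power intro!: mult_right_mono)
    ultimately show "eventually (\<lambda>(k, \<mu>). norm (hyp2F1_coeff a b (of_nat n - \<mu> + of_real \<beta> + 1) k * z ^ k) \<le>
        left_majorant_coeff n \<alpha> \<beta> k * r ^ k) (at_top \<times>\<^sub>F (at \<nu> within S))"
      by (subst eventually_prod_filter) (intro exI[of _ "\<lambda>_. True"] exI[of _ "\<lambda>\<mu>. Re \<mu> \<le> real n"], auto)
  qed (use False in auto)
  moreover have "((\<lambda>\<mu>. complex_of_real r powr (of_nat n - \<mu> + of_real \<beta>)) \<longlongrightarrow>
      of_real r powr (of_nat n - \<nu> + of_real \<beta>)) (at \<nu> within S)"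
    using r by (intro tendsto_intros) auto
  ultimately show ?thesis
    unfolding jacobi_left_def hyp2F1_eq_suminf a_def b_def z_def by (intro tendsto_mult)
qed auto

text \<open>Convergence along all sequences in S - {\<nu>} suffices, which reduces the claim to
  dominated convergence for sequences.\<close>

lemma tendsto_set_integral_dominated:
  fixes g :: "complex \<Rightarrow> real \<Rightarrow> complex" and w :: "real \<Rightarrow> real"
  assumes meas: "\<And>\<mu>. g \<mu> \<in> borel_measurable borel" and A: "A \<in> sets borel"
    and lim: "\<And>r. r \<in> A \<Longrightarrow> ((\<lambda>\<mu>. g \<mu> r) \<longlongrightarrow> g \<nu> r) (at \<nu> within S)"
    and bound: "\<And>\<mu> r. \<mu> \<in> S \<Longrightarrow> r \<in> A \<Longrightarrow> norm (g \<mu> r) \<le> w r"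
    and w: "set_integrable lborel A w"
  shows "((\<lambda>\<mu>. LBINT r:A. g \<mu> r) \<longlongrightarrow> (LBINT r:A. g \<nu> r)) (at \<nu> within S)"
  unfolding tendsto_at_iff_sequentially
proof (intro allI impI)
  fix X assume X: "\<forall>i. X i \<in> S - {\<nu>}" "X \<longlonglongrightarrow> \<nu>"
  note [measurable] = meas A
  show "((\<lambda>\<mu>. LBINT r:A. g \<mu> r) \<circ> X) \<longlonglongrightarrow> (LBINT r:A. g \<nu> r)"
    unfolding set_lebesgue_integral_def comp_def
  proof (rule integral_dominated_convergence)
    show "integrable lborel (\<lambda>r. indicator A r *\<^sub>R w r)"
      using w unfolding set_integrable_def .
    show "AE r in lborel. (\<lambda>i. indicator A r *\<^sub>R g (X i) r) \<longlonglongrightarrow> indicator A r *\<^sub>R g \<nu> r"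
    proof (rule AE_I2)
      fix r
      have "(\<lambda>i. g (X i) r) \<longlonglongrightarrow> g \<nu> r" if "r \<in> A"
        using lim[OF that] X unfolding tendsto_at_iff_sequentially comp_def by blast
      thus "(\<lambda>i. indicator A r *\<^sub>R g (X i) r) \<longlonglongrightarrow> indicator A r *\<^sub>R g \<nu> r"
        by (cases "r \<in> A") auto
    qed
    show "AE r in lborel. norm (indicator A r *\<^sub>R g (X i) r) \<le> indicator A r *\<^sub>R w r" for i
      using bound[of "X i"] X by (auto simp: indicator_def)
  qed measurable
qed

section \<open>The integral representation\<close>

text \<open>The factor s^(\<sigma>-1) is integrable at 0 because \<sigma> > 0, and
  s^(\<sigma>-\<tau>-1) at infinity because \<tau> > \<sigma>; the integral is split at 1.\<close>

lemma set_integrable_powr_decay: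
  fixes \<sigma> \<tau> :: real
  assumes \<sigma>: "\<sigma> > 0" and \<tau>: "\<tau> > \<sigma>"
  shows "set_integrable lborel {0<..} (\<lambda>s. (1 + s) powr (-\<tau>) * s powr (\<sigma> - 1))"
proof -
  have "set_integrable lborel {0<..<1} (\<lambda>s. s powr (\<sigma> - 1) * (1 - s) powr (1 - 1))"
    by (rule set_integrable_subset[OF integrable_Beta]) (use \<sigma> in auto)
  hence A: "set_integrable lborel {0<..<1} (\<lambda>s. (1 + s) powr (-\<tau>) * s powr (\<sigma> - 1))"
  proof (rule set_integrable_bound)
    show "AE s in lborel. s \<in> {0<..<1} \<longrightarrow> norm ((1 + s) powr (-\<tau>) * s powr (\<sigma> - 1)) \<le>
        norm (s powr (\<sigma> - 1) * (1 - s) powr (1 - 1))"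
    proof (intro AE_I2 impI)
      fix s :: real assume s: "s \<in> {0<..<1}"
      have "(1 + s) powr (-\<tau>) \<le> (1 + s) powr 0" using s \<sigma> \<tau> by (intro powr_mono) auto
      thus "norm ((1 + s) powr (-\<tau>) * s powr (\<sigma> - 1)) \<le> norm (s powr (\<sigma> - 1) * (1 - s) powr (1 - 1))"
        using s by (simp add: abs_mult mult_left_le_one_le)
    qed
  qed (simp add: set_borel_measurable_def)
  have "(\<lambda>s::real. s powr (\<sigma> - \<tau> - 1)) integrable_on {1..}"
    using has_integral_powr_to_inf[of "\<sigma> - \<tau> - 1" 1] \<tau> by (auto simp: integrable_on_def)
  hence "(\<lambda>s::real. s powr (\<sigma> - \<tau> - 1)) absolutely_integrable_on {1..}"
    by (rule nonnegative_absolutely_integrable_1) auto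
  hence "set_integrable lborel {1..} (\<lambda>s::real. s powr (\<sigma> - \<tau> - 1))"
    unfolding set_integrable_def by (simp add: integrable_completion)
  hence B: "set_integrable lborel {1..} (\<lambda>s. (1 + s) powr (-\<tau>) * s powr (\<sigma> - 1))"
  proof (rule set_integrable_bound)
    show "AE s in lborel. s \<in> {1..} \<longrightarrow> norm ((1 + s) powr (-\<tau>) * s powr (\<sigma> - 1)) \<le> norm (s powr (\<sigma> - \<tau> - 1))"
    proof (intro AE_I2 impI)
      fix s :: real assume s: "s \<in> {1..}"
      have "(1 + s) powr (-\<tau>) * s powr (\<sigma> - 1) \<le> s powr (-\<tau>) * s powr (\<sigma> - 1)"
        using s \<sigma> \<tau> by (intro mult_right_mono powr_mono2') auto
      also have "\<dots> = s powr (-\<tau> + (\<sigma> - 1))" by (rule powr_add [symmetric])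
      also have "-\<tau> + (\<sigma> - 1) = \<sigma> - \<tau> - 1" by simp
      finally show "norm ((1 + s) powr (-\<tau>) * s powr (\<sigma> - 1)) \<le> norm (s powr (\<sigma> - \<tau> - 1))" by simp
    qed
  qed (simp add: set_borel_measurable_def)
  have "{0<..<1} \<union> {1..} = ({0<..} :: real set)" by auto
  thus ?thesis using set_integrable_Un[OF A B] by simp
qed

lemma weyl_integral_affine:
  assumes d: "d > 0"
  shows "weyl_integral \<mu> f (c + d * t) = of_real d powr \<mu> / Gamma \<mu> *
    (LBINT r:{t<..}. f (c + d * r) * complex_of_real (r - t) powr (\<mu> - 1))"
proof -
  have dom: "{r. c + d * r \<in> {c + d * t<..}} = {t<..}" using d by auto
  have "(LBINT y:{c + d * t<..}. f y * complex_of_real (y - (c + d * t)) powr (\<mu> - 1)) =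
      of_real d * (LBINT r:{t<..}. f (c + d * r) * complex_of_real (c + d * r - (c + d * t)) powr (\<mu> - 1))"
    unfolding set_integral_affine[OF d, of "{c + d * t<..}" _ c] dom by (simp add: scaleR_conv_of_real)
  also have "(LBINT r:{t<..}. f (c + d * r) * complex_of_real (c + d * r - (c + d * t)) powr (\<mu> - 1)) =
      (LBINT r:{t<..}. of_real d powr (\<mu> - 1) * (f (c + d * r) * complex_of_real (r - t) powr (\<mu> - 1)))"
  proof (intro set_lebesgue_integral_cong allI impI)
    fix r assume r: "r \<in> {t<..}"
    have "complex_of_real (c + d * r - (c + d * t)) = complex_of_real d * complex_of_real (r - t)"
      by (simp add: of_real_diff algebra_simps)
    thus "f (c + d * r) * complex_of_real (c + d * r - (c + d * t)) powr (\<mu> - 1) =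
        of_real d powr (\<mu> - 1) * (f (c + d * r) * complex_of_real (r - t) powr (\<mu> - 1))"
      using r d by (simp add: powr_times_real)
  qed simp
  also have "of_real d * \<dots> = (of_real d * of_real d powr (\<mu> - 1)) *
      (LBINT r:{t<..}. f (c + d * r) * complex_of_real (r - t) powr (\<mu> - 1))" by simp
  also have "of_real d * complex_of_real d powr (\<mu> - 1) = of_real d powr \<mu>"
    using d by (simp add: powr_diff)
  finally show ?thesis by (simp add: weyl_integral_def)
qed

text \<open>The right side of the formula without the factor (2\<delta>)^(-\<nu>), in the variable r
  = (y+1)/2. Gamma(n-\<nu>) is already cancelled and the \<nu>-dependent Gamma factors are written
  with the entire function \<open>rGamma\<close>, so the expression remains meaningful at Re \<nu> =
  n.\<close>

definition jacobi_integral :: "nat \<Rightarrow> real \<Rightarrow> real \<Rightarrow> (real \<Rightarrow> complex) \<Rightarrow> complex \<Rightarrow> complex" where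
  "jacobi_integral n \<alpha> \<beta> F \<nu> =
     rGamma (-\<nu>) * (LBINT r:{1<..}. F r * jacobi_right n \<alpha> \<beta> \<nu> r) +
     Gamma (of_nat n + of_real \<beta> + 1) * rGamma (of_nat n - \<nu> + of_real \<beta> + 1) /
       of_real (Beta (real n + \<beta> + 1) (real n + \<alpha> + 1)) *
     (LBINT r:{0<..<1}. F r * jacobi_left n \<alpha> \<beta> \<nu> r)"

context
  fixes n :: nat and \<alpha> \<beta> \<tau> M :: real and F :: "real \<Rightarrow> complex"
  assumes n: "n > 0" and \<alpha>: "\<alpha> > -1" and \<beta>: "\<beta> > -1"
    and \<tau>: "\<tau> > 0"
    and F_meas [measurable]: "F \<in> borel_measurable borel"
    and F_le: "\<And>r. r \<ge> 0 \<Longrightarrow> norm (F r) \<le> M * (1 + r) powr (-\<tau>)"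
begin

lemma M_nonneg: "M \<ge> 0"
  using order_trans[OF norm_ge_zero F_le[of 0]] by simp

text \<open>Decay of \<open>F\<close> and of the kernel together give r^(-\<tau>-Re \<nu>-1); the
  condition 1 <= \<tau> + Re \<nu> makes this at most r^(-2), the power in
  \<open>set_integrable_right_majorant\<close>.\<close>

lemma jacobi_right_dominated:
  obtains w where "set_integrable lborel {1<..} w"
    "\<And>\<nu> r. Re \<nu> \<le> real n \<Longrightarrow> 1 \<le> \<tau> + Re \<nu> \<Longrightarrow> r > 1 \<Longrightarrow> norm (F r * jacobi_right n \<alpha> \<beta> \<nu> r) \<le> w r"
proof -
  obtain C \<theta> where C: "C \<ge> 0" "\<theta> < 1" "\<And>\<nu> r. Re \<nu> \<le> real n \<Longrightarrow> r > 1 \<Longrightarrow>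
       norm (jacobi_right n \<alpha> \<beta> \<nu> r) \<le> C * (r powr (-Re \<nu> - 1) * (1 - 1 / r) powr (-\<theta>))"
    using norm_jacobi_right_le[OF \<alpha> \<beta>, of n] by metis
  show ?thesis
  proof (rule that)
    show "set_integrable lborel {1<..} (\<lambda>r. (M * C) * (r powr (-2) * (1 - 1 / r) powr (-\<theta>)))"
      by (intro set_integrable_mult_right set_integrable_right_majorant C)
    fix \<nu> :: complex and r :: real
    assume \<nu>: "Re \<nu> \<le> real n" "1 \<le> \<tau> + Re \<nu>" and r: "r > 1"
    have "norm (F r) \<le> M * r powr (-\<tau>)"
      using r \<tau> M_nonneg by (intro order_trans[OF F_le] mult_left_mono powr_mono2') auto
    hence "norm (F r * jacobi_right n \<alpha> \<beta> \<nu> r) \<le>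
        (M * r powr (-\<tau>)) * (C * (r powr (-Re \<nu> - 1) * (1 - 1 / r) powr (-\<theta>)))"
      unfolding norm_mult using C(3)[OF \<nu>(1) r] M_nonneg by (intro mult_mono) auto
    also have "\<dots> = (M * C) * ((r powr (-\<tau>) * r powr (-Re \<nu> - 1)) * (1 - 1 / r) powr (-\<theta>))"
      by (simp only: mult_ac)
    also have "r powr (-\<tau>) * r powr (-Re \<nu> - 1) = r powr (-\<tau> + (-Re \<nu> - 1))"
      by (rule powr_add [symmetric])
    also have "(M * C) * (r powr (-\<tau> + (-Re \<nu> - 1)) * (1 - 1 / r) powr (-\<theta>)) \<le>
        (M * C) * (r powr (-2) * (1 - 1 / r) powr (-\<theta>))"
      using r \<nu> C(1) M_nonneg by (intro mult_left_mono mult_right_mono powr_mono) auto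
    finally show "norm (F r * jacobi_right n \<alpha> \<beta> \<nu> r) \<le> (M * C) * (r powr (-2) * (1 - 1 / r) powr (-\<theta>))" .
  qed
qed

lemma jacobi_left_dominated:
  assumes "Re \<nu> \<le> real n" "r \<in> {0<..<1}"
  shows "norm (F r * jacobi_left n \<alpha> \<beta> \<nu> r) \<le> M * left_majorant n \<alpha> \<beta> r"
proof -
  have "(1 + r) powr (-\<tau>) \<le> (1 + r) powr 0" using assms \<tau> by (intro powr_mono) auto
  hence "norm (F r) \<le> M * 1"
    using assms M_nonneg by (intro order_trans[OF F_le] mult_left_mono) auto
  thus ?thesis
    unfolding norm_mult using norm_jacobi_left_le[OF \<beta> assms(1), of r \<alpha>] assms M_nonneg
    by (intro mult_mono) auto
qed

lemma set_integrable_jacobi_right: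
  assumes "Re \<nu> \<le> real n" "1 \<le> \<tau> + Re \<nu>"
  shows "set_integrable lborel {1<..} (\<lambda>r. F r * jacobi_right n \<alpha> \<beta> \<nu> r)"
proof -
  obtain w where w: "set_integrable lborel {1<..} w"
    "\<And>\<nu> r. Re \<nu> \<le> real n \<Longrightarrow> 1 \<le> \<tau> + Re \<nu> \<Longrightarrow> r > 1 \<Longrightarrow> norm (F r * jacobi_right n \<alpha> \<beta> \<nu> r) \<le> w r"
    using jacobi_right_dominated by blast
  show ?thesis
    by (rule set_integrable_bound[OF w(1)])
       (use order_trans[OF w(2)[OF assms] abs_ge_self] in \<open>auto simp: set_borel_measurable_def\<close>)
qed

lemma set_integrable_jacobi_left:
  assumes "Re \<nu> \<le> real n"
  shows "set_integrable lborel {0<..<1} (\<lambda>r. F r * jacobi_left n \<alpha> \<beta> \<nu> r)"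
  by (rule set_integrable_bound[OF set_integrable_mult_right[OF set_integrable_left_majorant[OF \<alpha> \<beta>], of M n]])
     (use order_trans[OF jacobi_left_dominated[OF assms] abs_ge_self] in \<open>auto simp: set_borel_measurable_def\<close>)

lemma tendsto_jacobi_integral:
  assumes \<nu>: "Re \<nu> \<le> real n" "1 < \<tau> + Re \<nu>"
  shows "(jacobi_integral n \<alpha> \<beta> F \<longlongrightarrow> jacobi_integral n \<alpha> \<beta> F \<nu>) (at \<nu> within {\<mu>. Re \<mu> < real n})"
proof -
  \<comment> \<open>The strict inequality at \<nu> is an open condition, so the approach region may
    be shrunk to orders for which the right majorant is valid.\<close>
  define S where "S = {\<mu>. Re \<mu> < real n \<and> 1 < \<tau> + Re \<mu>}"
  have at_eq: "at \<nu> within {\<mu>. Re \<mu> < real n} = at \<nu> within S"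
  proof (rule at_within_nhd)
    show "open {\<mu>. 1 < \<tau> + Re \<mu>}" by (intro open_Collect_less continuous_intros)
  qed (use \<nu> in \<open>auto simp: S_def\<close>)
  obtain w where w: "set_integrable lborel {1<..} w"
    "\<And>\<nu> r. Re \<nu> \<le> real n \<Longrightarrow> 1 \<le> \<tau> + Re \<nu> \<Longrightarrow> r > 1 \<Longrightarrow> norm (F r * jacobi_right n \<alpha> \<beta> \<nu> r) \<le> w r"
    using jacobi_right_dominated by blast
  have "((\<lambda>\<mu>. LBINT r:{1<..}. F r * jacobi_right n \<alpha> \<beta> \<mu> r) \<longlongrightarrow>
      (LBINT r:{1<..}. F r * jacobi_right n \<alpha> \<beta> \<nu> r)) (at \<nu> within S)"
    by (rule tendsto_set_integral_dominated[OF _ _ _ _ w(1)])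
       (auto intro!: tendsto_intros tendsto_jacobi_right w(2) simp: S_def)
  moreover have "((\<lambda>\<mu>. LBINT r:{0<..<1}. F r * jacobi_left n \<alpha> \<beta> \<mu> r) \<longlongrightarrow>
      (LBINT r:{0<..<1}. F r * jacobi_left n \<alpha> \<beta> \<nu> r)) (at \<nu> within S)"
    by (rule tendsto_set_integral_dominated[OF _ _ _ _ set_integrable_mult_right[OF set_integrable_left_majorant[OF \<alpha> \<beta>], of M n]])
       (auto intro!: tendsto_mult[OF tendsto_const] tendsto_jacobi_left jacobi_left_dominated \<beta> \<nu> simp: S_def)
  moreover have "((\<lambda>\<mu>. rGamma (-\<mu>)) \<longlongrightarrow> rGamma (-\<nu>)) (at \<nu> within S)"
    "((\<lambda>\<mu>. rGamma (of_nat n - \<mu> + of_real \<beta> + 1)) \<longlongrightarrow> rGamma (of_nat n - \<nu> + of_real \<beta> + 1)) (at \<nu> within S)"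
    by ((rule isCont_tendsto_compose[OF isCont_rGamma[OF continuous_ident]], intro tendsto_intros)+)
  moreover have "complex_of_real (Beta (real n + \<beta> + 1) (real n + \<alpha> + 1)) \<noteq> 0"
  proof -
    have "Beta (real n + \<beta> + 1) (real n + \<alpha> + 1) > 0"
      unfolding Beta_def using \<alpha> \<beta> by (intro divide_pos_pos mult_pos_pos Gamma_real_pos) auto
    thus ?thesis by simp
  qed
  ultimately show ?thesis
    unfolding at_eq jacobi_integral_def[abs_def] by (intro tendsto_intros)
qed

text \<open>The lower bound on \<tau> says Re \<mu> < \<tau>, which makes the inner integral
  converge at infinity. After the interchange the kernel vanishes for r <= 0 and is given by
  \<open>jacobi_kernel_left\<close> and \<open>jacobi_kernel_right\<close> elsewhere.\<close>

lemma jacobi_weight_weyl_integral: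
  assumes \<nu>: "Re \<nu> < real n" "real n < \<tau> + Re \<nu>"
  shows "(LBINT t:{0<..<1}. complex_of_real (t powr \<beta> * (1 - t) powr \<alpha> * poly (rodrigues_poly n \<alpha> \<beta>) t) *
      (LBINT r:{t<..}. F r * complex_of_real (r - t) powr (of_nat n - \<nu> - 1))) =
    Gamma (of_nat n - \<nu>) * of_real (Beta (real n + \<beta> + 1) (real n + \<alpha> + 1)) * jacobi_integral n \<alpha> \<beta> F \<nu>"
proof -
  define \<mu> where "\<mu> = of_nat n - \<nu>"
  define B where "B = complex_of_real (Beta (real n + \<beta> + 1) (real n + \<alpha> + 1))"
  have \<mu>: "Re \<mu> > 0" "Re \<mu> < \<tau>" using \<nu> by (auto simp: \<mu>_def)
  define u where "u = (\<lambda>t. complex_of_real (t powr \<beta> * (1 - t) powr \<alpha> * poly (rodrigues_poly n \<alpha> \<beta>) t))"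
  define w where "w = (\<lambda>t. indicator {0<..<1} t *\<^sub>R u t)"
  have [measurable]: "poly (rodrigues_poly n \<alpha> \<beta>) \<in> borel_measurable borel"
    by (intro borel_measurable_continuous_onI continuous_intros)
  have u_meas [measurable]: "u \<in> borel_measurable borel" unfolding u_def by measurable
  have w_meas [measurable]: "w \<in> borel_measurable borel" unfolding w_def by measurable
  have w_int: "integrable lborel w"
    using set_integrable_jacobi_weight[OF \<alpha> \<beta>, of "\<lambda>t. of_real (poly (rodrigues_poly n \<alpha> \<beta>) t)"]
    by (simp add: w_def u_def set_integrable_def continuous_intros)
  \<comment> \<open>A majorant of the inner integrand for all t in (0,1) at once: (1+t+s)^(-\<tau>)
    <= (1+s)^(-\<tau>).\<close>
  define k where "k = (\<lambda>s. M * ((1 + s) powr (-\<tau>) * s powr (Re \<mu> - 1)))"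
  have k: "set_integrable lborel {0<..} k"
    unfolding k_def by (intro set_integrable_mult_right set_integrable_powr_decay \<mu>)
  have F_k: "norm (F (t + s)) * s powr (Re \<mu> - 1) \<le> k s" if "t \<in> {0<..<1}" "s \<in> {0<..}" for t s
  proof -
    have "norm (F (t + s)) \<le> M * (1 + s) powr (-\<tau>)"
      using that \<tau> M_nonneg by (intro order_trans[OF F_le] mult_left_mono powr_mono2') auto
    thus ?thesis
      unfolding k_def mult.assoc[symmetric] by (intro mult_right_mono) auto
  qed
  have int: "set_integrable lborel {0<..} (\<lambda>s. norm (F (t + s)) * s powr (Re \<mu> - 1))" if "t \<in> {0<..<1}" for t
    by (rule set_integrable_bound[OF k])
       (use order_trans[OF F_k[OF that] abs_ge_self] in \<open>auto simp: set_borel_measurable_def abs_mult\<close>)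
  define D where "D = (LBINT s:{0<..}. k s)"
  have bound: "norm (w t) * (LBINT s:{0<..}. norm (F (t + s)) * s powr (Re \<mu> - 1)) \<le> norm (w t) * D" for t
  proof (cases "t \<in> {0<..<1}")
    case True
    thus ?thesis unfolding D_def
      by (intro mult_left_mono set_integral_mono int k F_k) auto
  qed (simp add: w_def)
  have wt: "t \<in> {0<..<1}" if "w t \<noteq> 0" for t
    using that by (auto simp: w_def indicator_def split: if_splits)
  note fubini = fractional_fubini[OF w_meas F_meas integrable_mult_left[OF integrable_norm[OF w_int], of D] int[OF wt] bound]
  have K0: "(LBINT t:{..<r}. w t * complex_of_real (r - t) powr (\<mu> - 1)) = 0" if "r \<le> 0" for r
    unfolding set_lebesgue_integral_def
    using that by (intro integral_eq_zero_AE AE_I2) (auto simp: w_def indicator_def)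
  define E where "E = Gamma \<mu> * Gamma (of_nat n + of_real \<beta> + 1) / Gamma (\<mu> + of_real \<beta> + 1)"
  have K1: "(LBINT t:{..<r}. w t * complex_of_real (r - t) powr (\<mu> - 1)) = E * jacobi_left n \<alpha> \<beta> \<nu> r"
    if r: "0 < r" "r < 1" for r
  proof -
    have "(LBINT t:{..<r}. w t * complex_of_real (r - t) powr (\<mu> - 1)) =
        (LBINT t:{0<..<r}. u t * complex_of_real (r - t) powr (\<mu> - 1))"
      unfolding set_lebesgue_integral_def using r
      by (intro Bochner_Integration.integral_cong) (auto simp: w_def indicator_def)
    thus ?thesis
      using jacobi_kernel_left[OF \<alpha> \<beta> r \<nu>(1)] unfolding u_def \<mu>_def E_def jacobi_left_def by simp
  qed
  have K2: "(LBINT t:{..<r}. w t * complex_of_real (r - t) powr (\<mu> - 1)) = pochhammer (-\<nu>) n * B * jacobi_right n \<alpha> \<beta> \<nu> r"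
    if r: "r > 1" for r
  proof -
    have "(LBINT t:{..<r}. w t * complex_of_real (r - t) powr (\<mu> - 1)) =
        (LBINT t:{0<..<1}. u t * complex_of_real (r - t) powr (\<mu> - 1))"
      unfolding set_lebesgue_integral_def using r
      by (intro Bochner_Integration.integral_cong) (auto simp: w_def indicator_def)
    thus ?thesis
      using jacobi_kernel_right[OF \<alpha> \<beta> r, of n \<nu>] unfolding u_def \<mu>_def B_def jacobi_right_def by simp
  qed
  have intR: "set_integrable lborel {1<..} (\<lambda>r. F r * jacobi_right n \<alpha> \<beta> \<nu> r)"
    using \<nu> n by (intro set_integrable_jacobi_right) auto
  have intL: "set_integrable lborel {0<..<1} (\<lambda>r. F r * jacobi_left n \<alpha> \<beta> \<nu> r)"
    using \<nu> by (intro set_integrable_jacobi_left) auto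
  have "(LBINT t:{0<..<1}. u t * (LBINT r:{t<..}. F r * complex_of_real (r - t) powr (\<mu> - 1))) =
      (LBINT t. w t * (LBINT r:{t<..}. F r * complex_of_real (r - t) powr (\<mu> - 1)))"
    by (simp add: w_def set_lebesgue_integral_def)
  also have "\<dots> = (LBINT r. F r * (LBINT t:{..<r}. w t * complex_of_real (r - t) powr (\<mu> - 1)))"
    by (rule fubini(2))
  also have "\<dots> = (LBINT r. (indicator {0<..<1} r *\<^sub>R (E * (F r * jacobi_left n \<alpha> \<beta> \<nu> r))) +
      (indicator {1<..} r *\<^sub>R (pochhammer (-\<nu>) n * B * (F r * jacobi_right n \<alpha> \<beta> \<nu> r))))"
  proof (rule integral_cong_AE)
    show "(\<lambda>r. F r * (LBINT t:{..<r}. w t * complex_of_real (r - t) powr (\<mu> - 1))) \<in> borel_measurable lborel"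
      using fubini(1) by (rule borel_measurable_integrable)
    \<comment> \<open>At r = 1 neither kernel formula applies, but a single point is a null
      set.\<close>
    have "AE r in lborel. r \<noteq> (1::real)" by (rule AE_lborel_singleton)
    thus "AE r in lborel. F r * (LBINT t:{..<r}. w t * complex_of_real (r - t) powr (\<mu> - 1)) =
        (indicator {0<..<1} r *\<^sub>R (E * (F r * jacobi_left n \<alpha> \<beta> \<nu> r))) +
        (indicator {1<..} r *\<^sub>R (pochhammer (-\<nu>) n * B * (F r * jacobi_right n \<alpha> \<beta> \<nu> r)))"
    proof eventually_elim
      case (elim r)
      consider "r \<le> 0" | "0 < r" "r < 1" | "r > 1" using elim by linarith
      thus ?case by cases (simp_all add: K0 K1 K2)
    qed
  qed measurable
  also have "\<dots> = E * (LBINT r:{0<..<1}. F r * jacobi_left n \<alpha> \<beta> \<nu> r) +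
      pochhammer (-\<nu>) n * B * (LBINT r:{1<..}. F r * jacobi_right n \<alpha> \<beta> \<nu> r)"
    using set_integrable_mult_right[OF intL, of E] set_integrable_mult_right[OF intR, of "pochhammer (-\<nu>) n * B"]
    unfolding set_integral_mult_right [symmetric] unfolding set_integrable_def set_lebesgue_integral_def
    by (rule Bochner_Integration.integral_add)
  also have "\<dots> = Gamma \<mu> * B * jacobi_integral n \<alpha> \<beta> F \<nu>"
  proof -
    have "\<mu> \<notin> \<int>\<^sub>\<le>\<^sub>0" "\<mu> + of_real \<beta> + 1 \<notin> \<int>\<^sub>\<le>\<^sub>0"
      using \<mu> \<beta> by (auto intro!: Re_pos_not_nonpos_Ints)
    hence "Gamma \<mu> \<noteq> 0" by (simp add: Gamma_eq_zero_iff)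
    \<comment> \<open>This turns (-\<nu>)_n into Gamma(\<mu>)/Gamma(-\<nu>), also for integers 0 <=
      \<nu> < n, where both sides are 0.\<close>
    moreover have "rGamma (-\<nu>) = pochhammer (-\<nu>) n * rGamma \<mu>"
      using pochhammer_rGamma[of "-\<nu>" n] by (simp add: \<mu>_def)
    ultimately have "pochhammer (-\<nu>) n = rGamma (-\<nu>) * Gamma \<mu>"
      by (simp add: rGamma_inverse_Gamma)
    moreover have "E = Gamma \<mu> * (Gamma (of_nat n + of_real \<beta> + 1) * rGamma (of_nat n - \<nu> + of_real \<beta> + 1))"
      by (simp add: E_def \<mu>_def rGamma_inverse_Gamma divide_inverse)
    moreover have "B \<noteq> 0"
    proof -
      have "Beta (real n + \<beta> + 1) (real n + \<alpha> + 1) > 0"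
        unfolding Beta_def using \<alpha> \<beta> by (intro divide_pos_pos mult_pos_pos Gamma_real_pos) auto
      thus ?thesis by (simp add: B_def)
    qed
    ultimately show ?thesis
      unfolding jacobi_integral_def B_def[symmetric] by (simp add: field_simps)
  qed
  finally show ?thesis by (simp only: u_def \<mu>_def B_def)
qed

end

text \<open>The sign (-1)^n of the definition cancels that of Rodrigues' formula, Gamma(\<mu>) and
  the Beta value cancel, and (2\<delta>)^\<mu> from rescaling the Weyl integral over (2\<delta>)^n
  leaves (2\<delta>)^(-\<nu>).\<close>

lemma frac_jacobi_deriv_eq:
  fixes f :: "real \<Rightarrow> complex" and x \<delta> :: real
  defines "F \<equiv> \<lambda>r. f (x - \<delta> + 2 * \<delta> * r)"
  assumes "n > 0" "\<alpha> > -1" "\<beta> > -1" "\<delta> > 0" "\<tau> > 0"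
    and "F \<in> borel_measurable borel"
    and "\<And>r. r \<ge> 0 \<Longrightarrow> norm (F r) \<le> M * (1 + r) powr (-\<tau>)"
    and "Re \<nu> < real n" "real n < \<tau> + Re \<nu>"
  shows "frac_jacobi_deriv \<delta> \<alpha> \<beta> \<nu> n f x = of_real (2 * \<delta>) powr (-\<nu>) * jacobi_integral n \<alpha> \<beta> F \<nu>"
proof -
  define \<mu> where "\<mu> = of_nat n - \<nu>"
  define B where "B = complex_of_real (Beta (real n + \<beta> + 1) (real n + \<alpha> + 1))"
  define u where "u = (\<lambda>t. complex_of_real (t powr \<beta> * (1 - t) powr \<alpha> * poly (rodrigues_poly n \<alpha> \<beta>) t))"
  have d: "2 * \<delta> > 0" using assms by simp
  have "(LBINT t:{0<..<1}. u t * weyl_integral \<mu> f (x - \<delta> + 2 * \<delta> * t)) =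
      of_real (2 * \<delta>) powr \<mu> / Gamma \<mu> *
      (LBINT t:{0<..<1}. u t * (LBINT r:{t<..}. F r * complex_of_real (r - t) powr (\<mu> - 1)))"
    unfolding weyl_integral_affine[OF d] F_def set_integral_mult_right [symmetric] by (simp only: mult_ac)
  also have "\<dots> = of_real (2 * \<delta>) powr \<mu> / Gamma \<mu> * (Gamma \<mu> * B * jacobi_integral n \<alpha> \<beta> F \<nu>)"
    using jacobi_weight_weyl_integral[of n \<alpha> \<beta> \<tau> F M \<nu>] assms unfolding u_def \<mu>_def B_def by simp
  finally have "frac_jacobi_deriv \<delta> \<alpha> \<beta> \<nu> n f x = ((-1) ^ n * (-1) ^ n) / (of_real (2 * \<delta>) ^ n * B) *
      (of_real (2 * \<delta>) powr \<mu> / Gamma \<mu> * (Gamma \<mu> * B * jacobi_integral n \<alpha> \<beta> F \<nu>))"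
    unfolding frac_jacobi_deriv_def jacobi_deriv_eq[OF assms(3,4,2,5)] u_def \<mu>_def B_def
    by (simp add: mult.assoc)
  moreover have "Gamma \<mu> \<noteq> 0"
    using Re_pos_not_nonpos_Ints[of \<mu>] assms by (simp add: \<mu>_def Gamma_eq_zero_iff)
  moreover have "B \<noteq> 0"
  proof -
    have "Beta (real n + \<beta> + 1) (real n + \<alpha> + 1) > 0"
      unfolding Beta_def using assms by (intro divide_pos_pos mult_pos_pos Gamma_real_pos) auto
    thus ?thesis by (simp add: B_def)
  qed
  moreover have "complex_of_real (2 * \<delta>) powr \<mu> = of_real (2 * \<delta>) ^ n * of_real (2 * \<delta>) powr (-\<nu>)"
  proof -
    have "\<mu> = of_nat n + (-\<nu>)" by (simp add: \<mu>_def)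
    thus ?thesis using d by (simp only: powr_add) (simp add: powr_nat')
  qed
  moreover have "(-1) ^ n * (-1) ^ n = (1 :: complex)"
    by (simp flip: power_mult_distrib)
  moreover have "complex_of_real (2 * \<delta>) ^ n \<noteq> 0" using d by simp
  ultimately show ?thesis by (simp only: divide_simps) simp
qed

text \<open>Decay controls the tail and continuity the compact remainder. Writing 1 + r keeps the
  bound finite at r = 0; nothing is claimed for r < 0, where \<open>f\<close> is arbitrary.\<close>

lemma bigo_powr_imp_bounded:
  fixes f :: "real \<Rightarrow> complex"
  assumes f: "continuous_on UNIV f" "f \<in> O[at_top](\<lambda>x. complex_of_real (x powr (-\<tau>)))"
    and \<tau>: "\<tau> > 0" and d: "d > 0"
  obtains M where "\<And>r. r \<ge> 0 \<Longrightarrow> norm (f (c + d * r)) \<le> M * (1 + r) powr (-\<tau>)"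
proof -
  obtain C where C: "C > 0" "eventually (\<lambda>y. norm (f y) \<le> C * norm (complex_of_real (y powr (-\<tau>)))) at_top"
    using landau_o.bigE[OF f(2)] by blast
  from C(2) obtain y0 where "\<forall>y\<ge>y0. norm (f y) \<le> C * norm (complex_of_real (y powr (-\<tau>)))"
    unfolding eventually_at_top_linorder by blast
  hence y0: "norm (f y) \<le> C * y powr (-\<tau>)" if "y \<ge> y0" for y
    using that by simp
  \<comment> \<open>For r > R the three entries give 1 + r <= 2r, c + dr >= y0 and c + dr >= dr/2;
    together c + dr >= (d/4)(1+r), the origin of d/4 in \<open>M\<close>.\<close>
  define R where "R = max 1 (max ((y0 - c) / d) (-2 * c / d))"
  have "compact ((\<lambda>r. f (c + d * r)) ` {0..R})"
    by (intro compact_continuous_image compact_Icc continuous_on_compose2[OF f(1)] continuous_intros) auto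
  from compact_imp_bounded[OF this] obtain K where "\<forall>z\<in>(\<lambda>r. f (c + d * r)) ` {0..R}. norm z \<le> K"
    unfolding bounded_iff by blast
  hence K: "norm (f (c + d * r)) \<le> K" if "r \<in> {0..R}" for r
    using that by blast
  have K0: "K \<ge> 0" using order_trans[OF norm_ge_zero K[of 0]] by (simp add: R_def)
  define M where "M = max (K * (1 + R) powr \<tau>) (C * (d / 4) powr (-\<tau>))"
  show ?thesis
  proof (rule that)
    fix r :: real assume r: "r \<ge> 0"
    show "norm (f (c + d * r)) \<le> M * (1 + r) powr (-\<tau>)"
    proof (cases "r \<le> R")
      case True
      have "1 = (1 + R) powr \<tau> * (1 + R) powr (-\<tau>)"
        by (simp add: R_def flip: powr_add)
      also have "\<dots> \<le> (1 + R) powr \<tau> * (1 + r) powr (-\<tau>)"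
        using True r \<tau> by (intro mult_left_mono powr_mono2') auto
      finally have "K * 1 \<le> K * ((1 + R) powr \<tau> * (1 + r) powr (-\<tau>))"
        using K0 by (intro mult_left_mono)
      also have "\<dots> \<le> M * (1 + r) powr (-\<tau>)"
        unfolding mult.assoc [symmetric] M_def by (intro mult_right_mono) auto
      finally show ?thesis using K[of r] True r by simp
    next
      case False
      hence "r \<ge> 1" "(y0 - c) / d \<le> r" "-2 * c / d \<le> r" by (auto simp: R_def)
      hence *: "r \<ge> 1" "y0 \<le> c + d * r" "-2 * c \<le> d * r" using d by (auto simp: field_simps)
      have "d / 4 * (1 + r) \<le> d / 4 * (2 * r)" using d *(1) by (intro mult_left_mono) auto
      hence le: "d / 4 * (1 + r) \<le> c + d * r" using *(3) by simp
      have "norm (f (c + d * r)) \<le> C * (c + d * r) powr (-\<tau>)" by (rule y0) (use * in simp)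
      also have "\<dots> \<le> C * (d / 4 * (1 + r)) powr (-\<tau>)"
        using C(1) le d r \<tau> by (intro mult_left_mono powr_mono2') auto
      also have "(d / 4 * (1 + r)) powr (-\<tau>) = (d / 4) powr (-\<tau>) * (1 + r) powr (-\<tau>)"
        by (rule powr_mult)
      also have "C * \<dots> \<le> M * (1 + r) powr (-\<tau>)"
        unfolding mult.assoc [symmetric] M_def by (intro mult_right_mono) auto
      finally show ?thesis .
    qed
  qed
qed

lemma jacobi_right_affine:
  fixes \<nu> :: complex
  assumes "r > 1"
  shows "1 / complex_of_real (-1 + 2 * r + 1) powr (\<nu> + 1) *
      hyp2F1 (\<nu> + 1) (of_nat n + of_real \<beta> + 1) (2 * of_nat n + of_real \<alpha> + of_real \<beta> + 2)
        (complex_of_real (2 / (-1 + 2 * r + 1))) =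
    2 powr (-\<nu> - 1) * jacobi_right n \<alpha> \<beta> \<nu> r"
proof -
  have "complex_of_real (-1 + 2 * r + 1) = complex_of_real 2 * complex_of_real r" by simp
  hence "complex_of_real (-1 + 2 * r + 1) powr (-(\<nu> + 1)) = 2 powr (-(\<nu> + 1)) * of_real r powr (-(\<nu> + 1))"
    using assms by (simp only: powr_times_real) (simp add: powr_times_real)
  moreover have "1 / complex_of_real (-1 + 2 * r + 1) powr (\<nu> + 1) = complex_of_real (-1 + 2 * r + 1) powr (-(\<nu> + 1))"
    by (rule powr_minus_divide [symmetric])
  moreover have "2 / (-1 + 2 * r + 1) = 1 / r" by simp
  ultimately show ?thesis
    unfolding jacobi_right_def by simp
qed

text \<open>Euler's transformation with c-a = n+\<beta>+1 and c-b = -(n+\<alpha>) produces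
  (1-r)^(c-a-b) = (1-r)^(-(n+\<alpha>-\<nu>)), which is cancelled by the power of 1-y in the
  formula.\<close>

lemma jacobi_left_affine:
  fixes \<nu> :: complex
  assumes \<beta>: "\<beta> > -1" and r: "r \<in> {0<..<1}" and \<nu>: "Re \<nu> \<le> real n"
  shows "complex_of_real (1 - (-1 + 2 * r)) powr (of_nat n + of_real \<alpha> - \<nu>) *
      complex_of_real (1 + (-1 + 2 * r)) powr (of_nat n + of_real \<beta> - \<nu>) *
      hyp2F1 (- \<nu>) (2 * of_nat n - \<nu> + of_real \<alpha> + of_real \<beta> + 1) (of_nat n - \<nu> + of_real \<beta> + 1)
        (complex_of_real ((1 + (-1 + 2 * r)) / 2)) =
    2 powr (2 * of_nat n + of_real \<alpha> + of_real \<beta> - 2 * \<nu>) * jacobi_left n \<alpha> \<beta> \<nu> r"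
proof -
  define a b c where "a = - \<nu>" and "b = 2 * of_nat n - \<nu> + of_real \<alpha> + of_real \<beta> + 1"
    and "c = of_nat n - \<nu> + complex_of_real \<beta> + 1"
  define p q where "p = of_nat n + of_real \<alpha> - \<nu>" and "q = of_nat n + of_real \<beta> - \<nu>"
  have c: "c \<notin> \<int>\<^sub>\<le>\<^sub>0" using \<beta> \<nu> by (intro Re_pos_not_nonpos_Ints) (simp add: c_def)
  have pq: "c - a - b = -p" "c - a = of_nat n + of_real \<beta> + 1" "c - b = -(of_nat n + of_real \<alpha>)"
    "of_nat n - \<nu> + of_real \<beta> = q" "2 * of_nat n + of_real \<alpha> + of_real \<beta> - 2 * \<nu> = p + q"
    by (simp_all add: a_def b_def c_def p_def q_def)
  have "complex_of_real (1 - (-1 + 2 * r)) = complex_of_real 2 * complex_of_real (1 - r)"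
    "complex_of_real (1 + (-1 + 2 * r)) = complex_of_real 2 * complex_of_real r"
    by (simp_all add: of_real_diff)
  hence P: "complex_of_real (1 - (-1 + 2 * r)) powr p = 2 powr p * complex_of_real (1 - r) powr p"
    "complex_of_real (1 + (-1 + 2 * r)) powr q = 2 powr q * complex_of_real r powr q"
    using r by (simp_all only: powr_times_real) (simp_all add: powr_times_real)
  have E: "hyp2F1 a b c (of_real r) = complex_of_real (1 - r) powr (-p) * hyp2F1 (c - a) (c - b) c (of_real r)"
    using hyp2F1_Euler_transform[of "complex_of_real r" c a b] r c by (simp add: pq(1) of_real_diff)
  have cancel: "complex_of_real (1 - r) powr p * complex_of_real (1 - r) powr (-p) = 1"
    using r by (simp add: powr_minus)
  have "complex_of_real (1 - (-1 + 2 * r)) powr p * complex_of_real (1 + (-1 + 2 * r)) powr q *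
      hyp2F1 a b c (of_real r) =
      (2 powr p * 2 powr q) * (complex_of_real (1 - r) powr p * complex_of_real (1 - r) powr (-p)) *
      (complex_of_real r powr q * hyp2F1 (c - a) (c - b) c (of_real r))"
    unfolding P E by (simp only: mult_ac)
  also have "\<dots> = 2 powr (p + q) * (complex_of_real r powr q * hyp2F1 (c - a) (c - b) c (of_real r))"
    unfolding cancel by (simp add: powr_add)
  also have "complex_of_real r powr q * hyp2F1 (c - a) (c - b) c (of_real r) = jacobi_left n \<alpha> \<beta> \<nu> r"
    unfolding jacobi_left_def pq(2,3) unfolding pq(4) [symmetric] c_def ..
  also have "complex_of_real r = complex_of_real ((1 + (-1 + 2 * r)) / 2)" by simp
  finally show ?thesis
    unfolding pq(5) unfolding p_def q_def a_def b_def c_def .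
qed

text \<open>A Bochner integral of a non-integrable function is 0 by default, so integrability of
  both integrands is part of the claim. The open intervals leave out y = 1, where both Gauss series
  would be evaluated at 1, outside the open disc. \<open>rGamma\<close> realizes the convention for
  1/Gamma(-\<nu>).\<close>

theorem theorem4p3:
  fixes n :: nat and \<alpha> \<beta> \<delta> :: real and \<nu> :: complex and f :: "real \<Rightarrow> complex"
  assumes "n > 0" and "\<alpha> > -1" and "\<beta> > -1" and "\<delta> > 0"
    and "Re \<nu> \<le> real n"
    and "continuous_on UNIV f"
    and "\<exists>\<epsilon>>0. f \<in> O[at_top](\<lambda>x. complex_of_real (x powr (Re \<nu> - real n - \<epsilon>)))"
  shows "\<forall>x.
    let a = complex_of_real \<alpha>; b = complex_of_real \<beta>; N = (of_nat n :: complex);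
        \<phi> = (\<lambda>y::real. f (x + \<delta> * y) * (1 / complex_of_real (y + 1) powr (\<nu> + 1)) *
               hyp2F1 (\<nu> + 1) (N + b + 1) (2 * N + a + b + 2) (complex_of_real (2 / (y + 1))));
        \<psi> = (\<lambda>y::real. f (x + \<delta> * y) *
               complex_of_real (1 - y) powr (N + a - \<nu>) *
               complex_of_real (1 + y) powr (N + b - \<nu>) *
               hyp2F1 (- \<nu>) (2 * N - \<nu> + a + b + 1) (N - \<nu> + b + 1)
                 (complex_of_real ((1 + y) / 2)));
        R = rGamma (- \<nu>) * (1 / complex_of_real \<delta> powr \<nu>) * (LBINT y:{1<..}. \<phi> y) +
            Gamma (2 * N + a + b + 2) /
              (2 powr (2 * N - \<nu> + a + b + 1) * Gamma (N + a + 1) * Gamma (N - \<nu> + b + 1)) *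
              (1 / complex_of_real \<delta> powr \<nu>) * (LBINT y:{-1<..<1}. \<psi> y)
    in set_integrable lborel {1<..} \<phi> \<and> set_integrable lborel {-1<..<1} \<psi> \<and>
       (Re \<nu> < real n \<longrightarrow> frac_jacobi_deriv \<delta> \<alpha> \<beta> \<nu> n f x = R) \<and>
       (Re \<nu> = real n \<longrightarrow>
          ((\<lambda>\<mu>. frac_jacobi_deriv \<delta> \<alpha> \<beta> \<mu> n f x) \<longlongrightarrow> R) (at \<nu> within {\<mu>. Re \<mu> < real n}))"
proof
  fix x :: real
  define a b N where abN: "a = complex_of_real \<alpha>" "b = complex_of_real \<beta>" "N = (of_nat n :: complex)"
  define \<phi> where "\<phi> = (\<lambda>y::real. f (x + \<delta> * y) * (1 / complex_of_real (y + 1) powr (\<nu> + 1)) *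
      hyp2F1 (\<nu> + 1) (N + b + 1) (2 * N + a + b + 2) (complex_of_real (2 / (y + 1))))"
  define \<psi> where "\<psi> = (\<lambda>y::real. f (x + \<delta> * y) *
      complex_of_real (1 - y) powr (N + a - \<nu>) * complex_of_real (1 + y) powr (N + b - \<nu>) *
      hyp2F1 (- \<nu>) (2 * N - \<nu> + a + b + 1) (N - \<nu> + b + 1) (complex_of_real ((1 + y) / 2)))"
  define R where "R = rGamma (- \<nu>) * (1 / complex_of_real \<delta> powr \<nu>) * (LBINT y:{1<..}. \<phi> y) +
      Gamma (2 * N + a + b + 2) /
        (2 powr (2 * N - \<nu> + a + b + 1) * Gamma (N + a + 1) * Gamma (N - \<nu> + b + 1)) *
        (1 / complex_of_real \<delta> powr \<nu>) * (LBINT y:{-1<..<1}. \<psi> y)"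
  obtain \<epsilon> where \<epsilon>: "\<epsilon> > 0" "f \<in> O[at_top](\<lambda>x. complex_of_real (x powr (Re \<nu> - real n - \<epsilon>)))"
    using assms(7) by blast
  \<comment> \<open>The decay rate of f. Since \<tau> + Re \<nu> = n + \<epsilon>, it exceeds n
    because \<epsilon> > 0, and hence exceeds 1 because n >= 1.\<close>
  define \<tau> where "\<tau> = real n - Re \<nu> + \<epsilon>"
  have \<tau>: "\<tau> > 0" "real n < \<tau> + Re \<nu>" "1 < \<tau> + Re \<nu>" "1 \<le> \<tau> + Re \<nu>"
    using assms(1,5) \<epsilon>(1) by (simp_all add: \<tau>_def)
  have "Re \<nu> - real n - \<epsilon> = -\<tau>" by (simp add: \<tau>_def)
  then obtain M where M: "\<And>r. r \<ge> 0 \<Longrightarrow> norm (f ((x - \<delta>) + 2 * \<delta> * r)) \<le> M * (1 + r) powr (-\<tau>)"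
    using bigo_powr_imp_bounded[OF assms(6), of \<tau> "2 * \<delta>" "x - \<delta>"] \<epsilon>(2) \<tau>(1) assms(4) by auto
  define F where "F = (\<lambda>r. f (x - \<delta> + 2 * \<delta> * r))"
  have F_meas: "F \<in> borel_measurable borel"
    unfolding F_def by (intro borel_measurable_continuous_onI continuous_on_compose2[OF assms(6)] continuous_intros) auto
  have F_le: "norm (F r) \<le> M * (1 + r) powr (-\<tau>)" if "r \<ge> 0" for r
    unfolding F_def by (rule M[OF that])
  have f_F: "f (x + \<delta> * (-1 + 2 * r)) = F r" for r
    by (simp add: F_def algebra_simps)
  have \<phi>: "\<phi> (-1 + 2 * r) = 2 powr (-\<nu> - 1) * (F r * jacobi_right n \<alpha> \<beta> \<nu> r)" if "r \<in> {1<..}" for r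
    using jacobi_right_affine[of r \<nu> n \<beta> \<alpha>] that unfolding \<phi>_def f_F abN
    by (simp only: mult.assoc greaterThan_iff mult.left_commute)
  have \<psi>: "\<psi> (-1 + 2 * r) = 2 powr (2 * N + a + b - 2 * \<nu>) * (F r * jacobi_left n \<alpha> \<beta> \<nu> r)" if "r \<in> {0<..<1}" for r
    using jacobi_left_affine[OF assms(3) that assms(5), of \<alpha>] unfolding \<psi>_def f_F abN
    by (simp only: mult.assoc mult.left_commute)
  have dom: "{r. -1 + 2 * r \<in> {1<..}} = ({1<..} :: real set)" "{r. -1 + 2 * r \<in> {-1<..<1}} = ({0<..<1} :: real set)" by auto
  have int_right: "set_integrable lborel {1<..} (\<lambda>r. F r * jacobi_right n \<alpha> \<beta> \<nu> r)"
    by (rule set_integrable_jacobi_right[OF assms(1-3) \<tau>(1) F_meas F_le assms(5) \<tau>(4)])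
  have int_left: "set_integrable lborel {0<..<1} (\<lambda>r. F r * jacobi_left n \<alpha> \<beta> \<nu> r)"
    by (rule set_integrable_jacobi_left[OF assms(1-3) \<tau>(1) F_meas F_le assms(5)])
  have int_\<phi>: "set_integrable lborel {1<..} \<phi>"
    using set_integrable_mult_right[OF int_right, of "2 powr (-\<nu> - 1)"]
    by (subst set_integrable_affine_iff[of 2 _ _ "-1"], simp, unfold dom, subst set_integrable_cong[OF refl refl \<phi>]) auto
  have int_\<psi>: "set_integrable lborel {-1<..<1} \<psi>"
    using set_integrable_mult_right[OF int_left, of "2 powr (2 * N + a + b - 2 * \<nu>)"]
    by (subst set_integrable_affine_iff[of 2 _ _ "-1"], simp, unfold dom, subst set_integrable_cong[OF refl refl \<psi>]) auto
  have val_\<phi>: "(LBINT y:{1<..}. \<phi> y) = 2 powr (-\<nu>) * (LBINT r:{1<..}. F r * jacobi_right n \<alpha> \<beta> \<nu> r)"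
  proof -
    have "(LBINT y:{1<..}. \<phi> y) = 2 * (LBINT r:{1<..}. \<phi> (-1 + 2 * r))"
      by (subst set_integral_affine[of 2 _ _ "-1"]) (simp_all only: dom, simp_all add: scaleR_conv_of_real)
    also have "(LBINT r:{1<..}. \<phi> (-1 + 2 * r)) = (LBINT r:{1<..}. 2 powr (-\<nu> - 1) * (F r * jacobi_right n \<alpha> \<beta> \<nu> r))"
      using \<phi> by (intro set_lebesgue_integral_cong) auto
    finally show ?thesis by (simp add: powr_diff)
  qed
  have val_\<psi>: "(LBINT y:{-1<..<1}. \<psi> y) =
      2 powr (2 * N + a + b + 1 - 2 * \<nu>) * (LBINT r:{0<..<1}. F r * jacobi_left n \<alpha> \<beta> \<nu> r)"
  proof -
    have "(LBINT y:{-1<..<1}. \<psi> y) = 2 * (LBINT r:{0<..<1}. \<psi> (-1 + 2 * r))"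
      by (subst set_integral_affine[of 2 _ _ "-1"]) (simp_all only: dom, simp_all add: scaleR_conv_of_real)
    also have "(LBINT r:{0<..<1}. \<psi> (-1 + 2 * r)) =
        (LBINT r:{0<..<1}. 2 powr (2 * N + a + b - 2 * \<nu>) * (F r * jacobi_left n \<alpha> \<beta> \<nu> r))"
      using \<psi> by (intro set_lebesgue_integral_cong) auto
    also have "2 * \<dots> = (2 * 2 powr (2 * N + a + b - 2 * \<nu>)) * (LBINT r:{0<..<1}. F r * jacobi_left n \<alpha> \<beta> \<nu> r)"
      by simp
    also have "2 * 2 powr (2 * N + a + b - 2 * \<nu>) = 2 powr (1 + (2 * N + a + b - 2 * \<nu>))"
      by (simp only: powr_add) simp
    also have "1 + (2 * N + a + b - 2 * \<nu>) = 2 * N + a + b + 1 - 2 * \<nu>" by simp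
    finally show ?thesis .
  qed
  have R: "R = of_real (2 * \<delta>) powr (-\<nu>) * jacobi_integral n \<alpha> \<beta> F \<nu>"
  proof -
    define P where "P = complex_of_real \<delta> powr (-\<nu>)"
    have P: "1 / complex_of_real \<delta> powr \<nu> = P" by (simp add: P_def powr_minus_divide)
    have P2: "complex_of_real (2 * \<delta>) powr (-\<nu>) = 2 powr (-\<nu>) * P"
      using assms(4) powr_times_real[of 2 "complex_of_real \<delta>" "-\<nu>"] by (simp add: P_def)
    \<comment> \<open>The first factor cancels the power of 2 in the denominator of the formula; the
      second belongs to (2\<delta>)^(-\<nu>).\<close>
    have T: "2 powr (2 * N + a + b + 1 - 2 * \<nu>) = 2 powr (2 * N - \<nu> + a + b + 1) * 2 powr (-\<nu>)"
      by (simp add: algebra_simps flip: powr_add)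
    have pos: "Gamma (2 * N + a + b + 2) \<noteq> 0" "Gamma (N + a + 1) \<noteq> 0" "Gamma (N + b + 1) \<noteq> 0"
      using assms(1-3) by (auto simp: Gamma_eq_zero_iff abN intro!: Re_pos_not_nonpos_Ints)
    have "complex_of_real (Beta (real n + \<beta> + 1) (real n + \<alpha> + 1)) = Beta (N + b + 1) (N + a + 1)"
      by (simp add: abN flip: Beta_complex_of_real)
    also have "\<dots> = Gamma (N + b + 1) * Gamma (N + a + 1) / Gamma (2 * N + a + b + 2)"
      by (simp add: Beta_def algebra_simps)
    finally have B: "complex_of_real (Beta (real n + \<beta> + 1) (real n + \<alpha> + 1)) =
        Gamma (N + b + 1) * Gamma (N + a + 1) / Gamma (2 * N + a + b + 2)" .
    have "Gamma (N + b + 1) * rGamma (N - \<nu> + b + 1) / of_real (Beta (real n + \<beta> + 1) (real n + \<alpha> + 1)) =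
        Gamma (2 * N + a + b + 2) / (Gamma (N + a + 1) * Gamma (N - \<nu> + b + 1))"
      unfolding B using pos by (simp add: rGamma_inverse_Gamma field_simps)
    thus ?thesis
      unfolding R_def jacobi_integral_def val_\<phi> val_\<psi> P P2 T abN[symmetric]
      by (simp add: distrib_left mult_ac)
  qed
  have eq: "frac_jacobi_deriv \<delta> \<alpha> \<beta> \<mu> n f x = of_real (2 * \<delta>) powr (-\<mu>) * jacobi_integral n \<alpha> \<beta> F \<mu>"
    if "Re \<mu> < real n" "real n < \<tau> + Re \<mu>" for \<mu>
    unfolding F_def
    by (rule frac_jacobi_deriv_eq[OF assms(1-4) \<tau>(1) _ M that]) (use F_meas in \<open>simp_all add: F_def\<close>)
  have base: "complex_of_real (2 * \<delta>) \<notin> \<real>\<^sub>\<le>\<^sub>0"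
    using assms(4) by (simp del: of_real_mult)
  have lim: "((\<lambda>\<mu>. frac_jacobi_deriv \<delta> \<alpha> \<beta> \<mu> n f x) \<longlongrightarrow> R) (at \<nu> within {\<mu>. Re \<mu> < real n})"
  proof (rule Lim_transform_eventually)
    show "((\<lambda>\<mu>. of_real (2 * \<delta>) powr (-\<mu>) * jacobi_integral n \<alpha> \<beta> F \<mu>) \<longlongrightarrow> R) (at \<nu> within {\<mu>. Re \<mu> < real n})"
      unfolding R using base
      by (intro tendsto_mult tendsto_powr_complex tendsto_intros
            tendsto_jacobi_integral[OF assms(1-3) \<tau>(1) F_meas F_le assms(5) \<tau>(3)]) auto
    \<comment> \<open>The room left by \<epsilon> > 0: orders \<mu> close to \<nu> still satisfy n <
      \<tau> + Re \<mu>, so the decay assumed for \<nu> serves them too.\<close>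
    have "((\<lambda>\<mu>. \<tau> + Re \<mu>) \<longlongrightarrow> \<tau> + Re \<nu>) (at \<nu> within {\<mu>. Re \<mu> < real n})"
      by (intro tendsto_intros)
    from order_tendstoD(1)[OF this \<tau>(2)]
    have "eventually (\<lambda>\<mu>. real n < \<tau> + Re \<mu>) (at \<nu> within {\<mu>. Re \<mu> < real n})" .
    moreover have "eventually (\<lambda>\<mu>. Re \<mu> < real n) (at \<nu> within {\<mu>. Re \<mu> < real n})"
      by (auto simp: eventually_at_filter)
    ultimately show "eventually (\<lambda>\<mu>. of_real (2 * \<delta>) powr (-\<mu>) * jacobi_integral n \<alpha> \<beta> F \<mu> =
        frac_jacobi_deriv \<delta> \<alpha> \<beta> \<mu> n f x) (at \<nu> within {\<mu>. Re \<mu> < real n})"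
      by eventually_elim (simp add: eq)
  qed
  have "set_integrable lborel {1<..} \<phi> \<and> set_integrable lborel {-1<..<1} \<psi> \<and>
      (Re \<nu> < real n \<longrightarrow> frac_jacobi_deriv \<delta> \<alpha> \<beta> \<nu> n f x = R) \<and>
      (Re \<nu> = real n \<longrightarrow> ((\<lambda>\<mu>. frac_jacobi_deriv \<delta> \<alpha> \<beta> \<mu> n f x) \<longlongrightarrow> R) (at \<nu> within {\<mu>. Re \<mu> < real n}))"
    using int_\<phi> int_\<psi> eq[of \<nu>] \<tau>(2) R lim by blast
  thus "let a = complex_of_real \<alpha>; b = complex_of_real \<beta>; N = (of_nat n :: complex);
        \<phi> = (\<lambda>y::real. f (x + \<delta> * y) * (1 / complex_of_real (y + 1) powr (\<nu> + 1)) *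
               hyp2F1 (\<nu> + 1) (N + b + 1) (2 * N + a + b + 2) (complex_of_real (2 / (y + 1))));
        \<psi> = (\<lambda>y::real. f (x + \<delta> * y) *
               complex_of_real (1 - y) powr (N + a - \<nu>) *
               complex_of_real (1 + y) powr (N + b - \<nu>) *
               hyp2F1 (- \<nu>) (2 * N - \<nu> + a + b + 1) (N - \<nu> + b + 1)
                 (complex_of_real ((1 + y) / 2)));
        R = rGamma (- \<nu>) * (1 / complex_of_real \<delta> powr \<nu>) * (LBINT y:{1<..}. \<phi> y) +
            Gamma (2 * N + a + b + 2) /
              (2 powr (2 * N - \<nu> + a + b + 1) * Gamma (N + a + 1) * Gamma (N - \<nu> + b + 1)) *
              (1 / complex_of_real \<delta> powr \<nu>) * (LBINT y:{-1<..<1}. \<psi> y)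
    in set_integrable lborel {1<..} \<phi> \<and> set_integrable lborel {-1<..<1} \<psi> \<and>
       (Re \<nu> < real n \<longrightarrow> frac_jacobi_deriv \<delta> \<alpha> \<beta> \<nu> n f x = R) \<and>
       (Re \<nu> = real n \<longrightarrow>
          ((\<lambda>\<mu>. frac_jacobi_deriv \<delta> \<alpha> \<beta> \<mu> n f x) \<longlongrightarrow> R) (at \<nu> within {\<mu>. Re \<mu> < real n}))"
    unfolding Let_def R_def \<phi>_def \<psi>_def abN .
qed

end
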